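(* Let $d\ge 1$, let $\lambda>0$, and let $\Theta$ be a probability measure on $S_+^{d-1}$ with $\Theta(L\cap S_+^{d-1})<1$ for every $(d-1)$-dimensional linear subspace $L$ of $\mathbb{R}^d$. Let $\Psi_0(B_r^d\times B)$ be the number of marked intersection points in $B_r^d$ of the stationary Poisson hyperplane process with intensity $\lambda$ and spherical orientation distribution $\Theta$ (as defined in the context), and let $f_B$, $X_1,X_2,\ldots$ and $\sigma_B^{(1,d)}$ be as in the context. Let $B\in\mathcal{B}((S_+^{d-1})^d)$ be chosen such that $\sigma_B^{(1,d)}>0$. Then $$\frac{(d-1)!}{(2\lambda r)^{d-1/2}}\left(\Psi_0(B_r^d\times B)-\frac{(2\lambda r)^d}{d!}\,\mathbb{E}f_B(X_1,\ldots,X_d)\right)\xrightarrow[r\to\infty]{\mathrm{d}}\mathcal{N}(0,\sigma_B^{(1,d)}),$$ where $\xrightarrow{\mathrm{d}}$ denotes convergence in distribution and $\mathcal{N}(0,\sigma^2)$ is a Gaussian random variable with mean $0$ and variance $\sigma^2$.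
   Context: Notation. $B_r^d=\{x\in\mathbb{R}^d:\|x\|\le r\}$; $S_+^{d-1}=\{x=(x_1,\dots,x_d)\in\mathbb{R}^d:\|x\|=1,\ x_d\ge 0\}$; for $p\in\mathbb{R}$, $v\in S_+^{d-1}$, $H(p,v)=\{x\in\mathbb{R}^d:\langle x,v\rangle=p\}$; $\chi(K)=1$ if $K\ne\varnothing$ and $\chi(\varnothing)=0$; $\mathcal{B}(\cdot)$ is the Borel $\sigma$-algebra. Poisson hyperplane process. The stationary Poisson hyperplane process with intensity $\lambda$ and orientation distribution $\Theta$ is the random collection of hyperplanes $H(P_i,V_i)$, where $\Psi=\sum_{i\ge1}\delta_{(P_i,V_i)}$ is a stationary independently marked Poisson process on $\mathbb{R}$ with intensity $\lambda$ and mark distribution $\Theta$, i.e. a Poisson process on $\mathbb{R}\times S_+^{d-1}$ with intensity measure $\lambda\,dp\,\Theta(dv)$. Ordering. Fix a linear ordering $\preceq$ on $S_+^{d-1}$ for which sorting is Borel measurable (e.g. the lexicographic order); for $v_1,\dots,v_d\in S_+^{d-1}$ let $(v_{(1)},\dots,v_{(d)})$ be the re-ordered tuple with $v_{(1)}\preceq\cdots\preceq v_{(d)}$. Kernel and counting variable. For $r>0$ and $B\in\mathcal{B}((S_+^{d-1})^d)$ put $$f_B((p_1,v_1),\ldots,(p_d,v_d))=\chi\big(H(p_1,v_1)\cap\cdots\cap H(p_d,v_d)\cap B_r^d\big)\,\mathbb{1}_B(v_{(1)},\ldots,v_{(d)})$$ (this depends on $r$), and let $$\Psi_0(B_r^d\times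 B)=\frac1{d!}\sum^{*}f_B\big((P_{i_1},V_{i_1}),\ldots,(P_{i_d},V_{i_d})\big),$$ the sum running over all $d$-tuples of pairwise distinct indices $i_1,\dots,i_d$; this is the number of intersection points in $B_r^d$ of $d$ distinct hyperplanes whose ordered orientation vectors lie in $B$. Auxiliary variables. For given $r>0$, $X_1,X_2,\ldots$ are i.i.d. random elements $X_i=(P_i,V_i)$ of $[-r,r]\times S_+^{d-1}$ with independent components, $P_i$ uniform on $[-r,r]$ and $V_i$ with distribution $\Theta$. Define $$\sigma_B^{(1,d)}=\mathbb{E}\big(f_B(X_1,\ldots,X_d)\,f_B(X_d,\ldots,X_{2d-1})\big).$$ Neither $\mathbb{E}f_B(X_1,\ldots,X_d)$ nor $\sigma_B^{(1,d)}$ depends on $r>0$. *)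

theory Defs
  imports "HOL-Probability.Probability"
begin

section \<open>The half sphere and hyperplanes\<close>

text \<open>
  The dimension is \<open>d = CARD('n)\<close>. The index type carries a linear order so that \<open>\<real>\<^sup>d\<close> has a
  last coordinate. A \<open>d\<close>-tuple is a function on \<open>{..<d}\<close>; the points, orientation vectors and
  auxiliary variables are therefore indexed from 0.
\<close>

definition half_sphere :: "(real ^ 'n::{finite,linorder}) set" where
  "half_sphere = {x. norm x = 1 \<and> x $ Max UNIV \<ge> 0}"

abbreviation half_sphere_borel :: "(real ^ 'n::{finite,linorder}) measure" where
  "half_sphere_borel \<equiv> restrict_space borel half_sphere"

definition hyperplane :: "real \<Rightarrow> real ^ 'n::{finite,linorder} \<Rightarrow> (real ^ 'n::{finite,linorder}) set" where
  "hyperplane p v = {x. x \<bullet> v = p}"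

definition chi :: "'a set \<Rightarrow> real" where
  "chi K = (if K = {} then 0 else 1)"

section \<open>Ordering of orientation tuples\<close>

abbreviation tuple_borel :: "(nat \<Rightarrow> real ^ 'n::{finite,linorder}) measure" where
  "tuple_borel \<equiv> PiM {..<CARD('n)} (\<lambda>_. half_sphere_borel)"

text \<open>
  For a linear order \<open>R\<close> on the half sphere there is exactly one such tuple, although the
  permutation need not be unique.
\<close>

definition sort_tuple ::
    "(real ^ 'n::{finite,linorder}) rel \<Rightarrow> (nat \<Rightarrow> real ^ 'n::{finite,linorder}) \<Rightarrow> nat \<Rightarrow> real ^ 'n::{finite,linorder}" where
  "sort_tuple R v = (THE w. w \<in> extensional {..<CARD('n)} \<and>
     (\<exists>\<pi>. \<pi> permutes {..<CARD('n)} \<and> (\<forall>i<CARD('n). w i = v (\<pi> i))) \<and>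
     (\<forall>i j. i \<le> j \<and> j < CARD('n) \<longrightarrow> (w i, w j) \<in> R))"

section \<open>Kernel and number of marked intersection points\<close>

definition hyp_kernel ::
    "(real ^ 'n::{finite,linorder}) rel \<Rightarrow> real \<Rightarrow> (nat \<Rightarrow> real ^ 'n::{finite,linorder}) set \<Rightarrow>
      (nat \<Rightarrow> real \<times> (real ^ 'n::{finite,linorder})) \<Rightarrow> real" where
  "hyp_kernel R r B x =
     chi ((\<Inter>i<CARD('n). hyperplane (fst (x i)) (snd (x i))) \<inter> cball 0 r) *
     indicator B (sort_tuple R (\<lambda>i. snd (x i)))"

text \<open>
  For a Poisson hyperplane process almost surely only finitely many hyperplanes hit the ball, so
  the sum below has finitely many nonzero terms; the default value 0 of the infinite sum
  matters on a null set only.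
\<close>

definition intersection_count ::
    "(real ^ 'n::{finite,linorder}) rel \<Rightarrow> (nat \<Rightarrow> 'w \<Rightarrow> real \<times> (real ^ 'n::{finite,linorder})) \<Rightarrow>
      real \<Rightarrow> (nat \<Rightarrow> real ^ 'n::{finite,linorder}) set \<Rightarrow> 'w \<Rightarrow> real" where
  "intersection_count R Y r B \<omega> =
     1 / fact (CARD('n)) *
     (\<Sum>\<^sub>\<infinity>\<iota> \<in> {\<iota> \<in> {..<CARD('n)} \<rightarrow>\<^sub>E UNIV. inj_on \<iota> {..<CARD('n)}}.
        hyp_kernel R r B (\<lambda>k. Y (\<iota> k) \<omega>))"

section \<open>Poisson processes\<close>

definition point_count :: "(nat \<Rightarrow> 'w \<Rightarrow> 'x) \<Rightarrow> 'x set \<Rightarrow> 'w \<Rightarrow> ennreal" where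
  "point_count Y A \<omega> = (\<Sum>i. indicator A (Y i \<omega>))"

text \<open>
  The random measure \<open>\<Sum>\<^sub>i \<delta>\<^bsub>Y i\<^esub>\<close> is a Poisson process with intensity measure \<open>\<Lambda>\<close>. The points
  are enumerated by all natural numbers, so this is meant for intensity measures of infinite
  total mass, where there are almost surely infinitely many points.
\<close>

definition poisson_process ::
    "'w measure \<Rightarrow> 'x measure \<Rightarrow> (nat \<Rightarrow> 'w \<Rightarrow> 'x) \<Rightarrow> bool" where
  "poisson_process M \<Lambda> Y \<longleftrightarrow>
     (\<forall>i. Y i \<in> measurable M \<Lambda>) \<and>
     (\<forall>A\<in>sets \<Lambda>. emeasure \<Lambda> A < \<infinity> \<longrightarrow>
        (\<forall>k. measure M {\<omega> \<in> space M. point_count Y A \<omega> = of_nat k} =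
           measure \<Lambda> A ^ k / fact k * exp (- measure \<Lambda> A))) \<and>
     (\<forall>A\<in>sets \<Lambda>. emeasure \<Lambda> A = \<infinity> \<longrightarrow> (AE \<omega> in M. point_count Y A \<omega> = \<infinity>)) \<and>
     (\<forall>m (A :: nat \<Rightarrow> 'x set). disjoint_family_on A {..<m} \<and> (\<forall>j<m. A j \<in> sets \<Lambda>) \<longrightarrow>
        prob_space.indep_vars M (\<lambda>_. borel) (\<lambda>j. point_count Y (A j)) {..<m})"

definition poisson_hyperplane_process ::
    "'w measure \<Rightarrow> real \<Rightarrow> (real ^ 'n::{finite,linorder}) measure \<Rightarrow>
      (nat \<Rightarrow> 'w \<Rightarrow> real \<times> (real ^ 'n::{finite,linorder})) \<Rightarrow> bool" where
  "poisson_hyperplane_process M lam \<Theta> Y \<longleftrightarrow>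
     poisson_process M (scale_measure (ennreal lam) (lborel \<Otimes>\<^sub>M \<Theta>)) Y"

section \<open>Auxiliary variables\<close>

text \<open>
  Independence of the two components of \<open>X i\<close> is expressed by the product form of its law.
\<close>

definition iid_marked_points ::
    "'v measure \<Rightarrow> (real ^ 'n::{finite,linorder}) measure \<Rightarrow> real \<Rightarrow>
      (nat \<Rightarrow> 'v \<Rightarrow> real \<times> (real ^ 'n::{finite,linorder})) \<Rightarrow> bool" where
  "iid_marked_points N \<Theta> r X \<longleftrightarrow>
     prob_space.indep_vars N (\<lambda>_. lborel \<Otimes>\<^sub>M \<Theta>) X UNIV \<and>
     (\<forall>i. distr N (lborel \<Otimes>\<^sub>M \<Theta>) (X i) = uniform_measure lborel {-r..r} \<Otimes>\<^sub>M \<Theta>)"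

definition kernel_mean ::
    "(real ^ 'n::{finite,linorder}) rel \<Rightarrow> 'v measure \<Rightarrow> (nat \<Rightarrow> 'v \<Rightarrow> real \<times> (real ^ 'n::{finite,linorder})) \<Rightarrow>
      real \<Rightarrow> (nat \<Rightarrow> real ^ 'n::{finite,linorder}) set \<Rightarrow> real" where
  "kernel_mean R N X r B = prob_space.expectation N (\<lambda>\<omega>. hyp_kernel R r B (\<lambda>i. X i \<omega>))"

text \<open>The two blocks of \<open>d\<close> variables share exactly the variable with index \<open>d - 1\<close>.\<close>

definition sigma1 ::
    "(real ^ 'n::{finite,linorder}) rel \<Rightarrow> 'v measure \<Rightarrow> (nat \<Rightarrow> 'v \<Rightarrow> real \<times> (real ^ 'n::{finite,linorder})) \<Rightarrow>
      real \<Rightarrow> (nat \<Rightarrow> real ^ 'n::{finite,linorder}) set \<Rightarrow> real" where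
  "sigma1 R N X r B = prob_space.expectation N
     (\<lambda>\<omega>. hyp_kernel R r B (\<lambda>i. X i \<omega>) * hyp_kernel R r B (\<lambda>i. X (CARD('n) - 1 + i) \<omega>))"

section \<open>Convergence in distribution\<close>

text \<open>
  The library notion \<open>weak_conv_m\<close> covers sequences only; this is the same condition
  along an arbitrary filter.
\<close>

definition converges_in_distribution ::
    "'w measure \<Rightarrow> ('r \<Rightarrow> 'w \<Rightarrow> real) \<Rightarrow> real measure \<Rightarrow> 'r filter \<Rightarrow> bool" where
  "converges_in_distribution M Z \<mu> F \<longleftrightarrow>
     (\<forall>\<^sub>F r in F. Z r \<in> borel_measurable M) \<and>
     (\<forall>x. isCont (cdf \<mu>) x \<longrightarrow> ((\<lambda>r. cdf (distr M borel (Z r)) x) \<longlongrightarrow> cdf \<mu> x) F)"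

definition gaussian :: "real \<Rightarrow> real \<Rightarrow> real measure" where
  "gaussian m s2 = density lborel (\<lambda>x. ennreal (normal_density m (sqrt s2) x))"

end

theory Submission
  imports Defs "HOL-Real_Asymp.Real_Asymp"
begin

text \<open>
  Only hyperplanes with \<open>\<bar>p\<bar> \<le> r\<close> meet the ball, so the count depends on the points of the Poisson
  process in the window \<open>[-r, r] \<times> S\<close>. Given that there are \<open>n\<close> of them, they are, up to their
  enumeration, \<open>n\<close> independent points with the normalised intensity as law; hence the count is
  distributed as a U-statistic \<open>U\<^sub>N\<close> of independent points, where \<open>N\<close> is Poisson with parameter
  \<open>\<mu> = 2 \<lambda> r\<close>. Subtracting from \<open>f\<close> its projection on functions of a single point leaves a
  degenerate kernel, whose U-statistic has second moment \<open>O(n\<^bsup>2d-2\<^esup>)\<close> because two tuples sharing at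
  most one point are uncorrelated. What remains is a compound Poisson sum of the projections
  \<open>g(X\<^sub>i) = E(f | X\<^sub>i)\<close>, whose characteristic function is explicit. The terms that come from the
  centring by \<open>E f\<close> combine so that the limit variance is \<open>E g\<^sup>2\<close> and not \<open>Var g\<close>; by conditioning
  on the shared point, \<open>E g\<^sup>2\<close> is \<open>sigma1\<close>. The error bounds are uniform in the law of the
  points and in the kernel, so \<open>r\<close> need not be scaled away.
\<close>

section \<open>Poisson processes conditioned on the number of points\<close>

text \<open>The definition of a Poisson process speaks of counts in disjoint sets only; the
  enumeration \<open>Y\<close> is arbitrary, so no single \<open>Y i\<close> has a known law. The
  way round is to sum over all \<open>fact n\<close> enumerations of the points in the window: such
  a sum does not depend on how \<open>Y\<close> lists them, and for rectangles it is determined by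
  finitely many counts. The number \<open>n\<close> of points fluctuates by the order
  \<open>sqrt \<mu>\<close>, and after normalisation this moves the U-statistic as much as the
  linear term does. Hence the linear statistic is centred by the deterministic
  \<open>\<mu> * mean\<close> and not by \<open>n * mean\<close>, which absorbs the part of the
  falling factorial that is linear in \<open>n / \<mu> - 1\<close>. The quadratic part is negligible
  as long as the deviation of \<open>n\<close> from \<open>\<mu>\<close> is of smaller order than
  \<open>\<mu> powr (3/4)\<close>, and this leaves enough room for Chebyshev's inequality. The law
  of the points and the kernel both change with \<open>r\<close>, so no limit theorem for one fixed
  sequence of variables applies; estimates of characteristic functions with constants that depend on
  \<open>d\<close> and \<open>t\<close> only take its place.\<close>

definition inj_tuples :: "nat \<Rightarrow> 'a set \<Rightarrow> (nat \<Rightarrow> 'a) set" where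
  "inj_tuples n I = {e \<in> {..<n} \<rightarrow>\<^sub>E I. inj_on e {..<n}}"

text \<open>The new entry must carry the label \<open>\<tau> n\<close> and differ from all earlier
  entries; a clash is possible only with earlier entries of the same label, hence the restricted
  image that is removed.\<close>

lemma inj_tuples_Suc_bij:
  "bij_betw (\<lambda>(e, i). e(n := i))
     (SIGMA e:{e \<in> inj_tuples n I. \<forall>k<n. lab (e k) = \<tau> k}. {i \<in> I. lab i = \<tau> n} - e ` {l\<in>{..<n}. \<tau> l = \<tau> n})
     {e \<in> inj_tuples (Suc n) I. \<forall>k<Suc n. lab (e k) = \<tau> k}"
proof (rule bij_betwI[where g = "\<lambda>e. (e(n := undefined), e n)"], goal_cases)
  case 1
  show ?case
    by (fastforce simp: inj_tuples_def lessThan_Suc PiE_iff extensional_def inj_on_def)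
next
  case 2
  show ?case
    by (auto simp: inj_tuples_def lessThan_Suc PiE_iff extensional_def inj_on_def)
next
  case (3 x)
  then show ?case
    by (auto simp: inj_tuples_def PiE_iff extensional_def fun_eq_iff)
next
  case (4 x)
  then show ?case
    by (auto simp: fun_eq_iff)
qed

text \<open>Entries are chosen one after another; at step \<open>k\<close> the values already used
  up in the class of \<open>\<tau> k\<close> are those of the earlier slots with that label.
  Truncated subtraction is correct here: a class that is too small produces a factor 0.\<close>

lemma card_inj_tuples_label:
  assumes "finite I"
  shows "card {e \<in> inj_tuples n I. \<forall>k<n. lab (e k) = \<tau> k} =
    (\<Prod>k<n. card {i \<in> I. lab i = \<tau> k} - card {l\<in>{..<k}. \<tau> l = \<tau> k})"
proof (induction n)
  case 0
  have "{e \<in> inj_tuples 0 I. \<forall>k<0. lab (e k) = \<tau> k} = {\<lambda>_. undefined}"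
    by (auto simp: inj_tuples_def)
  then show ?case by simp
next
  case (Suc n)
  let ?S = "{e \<in> inj_tuples n I. \<forall>k<n. lab (e k) = \<tau> k}"
  let ?T = "\<lambda>e. {i \<in> I. lab i = \<tau> n} - e ` {l\<in>{..<n}. \<tau> l = \<tau> n}"
  have fin: "finite ?S"
    using finite_PiE[of "{..<n}" "\<lambda>_. I"] assms by (auto simp: inj_tuples_def)
  have T: "card (?T e) = card {i \<in> I. lab i = \<tau> n} - card {l\<in>{..<n}. \<tau> l = \<tau> n}" if e: "e \<in> ?S" for e
  proof -
    have "e ` {l\<in>{..<n}. \<tau> l = \<tau> n} \<subseteq> {i \<in> I. lab i = \<tau> n}"
      using e by (auto simp: inj_tuples_def)
    moreover have "card (e ` {l\<in>{..<n}. \<tau> l = \<tau> n}) = card {l\<in>{..<n}. \<tau> l = \<tau> n}"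
      using e by (intro card_image) (auto simp: inj_tuples_def inj_on_def)
    ultimately show ?thesis by (simp add: card_Diff_subset)
  qed
  have "card {e \<in> inj_tuples (Suc n) I. \<forall>k<Suc n. lab (e k) = \<tau> k} = card (SIGMA e:?S. ?T e)"
    by (rule bij_betw_same_card[OF inj_tuples_Suc_bij, symmetric])
  also have "\<dots> = (\<Sum>e\<in>?S. card (?T e))"
    using fin assms by (intro card_SigmaI) auto
  also have "\<dots> = card ?S * (card {i \<in> I. lab i = \<tau> n} - card {l\<in>{..<n}. \<tau> l = \<tau> n})"
    using T by simp
  finally show ?case using Suc by simp
qed

text \<open>Grouping the factors by label turns the product into falling factorials, one for each
  label, of length the multiplicity of the label in \<open>\<tau>\<close>; labels that do not occur
  contribute empty products.\<close>

lemma prod_falling_label: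
  fixes a :: "'a \<Rightarrow> nat" and n :: nat
  assumes "finite J" "\<forall>k<n. \<tau> k \<in> J"
  shows "(\<Prod>k<n. a (\<tau> k) - card {l\<in>{..<k}. \<tau> l = \<tau> k}) = (\<Prod>j\<in>J. \<Prod>i<card {l\<in>{..<n}. \<tau> l = j}. a j - i)"
  using assms(2)
proof (induction n)
  case (Suc n)
  have c: "card {l\<in>{..<Suc n}. \<tau> l = j} = card {l\<in>{..<n}. \<tau> l = j} + (if j = \<tau> n then 1 else 0)" for j
  proof -
    have "{l\<in>{..<Suc n}. \<tau> l = j} = {l\<in>{..<n}. \<tau> l = j} \<union> (if j = \<tau> n then {n} else {})"
      by (auto simp: less_Suc_eq)
    then show ?thesis by simp
  qed
  have "(\<Prod>j\<in>J. \<Prod>i<card {l\<in>{..<Suc n}. \<tau> l = j}. a j - i) =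
    (\<Prod>j\<in>J. (\<Prod>i<card {l\<in>{..<n}. \<tau> l = j}. a j - i) * (if j = \<tau> n then a j - card {l\<in>{..<n}. \<tau> l = j} else 1))"
    by (intro prod.cong refl) (simp only: c, simp)
  also have "\<dots> = (\<Prod>j\<in>J. \<Prod>i<card {l\<in>{..<n}. \<tau> l = j}. a j - i) * (a (\<tau> n) - card {l\<in>{..<n}. \<tau> l = \<tau> n})"
    using Suc.prems assms(1) by (simp add: prod.distrib)
  finally show ?case using Suc by simp
qed simp

lemma prod_falling_eq_fact: "(\<Prod>i<m. m - i) = fact (m::nat)"
  by (simp add: fact_prod_rev atLeast0LessThan)


lemma card_label_fibres:
  assumes "finite J" "\<forall>k\<in>I. \<tau> k \<in> J" "finite I"
  shows "(\<Sum>j\<in>J. card {l\<in>I. \<tau> l = j}) = card I"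
proof -
  have "card (\<Union>j\<in>J. {l\<in>I. \<tau> l = j}) = (\<Sum>j\<in>J. card {l\<in>I. \<tau> l = j})"
    using assms by (intro card_UN_disjoint) auto
  moreover have "(\<Union>j\<in>J. {l\<in>I. \<tau> l = j}) = I" using assms by auto
  ultimately show ?thesis by simp
qed

section \<open>Counts of points and sums over enumerations\<close>

lemma point_count_eq_emeasure:
  "point_count Y A \<omega> = emeasure (count_space UNIV) {i. Y i \<omega> \<in> A}"
proof -
  have "point_count Y A \<omega> = (\<integral>\<^sup>+i. indicator {i. Y i \<omega> \<in> A} i \<partial>count_space UNIV)"
    by (simp add: point_count_def nn_integral_count_space_nat indicator_def)
  then show ?thesis by simp
qed

lemma point_count_eq_of_nat_iff:
  "point_count Y A \<omega> = of_nat n \<longleftrightarrow> finite {i. Y i \<omega> \<in> A} \<and> card {i. Y i \<omega> \<in> A} = n"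
  by (cases "finite {i. Y i \<omega> \<in> A}") (auto simp: point_count_eq_emeasure)

lemma measurable_point_count [measurable]:
  assumes [measurable]: "\<And>i. Y i \<in> measurable M \<Lambda>" "A \<in> sets \<Lambda>"
  shows "point_count Y A \<in> borel_measurable M"
  unfolding point_count_def by measurable

lemma poisson_process_joint_prob:
  assumes "prob_space M" and P: "poisson_process M \<Lambda> Y"
    and C: "disjoint_family_on C {..<L::nat}" "\<And>j. j < L \<Longrightarrow> C j \<in> sets \<Lambda>"
      "\<And>j. j < L \<Longrightarrow> emeasure \<Lambda> (C j) < \<infinity>"
  shows "measure M {\<omega> \<in> space M. \<forall>j<L. point_count Y (C j) \<omega> = of_nat (m j)} =
    (\<Prod>j<L. measure \<Lambda> (C j) ^ m j / fact (m j) * exp (- measure \<Lambda> (C j)))"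
\<comment> \<open>The product rule for independent variables is stated for nonempty index sets, so
  the empty family is settled separately.\<close>
proof (cases "L = 0")
  case True
  interpret prob_space M by fact
  show ?thesis using True by (simp add: prob_space)
next
  case False
  interpret prob_space M by fact
  have ind: "indep_vars (\<lambda>_. borel) (\<lambda>j. point_count Y (C j)) {..<L}"
    using P C unfolding poisson_process_def by blast
  have "prob (\<Inter>j\<in>{..<L}. point_count Y (C j) -` {of_nat (m j)} \<inter> space M) =
    (\<Prod>j<L. prob (point_count Y (C j) -` {of_nat (m j)} \<inter> space M))"
    using False by (intro indep_varsD_finite[OF ind]) auto
  also have "(\<Inter>j\<in>{..<L}. point_count Y (C j) -` {of_nat (m j)} \<inter> space M) =
      {\<omega> \<in> space M. \<forall>j<L. point_count Y (C j) \<omega> = of_nat (m j)}"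
    using False by auto
  also have "(\<Prod>j<L. prob (point_count Y (C j) -` {of_nat (m j)} \<inter> space M)) =
     (\<Prod>j<L. measure \<Lambda> (C j) ^ m j / fact (m j) * exp (- measure \<Lambda> (C j)))"
  proof (intro prod.cong refl)
    fix j assume "j \<in> {..<L}"
    then have "measure M {\<omega> \<in> space M. point_count Y (C j) \<omega> = of_nat (m j)} =
        measure \<Lambda> (C j) ^ m j / fact (m j) * exp (- measure \<Lambda> (C j))"
      using P C unfolding poisson_process_def by auto
    moreover have "point_count Y (C j) -` {of_nat (m j)} \<inter> space M = {\<omega> \<in> space M. point_count Y (C j) \<omega> = of_nat (m j)}"
      by auto
    ultimately show "prob (point_count Y (C j) -` {of_nat (m j)} \<inter> space M) =
        measure \<Lambda> (C j) ^ m j / fact (m j) * exp (- measure \<Lambda> (C j))" by simp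
  qed
  finally show ?thesis .
qed

text \<open>With \<open>n\<close> points in \<open>W\<close>, the number of injective tuples that
  follow the label pattern \<open>\<tau>\<close> is a product of falling factorials of the counts,
  of lengths \<open>m j\<close>. Counts and multiplicities both sum to \<open>n\<close>, so either
  they agree and the product is that of the \<open>fact (m j)\<close>, or some count is too small
  and the product vanishes. The sum over enumerations thus becomes an event about counts on disjoint
  sets, the only thing the definition of the process controls.\<close>

lemma labelled_tuple_count:
  fixes lab :: "'x \<Rightarrow> nat"
  assumes C: "\<And>j. C j = {x \<in> W. lab x = j}" and lab: "\<And>x. x \<in> W \<Longrightarrow> lab x < L"
    and \<tau>: "\<forall>k<n. \<tau> k < L"
  defines "m \<equiv> \<lambda>j. card {l\<in>{..<n}. \<tau> l = j}"
  shows "(\<integral>\<^sup>+e. (\<Prod>k<n. indicator (C (\<tau> k)) (Y (e k) \<omega>)) \<partial>count_space (inj_tuples n UNIV)) *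
      indicator {\<omega>. point_count Y W \<omega> = of_nat n} \<omega> =
    (if \<forall>j<L. point_count Y (C j) \<omega> = of_nat (m j) then ennreal (\<Prod>j<L. fact (m j)) else 0)"
proof -
  define I where "I = {i. Y i \<omega> \<in> W}"
  have IC: "{i. Y i \<omega> \<in> C j} = {i \<in> I. lab (Y i \<omega>) = j}" for j
    by (auto simp: C I_def)
  have summ: "(\<Sum>j<L. m j) = n"
    unfolding m_def using \<tau> card_label_fibres[of "{..<L}" "{..<n}" \<tau>] by auto
  show ?thesis
  proof (cases "finite I \<and> card I = n")
    case False
    have "\<not> (\<forall>j<L. point_count Y (C j) \<omega> = of_nat (m j))"
    proof
      assume a: "\<forall>j<L. point_count Y (C j) \<omega> = of_nat (m j)"
      have fI: "finite I"
      proof (rule finite_subset)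
        show "I \<subseteq> (\<Union>j<L. {i. Y i \<omega> \<in> C j})" using lab by (auto simp: IC I_def)
        show "finite (\<Union>j<L. {i. Y i \<omega> \<in> C j})" using a by (auto simp: point_count_eq_of_nat_iff)
      qed
      then have "card I = (\<Sum>j<L. card {i \<in> I. lab (Y i \<omega>) = j})"
        using card_label_fibres[of "{..<L}" I "\<lambda>i. lab (Y i \<omega>)"] lab by (auto simp: I_def)
      also have "\<dots> = n" using a summ by (simp add: point_count_eq_of_nat_iff IC)
      finally show False using False fI by simp
    qed
    moreover have "point_count Y W \<omega> \<noteq> of_nat n"
      using False by (simp add: point_count_eq_of_nat_iff I_def)
    ultimately show ?thesis by auto
  next
    case True
    define N where "N j = card {i \<in> I. lab (Y i \<omega>) = j}" for j
    have pW: "point_count Y W \<omega> = of_nat n"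
      using True by (simp add: point_count_eq_of_nat_iff I_def)
    have pC: "point_count Y (C j) \<omega> = of_nat k \<longleftrightarrow> N j = k" for j k
      using True by (auto simp: point_count_eq_of_nat_iff IC N_def)
    let ?S = "{e \<in> inj_tuples n I. \<forall>k<n. lab (Y (e k) \<omega>) = \<tau> k}"
    have finS: "finite ?S"
      using finite_PiE[of "{..<n}" "\<lambda>_. I"] True by (auto simp: inj_tuples_def)
    have "(\<integral>\<^sup>+e. (\<Prod>k<n. indicator (C (\<tau> k)) (Y (e k) \<omega>)) \<partial>count_space (inj_tuples n UNIV)) =
      (\<integral>\<^sup>+e. indicator ?S e \<partial>count_space (inj_tuples n UNIV))"
    proof (intro nn_integral_cong)
      fix e :: "nat \<Rightarrow> nat" assume "e \<in> space (count_space (inj_tuples n UNIV))"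
      then have "e \<in> ?S \<longleftrightarrow> (\<forall>k<n. Y (e k) \<omega> \<in> C (\<tau> k))"
        by (auto simp: inj_tuples_def C I_def PiE_iff)
      then show "(\<Prod>k<n. indicator (C (\<tau> k)) (Y (e k) \<omega>)) = (indicator ?S e :: ennreal)"
        by (auto simp: indicator_def prod_zero_iff)
    qed
    also have "\<dots> = of_nat (card ?S)"
    proof -
      have "?S \<subseteq> inj_tuples n UNIV" by (auto simp: inj_tuples_def)
      then show ?thesis using finS by (simp add: emeasure_count_space_finite)
    qed
    also have "card ?S = (\<Prod>j<L. \<Prod>i<m j. N j - i)"
      using True \<tau> card_inj_tuples_label[of I n "\<lambda>i. lab (Y i \<omega>)" \<tau>] prod_falling_label[of "{..<L}" n \<tau> N]
      by (simp add: N_def m_def)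
    also have "\<dots> = (if \<forall>j<L. N j = m j then \<Prod>j<L. fact (m j) else 0)"
    proof (cases "\<forall>j<L. N j = m j")
      case T: False
      have "(\<Sum>j<L. N j) = n"
        unfolding N_def using True card_label_fibres[of "{..<L}" I "\<lambda>i. lab (Y i \<omega>)"] lab by (auto simp: I_def)
      have "\<exists>j<L. N j < m j"
      proof (rule ccontr)
        assume "\<not> (\<exists>j<L. N j < m j)"
        then have ge: "\<And>j. j \<in> {..<L} \<Longrightarrow> m j \<le> N j" by force
        moreover obtain j0 where "j0 < L" "m j0 < N j0" using T ge by force
        ultimately have "(\<Sum>j<L. m j) < (\<Sum>j<L. N j)"
          by (intro sum_strict_mono_ex1) auto
        then show False using summ \<open>(\<Sum>j<L. N j) = n\<close> by simp
      qed
      then obtain j where j: "j < L" "N j < m j" by auto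
      \<comment> \<open>truncated subtraction: the factor \<open>i = N j\<close> vanishes\<close>
      then have "(\<Prod>i<m j. N j - i) = 0" by (intro prod_zero) auto
      then have "(\<Prod>j<L. \<Prod>i<m j. N j - i) = 0" using j by (intro prod_zero) auto
      then show ?thesis using T by auto
    qed (simp add: prod_falling_eq_fact)
    finally have eq: "(\<integral>\<^sup>+e. (\<Prod>k<n. indicator (C (\<tau> k)) (Y (e k) \<omega>)) \<partial>count_space (inj_tuples n UNIV)) =
      of_nat (if \<forall>j<L. N j = m j then \<Prod>j<L. fact (m j) else 0)" .
    have eqv: "(\<forall>j<L. point_count Y (C j) \<omega> = of_nat (m j)) \<longleftrightarrow> (\<forall>j<L. N j = m j)"
      by (simp add: pC)
    have ind: "indicator {\<omega>. point_count Y W \<omega> = of_nat n} \<omega> = (1 :: ennreal)"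
      using pW by simp
    show ?thesis
      unfolding eq eqv ind by (simp add: ennreal_of_nat_eq_real_of_nat)
  qed
qed

text \<open>The factorials of \<open>labelled_tuple_count\<close> cancel those of the Poisson
  probabilities, and the exponentials multiply to that of \<open>W\<close> because the
  \<open>C j\<close> partition it. The powers with exponents \<open>m j\<close> are then spread
  again over the slots \<open>k\<close>.\<close>

lemma poisson_process_labelled_tuples:
  fixes lab :: "'x \<Rightarrow> nat"
  assumes M: "prob_space M" and P: "poisson_process M \<Lambda> Y"
    and C: "\<And>j. C j = {x \<in> W. lab x = j}" and lab: "\<And>x. x \<in> W \<Longrightarrow> lab x < L"
    and \<tau>: "\<forall>k<n. \<tau> k < L"
    and C_sets: "\<And>j. C j \<in> sets \<Lambda>" and W: "W \<in> sets \<Lambda>" "emeasure \<Lambda> W < \<infinity>"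
  shows "(\<integral>\<^sup>+\<omega>. (\<integral>\<^sup>+e. (\<Prod>k<n. indicator (C (\<tau> k)) (Y (e k) \<omega>)) \<partial>count_space (inj_tuples n UNIV)) *
      indicator {\<omega>. point_count Y W \<omega> = of_nat n} \<omega> \<partial>M) =
    ennreal (exp (- measure \<Lambda> W) * (\<Prod>k<n. measure \<Lambda> (C (\<tau> k))))"
proof -
  interpret prob_space M by fact
  define m where "m j = card {l\<in>{..<n}. \<tau> l = j}" for j
  have [measurable]: "\<And>i. Y i \<in> measurable M \<Lambda>" using P by (simp add: poisson_process_def)
  note C_sets[measurable]
  have fin: "emeasure \<Lambda> (C j) < \<infinity>" for j
    using emeasure_mono[of "C j" W \<Lambda>] W by (auto simp: C intro: le_less_trans)
  have disj: "disjoint_family_on C {..<L}" by (auto simp: disjoint_family_on_def C)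
  let ?D = "{\<omega> \<in> space M. \<forall>j<L. point_count Y (C j) \<omega> = of_nat (m j)}"
  have D[measurable]: "?D \<in> sets M" by measurable
  have "(\<integral>\<^sup>+\<omega>. (\<integral>\<^sup>+e. (\<Prod>k<n. indicator (C (\<tau> k)) (Y (e k) \<omega>)) \<partial>count_space (inj_tuples n UNIV)) *
      indicator {\<omega>. point_count Y W \<omega> = of_nat n} \<omega> \<partial>M) = (\<integral>\<^sup>+\<omega>. ennreal (\<Prod>j<L. fact (m j)) * indicator ?D \<omega> \<partial>M)"
    by (intro nn_integral_cong) (simp add: labelled_tuple_count[OF C lab \<tau>] m_def)
  also have "\<dots> = ennreal (\<Prod>j<L. fact (m j)) * emeasure M ?D"
    by (rule nn_integral_cmult_indicator) measurable
  also have "\<dots> = ennreal ((\<Prod>j<L. fact (m j)) * measure M ?D)"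
    by (simp add: emeasure_eq_measure ennreal_mult'' prod_nonneg)
  also have "(\<Prod>j<L. fact (m j)) * measure M ?D =
     (\<Prod>j<L. exp (- measure \<Lambda> (C j)) * measure \<Lambda> (C j) ^ m j)"
    by (subst poisson_process_joint_prob[OF M P disj]) (use fin in \<open>auto simp: C_sets prod.distrib prod_dividef\<close>)
  also have "\<dots> = exp (- (\<Sum>j<L. measure \<Lambda> (C j))) * (\<Prod>j<L. measure \<Lambda> (C j) ^ m j)"
    by (simp add: prod.distrib exp_sum sum_negf[symmetric])
  also have "(\<Sum>j<L. measure \<Lambda> (C j)) = measure \<Lambda> (\<Union>j<L. C j)"
    using fin disj by (intro measure_finite_Union[symmetric]) (auto simp: C_sets less_top)
  also have "(\<Union>j<L. C j) = W" using lab by (auto simp: C)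
  also have "(\<Prod>j<L. measure \<Lambda> (C j) ^ m j) = (\<Prod>j<L. \<Prod>k\<in>{l\<in>{..<n}. \<tau> l = j}. measure \<Lambda> (C (\<tau> k)))"
    by (intro prod.cong) (auto simp: m_def)
  also have "\<dots> = (\<Prod>k<n. measure \<Lambda> (C (\<tau> k)))"
    using \<tau> by (intro prod.group) auto
  finally show ?thesis .
qed

lemma countable_inj_tuples: "countable (inj_tuples n (UNIV :: nat set))"
proof (rule countable_subset)
  show "inj_tuples n (UNIV :: nat set) \<subseteq> {..<n} \<rightarrow>\<^sub>E UNIV" by (auto simp: inj_tuples_def)
  show "countable ({..<n} \<rightarrow>\<^sub>E (UNIV :: nat set))" by (rule countable_PiE) auto
qed

text \<open>The tuple ranges over a countable set, so joint measurability reduces to that of each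
  \<open>Y i\<close>.\<close>

lemma measurable_pair_tuple:
  fixes Y :: "nat \<Rightarrow> 'w \<Rightarrow> 'x"
  assumes Y: "\<And>i. Y i \<in> measurable M \<Lambda>"
  shows "(\<lambda>x. Y (snd x k) (fst x)) \<in> measurable (M \<Otimes>\<^sub>M count_space (inj_tuples n UNIV)) \<Lambda>"
  by (rule measurable_compose_countable'[where f = "\<lambda>e x. Y (e k) (fst x)" and g = snd and I = "inj_tuples n UNIV"])
     (auto intro: countable_inj_tuples measurable_compose[OF measurable_fst Y])

lemma prod_indicator_ennreal:
  "finite I \<Longrightarrow> (\<Prod>k\<in>I. indicator (A k) (f k) :: ennreal) = (if \<forall>k\<in>I. f k \<in> A k then 1 else 0)"
  by (auto simp: indicator_def prod_zero_iff)

lemma poisson_process_rectangle: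
  fixes A :: "nat \<Rightarrow> 'x set"
  assumes M: "prob_space M" and P: "poisson_process M \<Lambda> Y"
    and W: "W \<in> sets \<Lambda>" "emeasure \<Lambda> W < \<infinity>" and A: "\<And>k. k < n \<Longrightarrow> A k \<in> sets \<Lambda>"
  shows "(\<integral>\<^sup>+\<omega>. (\<integral>\<^sup>+e. (\<Prod>k<n. indicator (A k \<inter> W) (Y (e k) \<omega>)) \<partial>count_space (inj_tuples n UNIV)) *
      indicator {\<omega>. point_count Y W \<omega> = of_nat n} \<omega> \<partial>M) =
    ennreal (exp (- measure \<Lambda> W) * (\<Prod>k<n. measure \<Lambda> (A k \<inter> W)))"
proof -
  interpret prob_space M by fact
  \<comment> \<open>The atoms of the algebra generated by the sets \<open>A k\<close>, labelled by natural numbers.\<close>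
  define lab where "lab x = set_encode {k. k < n \<and> x \<in> A k}" for x
  define L where "L = Suc (Max (lab ` W))"
  have "lab ` W \<subseteq> set_encode ` Pow {..<n}" by (auto simp: lab_def)
  then have "finite (lab ` W)" by (rule finite_subset) auto
  then have lab: "lab x < L" if "x \<in> W" for x
    using that by (auto simp: L_def less_Suc_eq_le)
  define C where "C j = {x \<in> W. lab x = j}" for j
  have C_sets[measurable]: "C j \<in> sets \<Lambda>" for j
  proof -
    \<comment> \<open>In this form \<open>x\<close> enters through finitely many conditions
      \<open>x \<in> A k\<close> only, all else being constant in \<open>x\<close>, so that
      measurability of the cell is immediate.\<close>
    have *: "lab x = j \<longleftrightarrow> j = set_encode (set_decode j) \<and> (\<forall>k. k \<in> set_decode j \<longrightarrow> k < n) \<and>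
        (\<forall>k<n. k \<in> set_decode j \<longleftrightarrow> x \<in> A k)" for x
    proof
      assume "lab x = j"
      then show "j = set_encode (set_decode j) \<and> (\<forall>k. k \<in> set_decode j \<longrightarrow> k < n) \<and>
        (\<forall>k<n. k \<in> set_decode j \<longleftrightarrow> x \<in> A k)"
        by (auto simp: lab_def)
    next
      assume a: "j = set_encode (set_decode j) \<and> (\<forall>k. k \<in> set_decode j \<longrightarrow> k < n) \<and>
        (\<forall>k<n. k \<in> set_decode j \<longleftrightarrow> x \<in> A k)"
      then have "set_decode j = {k. k < n \<and> x \<in> A k}" by auto
      then show "lab x = j" using a by (simp add: lab_def)
    qed
    have "C j = {x \<in> space \<Lambda>. x \<in> W \<and> j = set_encode (set_decode j) \<and> (\<forall>k. k \<in> set_decode j \<longrightarrow> k < n) \<and>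
        (\<forall>k\<in>{..<n}. k \<in> set_decode j \<longleftrightarrow> x \<in> A k)}"
      using sets.sets_into_space[OF W(1)] unfolding C_def * by auto
    also have "\<dots> \<in> sets \<Lambda>" using W A by measurable
    finally show ?thesis .
  qed
  define T where "T k = {j\<in>{..<L}. k \<in> set_decode j}" for k
  have AC: "A k \<inter> W = (\<Union>j\<in>T k. C j)" if "k < n" for k
    using that lab by (auto simp: C_def T_def lab_def)
  have fin: "emeasure \<Lambda> (C j) < \<infinity>" for j
    using emeasure_mono[of "C j" W \<Lambda>] W by (auto simp: C_def intro: le_less_trans)
  have ind: "(\<Prod>k<n. indicator (A k \<inter> W) (y k) :: ennreal) =
      (\<Sum>\<tau>\<in>PiE {..<n} T. \<Prod>k<n. indicator (C (\<tau> k)) (y k))" for y :: "nat \<Rightarrow> 'x"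
  proof -
    have "(\<Prod>k<n. indicator (A k \<inter> W) (y k) :: ennreal) = (\<Prod>k<n. \<Sum>j\<in>T k. indicator (C j) (y k))"
    proof (intro prod.cong refl)
      fix k assume "k \<in> {..<n}"
      then show "(indicator (A k \<inter> W) (y k) :: ennreal) = (\<Sum>j\<in>T k. indicator (C j) (y k))"
        by (subst AC) (auto simp: C_def T_def disjoint_family_on_def intro!: indicator_UN_disjoint)
    qed
    also have "\<dots> = (\<Sum>\<tau>\<in>PiE {..<n} T. \<Prod>k<n. indicator (C (\<tau> k)) (y k))"
      by (rule prod_sum_PiE) (auto simp: T_def)
    finally show ?thesis .
  qed
  have [measurable]: "\<And>i. Y i \<in> measurable M \<Lambda>" using P by (simp add: poisson_process_def)
  have [measurable]: "(\<lambda>x. Y (snd x k) (fst x)) \<in> measurable (M \<Otimes>\<^sub>M count_space (inj_tuples n UNIV)) \<Lambda>" for k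
    by (rule measurable_pair_tuple) measurable
  interpret E: sigma_finite_measure "count_space (inj_tuples n (UNIV :: nat set))"
    by (rule sigma_finite_measure_count_space_countable[OF countable_inj_tuples])
  have meas[measurable]: "(\<lambda>\<omega>. \<integral>\<^sup>+e. (\<Prod>k<n. indicator (C (\<tau> k)) (Y (e k) \<omega>)) \<partial>count_space (inj_tuples n UNIV))
     \<in> borel_measurable M" for \<tau>
  proof -
    have "(\<lambda>x. \<Prod>k<n. indicator (C (\<tau> k)) (Y (snd x k) (fst x)) :: ennreal)
      \<in> borel_measurable (M \<Otimes>\<^sub>M count_space (inj_tuples n UNIV))" by measurable
    then show ?thesis by (intro E.borel_measurable_nn_integral) (simp add: split_beta')
  qed
  have W' [measurable]: "W \<in> sets \<Lambda>" by fact
  have "(\<integral>\<^sup>+\<omega>. (\<integral>\<^sup>+e. (\<Prod>k<n. indicator (A k \<inter> W) (Y (e k) \<omega>)) \<partial>count_space (inj_tuples n UNIV)) *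
      indicator {\<omega>. point_count Y W \<omega> = of_nat n} \<omega> \<partial>M) =
    (\<integral>\<^sup>+\<omega>. (\<Sum>\<tau>\<in>PiE {..<n} T. (\<integral>\<^sup>+e. (\<Prod>k<n. indicator (C (\<tau> k)) (Y (e k) \<omega>)) \<partial>count_space (inj_tuples n UNIV)) *
      indicator {\<omega>. point_count Y W \<omega> = of_nat n} \<omega>) \<partial>M)"
    by (simp add: ind nn_integral_sum sum_distrib_right)
  also have "\<dots> = (\<Sum>\<tau>\<in>PiE {..<n} T. (\<integral>\<^sup>+\<omega>. (\<integral>\<^sup>+e. (\<Prod>k<n. indicator (C (\<tau> k)) (Y (e k) \<omega>)) \<partial>count_space (inj_tuples n UNIV)) *
      indicator {\<omega>. point_count Y W \<omega> = of_nat n} \<omega> \<partial>M))"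
  proof (rule nn_integral_sum)
    fix \<tau>
    have "{\<omega> \<in> space M. point_count Y W \<omega> = of_nat n} \<in> sets M" by measurable
    then have "(\<lambda>\<omega>. indicator {\<omega>. point_count Y W \<omega> = of_nat n} \<omega> :: ennreal) \<in> borel_measurable M"
      by (subst borel_measurable_indicator_iff) (simp add: Int_def conj_commute)
    then show "(\<lambda>\<omega>. (\<integral>\<^sup>+e. (\<Prod>k<n. indicator (C (\<tau> k)) (Y (e k) \<omega>)) \<partial>count_space (inj_tuples n UNIV)) *
      indicator {\<omega>. point_count Y W \<omega> = of_nat n} \<omega>) \<in> borel_measurable M"
      by measurable
  qed
  also have "\<dots> = (\<Sum>\<tau>\<in>PiE {..<n} T. ennreal (exp (- measure \<Lambda> W) * (\<Prod>k<n. measure \<Lambda> (C (\<tau> k)))))"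
    by (intro sum.cong refl poisson_process_labelled_tuples[OF M P C_def lab _ C_sets W])
       (auto simp: PiE_iff T_def)
  also have "\<dots> = ennreal (exp (- measure \<Lambda> W) * (\<Sum>\<tau>\<in>PiE {..<n} T. \<Prod>k<n. measure \<Lambda> (C (\<tau> k))))"
    by (simp add: sum_distrib_left prod_nonneg)
  also have "(\<Sum>\<tau>\<in>PiE {..<n} T. \<Prod>k<n. measure \<Lambda> (C (\<tau> k))) = (\<Prod>k<n. \<Sum>j\<in>T k. measure \<Lambda> (C j))"
    by (rule prod_sum_PiE[symmetric]) (auto simp: T_def)
  also have "\<dots> = (\<Prod>k<n. measure \<Lambda> (A k \<inter> W))"
  proof (intro prod.cong refl)
    fix k assume k: "k \<in> {..<n}"
    have "measure \<Lambda> (\<Union>j\<in>T k. C j) = (\<Sum>j\<in>T k. measure \<Lambda> (C j))"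
      using fin by (intro measure_finite_Union) (auto simp: T_def C_def disjoint_family_on_def C_sets[unfolded C_def] less_top)
    then show "(\<Sum>j\<in>T k. measure \<Lambda> (C j)) = measure \<Lambda> (A k \<inter> W)" using k by (simp add: AC)
  qed
  finally show ?thesis .
qed

text \<open>This is the Janossy measure of order \<open>n\<close> of the process in
  \<open>W\<close>, integrated against \<open>G\<close>. No factorial divides the constant, because
  every configuration of \<open>n\<close> points is counted once for each of its
  \<open>fact n\<close> enumerations. Both sides are integrals of \<open>G\<close> against finite
  measures, and these agree on rectangles.\<close>

lemma poisson_process_janossy:
  fixes G :: "(nat \<Rightarrow> 'x) \<Rightarrow> ennreal"
  assumes M: "prob_space M" and P: "poisson_process M \<Lambda> Y"
    and W: "W \<in> sets \<Lambda>" "emeasure \<Lambda> W < \<infinity>" "measure \<Lambda> W > 0"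
    and G: "G \<in> borel_measurable (PiM {..<n} (\<lambda>_. \<Lambda>))"
  shows "(\<integral>\<^sup>+\<omega>. (\<integral>\<^sup>+e. (\<Prod>k<n. indicator W (Y (e k) \<omega>)) * G (\<lambda>k\<in>{..<n}. Y (e k) \<omega>)
        \<partial>count_space (inj_tuples n UNIV)) * indicator {\<omega>. point_count Y W \<omega> = of_nat n} \<omega> \<partial>M) =
    ennreal (exp (- measure \<Lambda> W) * measure \<Lambda> W ^ n) * (\<integral>\<^sup>+x. G x \<partial>PiM {..<n} (\<lambda>_. uniform_measure \<Lambda> W))"
proof -
  interpret prob_space M by fact
  define c where "c = ennreal (exp (- measure \<Lambda> W) * measure \<Lambda> W ^ n)"
  let ?E = "count_space (inj_tuples n (UNIV :: nat set))"
  let ?Q = "uniform_measure \<Lambda> W"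
  have c: "c \<noteq> 0" "c \<noteq> \<infinity>" using W by (auto simp: c_def)
  have WQ: "emeasure \<Lambda> W \<noteq> 0" "emeasure \<Lambda> W \<noteq> \<infinity>" using W by (auto simp: measure_def)
  interpret Q: prob_space ?Q by (rule prob_space_uniform_measure[OF WQ])
  interpret QQ: product_sigma_finite "\<lambda>_::nat. ?Q" by unfold_locales
  have [measurable]: "\<And>i. Y i \<in> measurable M \<Lambda>" using P by (simp add: poisson_process_def)
  have W' [measurable]: "W \<in> sets \<Lambda>" by fact
  have [measurable]: "(\<lambda>x. Y (snd x k) (fst x)) \<in> measurable (M \<Otimes>\<^sub>M ?E) \<Lambda>" for k
    by (rule measurable_pair_tuple) measurable
  interpret E: sigma_finite_measure ?E
    by (rule sigma_finite_measure_count_space_countable[OF countable_inj_tuples])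
  define g where "g x = (\<Prod>k<n. indicator W (Y (snd x k) (fst x))) *
     (indicator {\<omega>\<in>space M. point_count Y W \<omega> = of_nat n} (fst x) :: ennreal)" for x :: "'a \<times> (nat \<Rightarrow> nat)"
  have g[measurable]: "g \<in> borel_measurable (M \<Otimes>\<^sub>M ?E)"
    unfolding g_def by measurable
  define t where "t x = (\<lambda>k\<in>{..<n}. Y (snd x k) (fst x))" for x
  have t[measurable]: "t \<in> measurable (M \<Otimes>\<^sub>M ?E) (PiM {..<n} (\<lambda>_. \<Lambda>))"
    unfolding t_def by measurable
  \<comment> \<open>The density \<open>g\<close> keeps the enumerations that stay in
    \<open>W\<close> on the event of exactly \<open>n\<close> points; dividing by \<open>c\<close>
    gives the total mass that a product of probability measures needs.\<close>
  define \<nu> where "\<nu> = distr (density (M \<Otimes>\<^sub>M ?E) (\<lambda>x. g x / c)) (PiM {..<n} (\<lambda>_. \<Lambda>)) t"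
  have nn: "(\<integral>\<^sup>+x. H x \<partial>\<nu>) = (\<integral>\<^sup>+\<omega>. (\<integral>\<^sup>+e. (\<Prod>k<n. indicator W (Y (e k) \<omega>)) * H (\<lambda>k\<in>{..<n}. Y (e k) \<omega>) \<partial>?E) *
     indicator {\<omega>. point_count Y W \<omega> = of_nat n} \<omega> \<partial>M) / c"
    if [measurable]: "H \<in> borel_measurable (PiM {..<n} (\<lambda>_. \<Lambda>))" for H
  proof -
    have "(\<integral>\<^sup>+x. H x \<partial>\<nu>) = (\<integral>\<^sup>+x. g x * H (t x) / c \<partial>(M \<Otimes>\<^sub>M ?E))"
      unfolding \<nu>_def by (simp add: nn_integral_distr nn_integral_density ennreal_times_divide mult.commute)
    also have "\<dots> = (\<integral>\<^sup>+x. g x * H (t x) \<partial>(M \<Otimes>\<^sub>M ?E)) / c"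
      by (simp add: nn_integral_divide)
    also have "(\<integral>\<^sup>+x. g x * H (t x) \<partial>(M \<Otimes>\<^sub>M ?E)) = (\<integral>\<^sup>+\<omega>. \<integral>\<^sup>+e. g (\<omega>, e) * H (t (\<omega>, e)) \<partial>?E \<partial>M)"
      by (rule E.nn_integral_fst[symmetric]) measurable
    also have "\<dots> = (\<integral>\<^sup>+\<omega>. (\<integral>\<^sup>+e. (\<Prod>k<n. indicator W (Y (e k) \<omega>)) * H (\<lambda>k\<in>{..<n}. Y (e k) \<omega>) \<partial>?E) *
     indicator {\<omega>. point_count Y W \<omega> = of_nat n} \<omega> \<partial>M)"
      by (intro nn_integral_cong) (auto simp: g_def t_def nn_integral_cmult nn_integral_multc split: split_indicator)
    finally show ?thesis .
  qed
  have "\<nu> = PiM {..<n} (\<lambda>_. ?Q)"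
  proof (rule QQ.PiM_eqI)
    show "sets \<nu> = sets (PiM {..<n} (\<lambda>_. ?Q))"
      by (simp add: \<nu>_def cong: sets_PiM_cong)
    fix A assume A: "\<And>i. i \<in> {..<n} \<Longrightarrow> A i \<in> sets ?Q"
    then have A'[measurable]: "Pi\<^sub>E {..<n} A \<in> sets (PiM {..<n} (\<lambda>_. \<Lambda>))" by (intro sets_PiM_I_finite) auto
    have "emeasure \<nu> (Pi\<^sub>E {..<n} A) = (\<integral>\<^sup>+x. indicator (Pi\<^sub>E {..<n} A) x \<partial>\<nu>)"
      by (subst nn_integral_indicator) (auto simp: \<nu>_def)
    also have "\<dots> = (\<integral>\<^sup>+\<omega>. (\<integral>\<^sup>+e. (\<Prod>k<n. indicator (A k \<inter> W) (Y (e k) \<omega>)) \<partial>?E) *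
     indicator {\<omega>. point_count Y W \<omega> = of_nat n} \<omega> \<partial>M) / c"
    proof (subst nn)
      have *: "(\<Prod>k<n. indicator W (y k)) * indicator (Pi\<^sub>E {..<n} A) (\<lambda>k\<in>{..<n}. y k) =
        (\<Prod>k<n. indicator (A k \<inter> W) (y k) :: ennreal)" for y
        unfolding prod_indicator_ennreal[OF finite_lessThan] by (auto simp: PiE_iff indicator_def)
      show "(\<integral>\<^sup>+ \<omega>. (\<integral>\<^sup>+ e. (\<Prod>k<n. indicator W (Y (e k) \<omega>)) * indicator (Pi\<^sub>E {..<n} A) (\<lambda>k\<in>{..<n}. Y (e k) \<omega>) \<partial>?E) *
         indicator {\<omega>. point_count Y W \<omega> = of_nat n} \<omega> \<partial>M) / c =
        (\<integral>\<^sup>+\<omega>. (\<integral>\<^sup>+e. (\<Prod>k<n. indicator (A k \<inter> W) (Y (e k) \<omega>)) \<partial>?E) *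
         indicator {\<omega>. point_count Y W \<omega> = of_nat n} \<omega> \<partial>M) / c"
        by (simp add: *)
    qed measurable
    also have "\<dots> = ennreal (exp (- measure \<Lambda> W) * (\<Prod>k<n. measure \<Lambda> (A k \<inter> W))) / c"
      using A by (subst poisson_process_rectangle[OF M P W(1,2)]) auto
    also have "\<dots> = ennreal (\<Prod>k<n. measure \<Lambda> (A k \<inter> W) / measure \<Lambda> W)"
      using W(3) unfolding c_def by (subst divide_ennreal) (auto simp: prod_nonneg prod_dividef)
    also have "\<dots> = (\<Prod>k<n. emeasure ?Q (A k))"
    proof (subst prod_ennreal[symmetric], simp, intro prod.cong refl)
      fix k assume "k \<in> {..<n}"
      then have a[measurable]: "A k \<in> sets \<Lambda>" using A by auto
      have "emeasure \<Lambda> (W \<inter> A k) \<le> emeasure \<Lambda> W" by (intro emeasure_mono) auto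
      then have "emeasure \<Lambda> (W \<inter> A k) < \<infinity>" using W(2) by (auto intro: le_less_trans)
      then show "ennreal (measure \<Lambda> (A k \<inter> W) / measure \<Lambda> W) = emeasure ?Q (A k)"
        using W by (simp add: Int_commute emeasure_eq_ennreal_measure less_top[symmetric] divide_ennreal)
    qed
    finally show "emeasure \<nu> (Pi\<^sub>E {..<n} A) = (\<Prod>k<n. emeasure ?Q (A k))" .
  qed simp
  with nn[OF G] have "(\<integral>\<^sup>+x. G x \<partial>PiM {..<n} (\<lambda>_. ?Q)) = (\<integral>\<^sup>+\<omega>. (\<integral>\<^sup>+e. (\<Prod>k<n. indicator W (Y (e k) \<omega>)) * G (\<lambda>k\<in>{..<n}. Y (e k) \<omega>) \<partial>?E) *
     indicator {\<omega>. point_count Y W \<omega> = of_nat n} \<omega> \<partial>M) / c" by simp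
  then show ?thesis using c unfolding c_def[symmetric]
    by (simp add: ennreal_times_divide mult_divide_eq_ennreal mult.commute[of c])
qed

section \<open>Degenerate kernels and Hoeffding residuals\<close>

text \<open>Kernels take whole sequences as arguments but are measurable with respect to a finite
  product, whose elements are extensional. This predicate mediates: it allows a kernel to be
  evaluated at a reindexed sequence without restricting it first.\<close>

definition depends_on :: "nat set \<Rightarrow> ((nat \<Rightarrow> 'x) \<Rightarrow> 'c) \<Rightarrow> bool" where
  "depends_on J F \<longleftrightarrow> (\<forall>x y. (\<forall>i\<in>J. x i = y i) \<longrightarrow> F x = F y)"

lemma depends_onD: "depends_on J F \<Longrightarrow> (\<And>i. i \<in> J \<Longrightarrow> x i = y i) \<Longrightarrow> F x = F y"
  by (auto simp: depends_on_def)

text \<open>Integrating over \<open>y\<close> realises the conditional expectation given the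
  coordinates outside \<open>J\<close>: those in \<open>J\<close> are replaced by an independent
  copy.\<close>

definition resample :: "nat set \<Rightarrow> (nat \<Rightarrow> 'x) \<Rightarrow> (nat \<Rightarrow> 'x) \<Rightarrow> nat \<Rightarrow> 'x" where
  "resample J x y i = (if i \<in> J then y i else x i)"

lemma measurable_depends_on_reindex:
  assumes F: "F \<in> measurable (PiM {..<d} (\<lambda>_. Q)) N" and dep: "depends_on {..<d} F"
    and \<iota>: "\<And>k. k < d \<Longrightarrow> \<iota> k \<in> I"
  shows "(\<lambda>x. F (\<lambda>k. x (\<iota> k))) \<in> measurable (PiM I (\<lambda>_. Q)) N"
proof -
  have "(\<lambda>x. F (\<lambda>k\<in>{..<d}. x (\<iota> k))) \<in> measurable (PiM I (\<lambda>_. Q)) N"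
    using \<iota> by (intro measurable_compose[OF _ F] measurable_restrict measurable_component_singleton) auto
  moreover have "F (\<lambda>k\<in>{..<d}. x (\<iota> k)) = F (\<lambda>k. x (\<iota> k))" for x
    by (rule depends_onD[OF dep]) auto
  ultimately show ?thesis by simp
qed

text \<open>If \<open>g\<close> is not integrable, its integral is 0 by convention, and
  \<open>c\<close> is nonnegative as an upper bound of an absolute value. So bounds on integrals
  such as \<open>proj a\<close> hold for every \<open>a\<close>, also outside the space.\<close>

lemma abs_integral_le:
  fixes g :: "'a \<Rightarrow> real"
  assumes "prob_space M" "\<And>x. \<bar>g x\<bar> \<le> c"
  shows "\<bar>\<integral>x. g x \<partial>M\<bar> \<le> c"
proof (cases "integrable M g")
  case True
  interpret prob_space M by fact
  have "\<bar>\<integral>x. g x \<partial>M\<bar> \<le> (\<integral>x. \<bar>g x\<bar> \<partial>M)" by simp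
  also have "\<dots> \<le> (\<integral>x. c \<partial>M)" using assms True by (intro integral_mono) auto
  finally show ?thesis by (simp add: prob_space)
next
  case False
  have "0 \<le> c" using assms(2)[of undefined] by simp
  then show ?thesis using False by (simp add: not_integrable_integral_eq)
qed

section \<open>Reindexing and resampling of independent coordinates\<close>

context prob_space
begin

abbreviation seq_space :: "(nat \<Rightarrow> 'a) measure" where
  "seq_space \<equiv> PiM UNIV (\<lambda>_. M)"

lemma prob_space_seq_space: "prob_space seq_space"
  by (rule prob_space_PiM) unfold_locales

text \<open>An injective choice of \<open>d\<close> coordinates of an i.i.d. sequence again has the
  product law.\<close>

lemma integral_reindex:
  fixes F :: "(nat \<Rightarrow> 'a) \<Rightarrow> 'c::{banach, second_countable_topology}"
  assumes F: "F \<in> borel_measurable (PiM {..<d} (\<lambda>_. M))" and dep: "depends_on {..<d} F"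
    and \<iota>: "inj_on \<iota> {..<d}"
  shows "(\<integral>x. F (\<lambda>k. x (\<iota> k)) \<partial>seq_space) = (\<integral>x. F x \<partial>PiM {..<d} (\<lambda>_. M))"
proof -
  have "(\<integral>x. F (\<lambda>k. x (\<iota> k)) \<partial>seq_space) = (\<integral>x. F (\<lambda>k\<in>{..<d}. x (\<iota> k)) \<partial>seq_space)"
    by (intro Bochner_Integration.integral_cong refl depends_onD[OF dep]) auto
  also have "\<dots> = (\<integral>x. F x \<partial>distr seq_space (PiM {..<d} (\<lambda>_. M)) (\<lambda>x. \<lambda>k\<in>{..<d}. x (\<iota> k)))"
    by (rule integral_distr[symmetric]) (use F in measurable)
  also have "distr seq_space (PiM {..<d} (\<lambda>_. M)) (\<lambda>x. \<lambda>k\<in>{..<d}. x (\<iota> k)) = PiM {..<d} (\<lambda>_. M)"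
    using \<iota> by (intro distr_PiM_reindex) (auto intro: prob_space_axioms)
  finally show ?thesis .
qed

lemma integral_reindex':
  fixes F :: "(nat \<Rightarrow> 'a) \<Rightarrow> 'c::{banach, second_countable_topology}"
  assumes "F \<in> borel_measurable (PiM {..<d} (\<lambda>_. M))" "depends_on {..<d} F" "inj_on \<iota> {..<d}"
  shows "(\<integral>x. F (\<lambda>k. x (\<iota> k)) \<partial>seq_space) = (\<integral>x. F x \<partial>seq_space)"
  using integral_reindex[OF assms] integral_reindex[OF assms(1,2), of "\<lambda>k. k"] by simp

lemma integral_component:
  fixes g :: "'a \<Rightarrow> 'c::{banach, second_countable_topology}"
  assumes "g \<in> borel_measurable M"
  shows "(\<integral>x. g (x i) \<partial>seq_space) = (\<integral>a. g a \<partial>M)"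
proof -
  have "(\<integral>a. g a \<partial>distr seq_space M (\<lambda>x. x i)) = (\<integral>x. g (x i) \<partial>seq_space)"
    using assms by (intro integral_distr) auto
  then show ?thesis using distr_PiM_component[of UNIV "\<lambda>_. M" i] by (simp add: prob_space_axioms)
qed

lemma measurable_resample [measurable]:
  "(\<lambda>z. resample J (fst z) (snd z)) \<in> measurable (seq_space \<Otimes>\<^sub>M seq_space) seq_space"
proof (rule measurable_PiM_single')
  show "(\<lambda>z. resample J (fst z) (snd z) i) \<in> measurable (seq_space \<Otimes>\<^sub>M seq_space) M" for i
    unfolding resample_def by measurable
qed (auto simp: resample_def space_pair_measure space_PiM PiE_iff)

text \<open>It suffices to look at cylinders: the preimage of a cylinder over \<open>K\<close> is a
  rectangle whose sides are cylinders over \<open>K - J\<close> in the old sequence and over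
  \<open>K \<inter> J\<close> in the copy.\<close>

lemma distr_resample:
  "distr (seq_space \<Otimes>\<^sub>M seq_space) seq_space (\<lambda>z. resample J (fst z) (snd z)) = seq_space"
proof -
  interpret S: prob_space seq_space by (rule prob_space_seq_space)
  interpret SS: pair_prob_space seq_space seq_space ..
  interpret PP: product_prob_space "\<lambda>_. M" "UNIV :: nat set" by unfold_locales
  show ?thesis
  proof (rule PP.PiM_eq)
    show "sets (distr (seq_space \<Otimes>\<^sub>M seq_space) seq_space (\<lambda>z. resample J (fst z) (snd z))) = sets seq_space"
      by simp
    fix K :: "nat set" and X assume K: "finite K" and X: "\<And>j. j \<in> K \<Longrightarrow> X j \<in> sets M"
    let ?e = "\<lambda>K. prod_emb UNIV (\<lambda>_. M) K (Pi\<^sub>E K X)"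
    have *: "(\<lambda>z. resample J (fst z) (snd z)) -` ?e K \<inter> space (seq_space \<Otimes>\<^sub>M seq_space) = ?e (K - J) \<times> ?e (K \<inter> J)"
      using X[THEN sets.sets_into_space]
      by (auto simp: prod_emb_def space_pair_measure space_PiM PiE_iff resample_def split: if_splits)
    have e: "emeasure seq_space (?e L) = (\<Prod>j\<in>L. emeasure M (X j))" if "L \<subseteq> K" for L
      using that K X by (intro PP.emeasure_PiM_emb) (auto intro: finite_subset)
    have e': "?e L \<in> sets seq_space" if "L \<subseteq> K" for L
      using that K X by (intro sets_PiM_I) (auto intro: finite_subset)
    have "emeasure (distr (seq_space \<Otimes>\<^sub>M seq_space) seq_space (\<lambda>z. resample J (fst z) (snd z))) (?e K)
      = emeasure (seq_space \<Otimes>\<^sub>M seq_space) (?e (K - J) \<times> ?e (K \<inter> J))"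
      using e'[of K] by (subst emeasure_distr) (auto simp: *)
    also have "\<dots> = (\<Prod>j\<in>K - J. emeasure M (X j)) * (\<Prod>j\<in>K \<inter> J. emeasure M (X j))"
      by (subst S.emeasure_pair_measure_Times) (auto simp: e e')
    also have "\<dots> = (\<Prod>j\<in>K. emeasure M (X j))"
      using K by (subst prod.union_disjoint[symmetric]) (auto intro!: prod.cong)
    finally show "emeasure (distr (seq_space \<Otimes>\<^sub>M seq_space) seq_space (\<lambda>z. resample J (fst z) (snd z))) (?e K)
      = (\<Prod>j\<in>K. emeasure M (X j))" .
  qed
qed

lemma integral_resample:
  fixes F :: "(nat \<Rightarrow> 'a) \<Rightarrow> real"
  assumes F[measurable]: "F \<in> borel_measurable seq_space" and bd: "\<And>x. \<bar>F x\<bar> \<le> b"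
  shows "(\<integral>x. F x \<partial>seq_space) = (\<integral>x. \<integral>y. F (resample J x y) \<partial>seq_space \<partial>seq_space)"
proof -
  interpret S: prob_space seq_space by (rule prob_space_seq_space)
  interpret SS: pair_prob_space seq_space seq_space ..
  have "(\<integral>x. F x \<partial>seq_space) = (\<integral>x. F x \<partial>distr (seq_space \<Otimes>\<^sub>M seq_space) seq_space (\<lambda>z. resample J (fst z) (snd z)))"
    by (simp only: distr_resample)
  also have "\<dots> = (\<integral>z. F (resample J (fst z) (snd z)) \<partial>(seq_space \<Otimes>\<^sub>M seq_space))"
    by (rule integral_distr) measurable
  also have "\<dots> = (\<integral>x. \<integral>y. F (resample J x y) \<partial>seq_space \<partial>seq_space)"
    by (subst SS.integral_fst'[symmetric])
       (auto intro!: SS.P.integrable_const_bound[where B = b] simp: bd)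
  finally show ?thesis .
qed

text \<open>Taking out what is known: \<open>G\<close> is unchanged by the resampling, and the inner
  integral is the conditional expectation of \<open>F\<close> given the coordinates outside
  \<open>J\<close>.\<close>

lemma integral_mult_resample:
  fixes F G :: "(nat \<Rightarrow> 'a) \<Rightarrow> real"
  assumes [measurable]: "F \<in> borel_measurable seq_space" "G \<in> borel_measurable seq_space"
    and bd: "\<And>x. \<bar>F x\<bar> \<le> b" "\<And>x. \<bar>G x\<bar> \<le> c" and G: "depends_on (- J) G"
  shows "(\<integral>x. G x * F x \<partial>seq_space) = (\<integral>x. G x * (\<integral>y. F (resample J x y) \<partial>seq_space) \<partial>seq_space)"
proof -
  have "\<bar>G x * F x\<bar> \<le> c * b" for x
    unfolding abs_mult using bd[of x] order_trans[OF abs_ge_zero bd(2)] by (intro mult_mono) auto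
  then have "(\<integral>x. G x * F x \<partial>seq_space) = (\<integral>x. \<integral>y. G (resample J x y) * F (resample J x y) \<partial>seq_space \<partial>seq_space)"
    by (intro integral_resample) auto
  moreover have "G (resample J x y) = G x" for x y
    by (rule depends_onD[OF G]) (auto simp: resample_def)
  ultimately show ?thesis by simp
qed

lemma measurable_upd_tuple:
  assumes F: "F \<in> measurable (PiM {..<d} (\<lambda>_. M)) N" and l: "l < d" and a: "a \<in> space M"
  shows "(\<lambda>y. F (y(l := a))) \<in> measurable (PiM {..<d} (\<lambda>_. M)) N"
proof -
  have "{..<d} = {..<d} \<union> {l}" using l by auto
  from this _ _ have "(\<lambda>y. y(l := a)) \<in> measurable (PiM {..<d} (\<lambda>_. M)) (PiM {..<d} (\<lambda>_. M))"
    by (rule measurable_fun_upd) (use a in auto)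
  then show ?thesis by (rule measurable_compose[OF _ F])
qed

text \<open>Injectivity of \<open>\<iota>\<close> keeps \<open>\<iota> l\<close> out of the
  resampled set, so this is the conditional expectation of \<open>F\<close> given its
  \<open>l\<close>-th argument alone.\<close>

lemma integral_resample_tuple:
  fixes F :: "(nat \<Rightarrow> 'a) \<Rightarrow> real"
  assumes F: "F \<in> borel_measurable (PiM {..<d} (\<lambda>_. M))" and dep: "depends_on {..<d} F"
    and \<iota>: "inj_on \<iota> {..<d}" and l: "l < d" and x: "x (\<iota> l) \<in> space M"
  shows "(\<integral>y. F (\<lambda>k. resample (\<iota> ` ({..<d} - {l})) x y (\<iota> k)) \<partial>seq_space) =
    (\<integral>y. F (y(l := x (\<iota> l))) \<partial>seq_space)"
proof -
  let ?F = "\<lambda>y. F (y(l := x (\<iota> l)))"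
  have "(\<integral>y. F (\<lambda>k. resample (\<iota> ` ({..<d} - {l})) x y (\<iota> k)) \<partial>seq_space) = (\<integral>y. ?F (\<lambda>k. y (\<iota> k)) \<partial>seq_space)"
    using \<iota> l by (intro Bochner_Integration.integral_cong refl depends_onD[OF dep])
      (auto simp: resample_def inj_on_def)
  also have "\<dots> = (\<integral>y. ?F y \<partial>seq_space)"
    by (intro integral_reindex'[where d = d] measurable_upd_tuple F l x \<iota>)
       (auto simp: depends_on_def intro!: depends_onD[OF dep])
  finally show ?thesis .
qed

end

section \<open>Projection and residual of a bounded symmetric kernel\<close>

locale bounded_symmetric_kernel = prob_space Q for Q :: "'x measure" +
  fixes d :: nat and f :: "(nat \<Rightarrow> 'x) \<Rightarrow> real"
  assumes d_pos: "0 < d"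
    and f_measurable: "f \<in> borel_measurable (PiM {..<d} (\<lambda>_. Q))"
    and f_bound: "\<bar>f x\<bar> \<le> 1"
    and f_depends: "depends_on {..<d} f"
    and f_symmetric: "\<pi> permutes {..<d} \<Longrightarrow> f (\<lambda>i. x (\<pi> i)) = f x"
begin

sublocale S: prob_space seq_space by (rule prob_space_seq_space)

text \<open>The conditional expectation of \<open>f\<close> given one of its points; by symmetry
  slot 0 stands for every slot.\<close>

definition proj where "proj a = (\<integral>y. f (y(0 := a)) \<partial>seq_space)"
definition mean where "mean = (\<integral>x. f x \<partial>seq_space)"
text \<open>A Hoeffding decomposition stopped at order one: the constant and the centred functions
  of single points are removed, and all higher orders stay together.\<close>

definition residual where "residual x = f x - mean - (\<Sum>k<d. proj (x k) - mean)"

lemma integrable_bounded: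
  fixes g :: "(nat \<Rightarrow> 'x) \<Rightarrow> real"
  assumes "g \<in> borel_measurable seq_space" "\<And>x. \<bar>g x\<bar> \<le> b"
  shows "integrable seq_space g"
  by (rule S.integrable_const_bound[where B = b]) (use assms in auto)

lemma f_reindex_measurable [measurable]: "(\<lambda>x. f (\<lambda>k. x (\<iota> k))) \<in> borel_measurable seq_space"
  by (rule measurable_depends_on_reindex[OF f_measurable f_depends]) auto

lemma f_measurable_seq [measurable]: "f \<in> borel_measurable seq_space"
  using f_reindex_measurable[of "\<lambda>k. k"] by simp

lemma proj_measurable [measurable]: "proj \<in> borel_measurable Q"
proof -
  have "(\<lambda>z. (snd z)(0 := fst z)) \<in> measurable (Q \<Otimes>\<^sub>M seq_space) seq_space"
    by (intro measurable_fun_upd[where J = UNIV]) auto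
  then have "(\<lambda>z. f ((snd z)(0 := fst z))) \<in> borel_measurable (Q \<Otimes>\<^sub>M seq_space)"
    by (rule measurable_compose) measurable
  then show ?thesis unfolding proj_def by (intro S.borel_measurable_lebesgue_integral) (simp add: split_beta')
qed

lemma proj_bound: "\<bar>proj a\<bar> \<le> 1"
  unfolding proj_def by (intro abs_integral_le S.prob_space_axioms f_bound)

lemma mean_bound: "\<bar>mean\<bar> \<le> 1"
  unfolding mean_def by (intro abs_integral_le S.prob_space_axioms f_bound)

text \<open>A transposition moves the fixed argument from slot \<open>l\<close> to slot 0. It
  permutes the free coordinates, which their common law does not notice.\<close>

lemma integral_f_upd:
  assumes l: "l < d" and a: "a \<in> space Q"
  shows "(\<integral>y. f (y(l := a)) \<partial>seq_space) = proj a"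
proof -
  let ?t = "Transposition.transpose 0 l"
  have t: "?t permutes {..<d}" using l d_pos by (intro permutes_swap_id) auto
  have "f (y(l := a)) = f ((\<lambda>k. y (?t k))(0 := a))" for y
  proof -
    have "f (y(l := a)) = f (\<lambda>k. (y(l := a)) (?t k))" by (rule f_symmetric[OF t, symmetric])
    also have "(\<lambda>k. (y(l := a)) (?t k)) = (\<lambda>k. y (?t k))(0 := a)"
      by (auto simp: Transposition.transpose_def fun_eq_iff)
    finally show ?thesis .
  qed
  then have "(\<integral>y. f (y(l := a)) \<partial>seq_space) = (\<integral>y. (\<lambda>y. f (y(0 := a))) (\<lambda>k. y (?t k)) \<partial>seq_space)"
    by simp
  also have "\<dots> = (\<integral>y. f (y(0 := a)) \<partial>seq_space)"
    by (intro integral_reindex'[where d = d] measurable_upd_tuple f_measurable d_pos a)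
       (auto simp: depends_on_def intro!: depends_onD[OF f_depends] inj_on_subset[OF permutes_inj[OF t]])
  finally show ?thesis by (simp add: proj_def)
qed

lemma integral_mult_f:
  assumes [measurable]: "G \<in> borel_measurable seq_space" and bd: "\<And>x. \<bar>G x\<bar> \<le> c"
    and \<iota>: "inj_on \<iota> {..<d}" and l: "l < d" and G: "depends_on (- \<iota> ` ({..<d} - {l})) G"
  shows "(\<integral>x. G x * f (\<lambda>k. x (\<iota> k)) \<partial>seq_space) = (\<integral>x. G x * proj (x (\<iota> l)) \<partial>seq_space)"
proof -
  have "(\<integral>x. G x * f (\<lambda>k. x (\<iota> k)) \<partial>seq_space) =
     (\<integral>x. G x * (\<integral>y. f (\<lambda>k. resample (\<iota> ` ({..<d} - {l})) x y (\<iota> k)) \<partial>seq_space) \<partial>seq_space)"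
    by (rule integral_mult_resample[OF _ _ f_bound bd G]) measurable
  also have "\<dots> = (\<integral>x. G x * proj (x (\<iota> l)) \<partial>seq_space)"
  proof (intro Bochner_Integration.integral_cong refl)
    fix x assume "x \<in> space seq_space"
    then have "x (\<iota> l) \<in> space Q" by (auto simp: space_PiM)
    then show "G x * (\<integral>y. f (\<lambda>k. resample (\<iota> ` ({..<d} - {l})) x y (\<iota> k)) \<partial>seq_space) = G x * proj (x (\<iota> l))"
      by (simp add: integral_resample_tuple[OF f_measurable f_depends \<iota> l] integral_f_upd l)
  qed
  finally show ?thesis .
qed

lemma integral_proj: "(\<integral>a. proj a \<partial>Q) = mean"
  using integral_mult_f[of "\<lambda>_. 1" 1 "\<lambda>k. k" 0] integral_component[of proj 0] d_pos
  by (simp add: depends_on_def mean_def)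

text \<open>Condition twice on the shared point: averaging the second factor over the coordinates
  that it does not share leaves \<open>proj\<close>, and then the first factor is averaged in the
  same way.\<close>

lemma integral_overlap_one:
  assumes \<iota>: "inj_on \<iota> {..<d}" and \<kappa>: "inj_on \<kappa> {..<d}" and "k < d" "l < d" "\<iota> k = \<kappa> l"
    and disj: "\<iota> ` ({..<d} - {k}) \<inter> \<kappa> ` ({..<d} - {l}) = {}"
  shows "(\<integral>x. f (\<lambda>i. x (\<iota> i)) * f (\<lambda>i. x (\<kappa> i)) \<partial>seq_space) = (\<integral>a. (proj a)\<^sup>2 \<partial>Q)"
proof -
  have "depends_on (- \<kappa> ` ({..<d} - {l})) (\<lambda>x. f (\<lambda>i. x (\<iota> i)))"
  proof -
    have "\<iota> i \<notin> \<kappa> ` ({..<d} - {l})" if "i < d" for i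
      using that disj \<kappa> assms(3-5) by (cases "i = k") (auto simp: inj_on_def)
    then show ?thesis
      unfolding depends_on_def by (auto intro!: depends_onD[OF f_depends])
  qed
  then have "(\<integral>x. f (\<lambda>i. x (\<iota> i)) * f (\<lambda>i. x (\<kappa> i)) \<partial>seq_space) = (\<integral>x. f (\<lambda>i. x (\<iota> i)) * proj (x (\<kappa> l)) \<partial>seq_space)"
    using assms by (intro integral_mult_f[OF _ f_bound]) auto
  also have "\<dots> = (\<integral>x. proj (x (\<kappa> l)) * f (\<lambda>i. x (\<iota> i)) \<partial>seq_space)" by (simp add: mult.commute)
  also have "\<dots> = (\<integral>x. proj (x (\<kappa> l)) * proj (x (\<iota> k)) \<partial>seq_space)"
  proof (intro integral_mult_f[OF _ proj_bound \<iota>])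
    have "\<kappa> l \<notin> \<iota> ` ({..<d} - {k})"
      using \<iota> assms(3-5) by (auto simp: inj_on_def simp flip: \<open>\<iota> k = \<kappa> l\<close>)
    then show "depends_on (- \<iota> ` ({..<d} - {k})) (\<lambda>x. proj (x (\<kappa> l)))"
      by (auto simp: depends_on_def)
  qed (use assms in auto)
  also have "\<dots> = (\<integral>a. (proj a)\<^sup>2 \<partial>Q)"
    using integral_component[of "\<lambda>a. (proj a)\<^sup>2" "\<kappa> l"] assms(5) by (simp add: power2_eq_square)
  finally show ?thesis .
qed

lemma residual_depends: "depends_on {..<d} residual"
proof -
  have "residual x = residual y" if "\<forall>i\<in>{..<d}. x i = y i" for x y
    using that depends_onD[OF f_depends, of x y] by (simp add: residual_def)
  then show ?thesis by (auto simp: depends_on_def)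
qed

lemma residual_measurable: "residual \<in> borel_measurable (PiM {..<d} (\<lambda>_. Q))"
  unfolding residual_def using f_measurable by measurable

lemma residual_reindex_measurable [measurable]: "(\<lambda>x. residual (\<lambda>k. x (\<iota> k))) \<in> borel_measurable seq_space"
  by (rule measurable_depends_on_reindex[OF residual_measurable residual_depends]) auto

lemma residual_bound: "\<bar>residual x\<bar> \<le> 2 * d + 2"
proof -
  have "\<bar>\<Sum>k<d. proj (x k) - mean\<bar> \<le> (\<Sum>k<d. 2)"
  proof (rule order_trans[OF sum_abs], rule sum_mono)
    show "\<bar>proj (x k) - mean\<bar> \<le> 2" for k
      using proj_bound[of "x k"] mean_bound by linarith
  qed
  then show ?thesis
    unfolding residual_def using f_bound[of x] mean_bound by simp
qed

text \<open>This is the degeneracy of the residual. With slot \<open>l\<close> fixed,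
  \<open>f - mean\<close> averages to \<open>proj a - mean\<close>, which the \<open>l\<close>-th
  summand cancels, and the other summands average to 0.\<close>

lemma integral_residual_upd:
  assumes l: "l < d" and a: "a \<in> space Q"
  shows "(\<integral>y. residual (y(l := a)) \<partial>seq_space) = 0"
proof -
  have "depends_on {..<d} (\<lambda>y. f (y(l := a)))"
    by (auto simp: depends_on_def intro!: depends_onD[OF f_depends])
  then have [measurable]: "(\<lambda>y. f (y(l := a))) \<in> borel_measurable seq_space"
    using measurable_depends_on_reindex[OF measurable_upd_tuple[OF f_measurable l a], of "\<lambda>k. k" UNIV]
    by simp
  have m: "(\<lambda>y. proj ((y(l := a)) k)) \<in> borel_measurable seq_space" for k
    using a by (cases "k = l") auto
  have i: "integrable seq_space (\<lambda>y. proj ((y(l := a)) k))" for k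
    by (rule integrable_bounded[OF m proj_bound])
  have "(\<integral>y. residual (y(l := a)) \<partial>seq_space) =
     proj a - mean - (\<Sum>k<d. (\<integral>y. proj ((y(l := a)) k) \<partial>seq_space) - mean)"
    unfolding residual_def
    using i by (simp add: integral_f_upd[OF l a] integrable_bounded[OF _ f_bound] S.prob_space del: fun_upd_apply)
  also have "(\<Sum>k<d. (\<integral>y. proj ((y(l := a)) k) \<partial>seq_space) - mean) = (\<Sum>k<d. if k = l then proj a - mean else 0)"
    by (intro sum.cong refl) (auto simp: S.prob_space integral_component integral_proj)
  finally show ?thesis using l by (simp add: fun_upd_def)
qed

text \<open>The only point that the tuples can share is \<open>\<kappa> l\<close>. Resampling the
  other entries of \<open>\<kappa>\<close> leaves the first factor alone, and the second is
  annihilated by degeneracy.\<close>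

lemma integral_residual_overlap:
  assumes \<iota>: "inj_on \<iota> {..<d}" and \<kappa>: "inj_on \<kappa> {..<d}" and l: "l < d"
    and disj: "\<iota> ` {..<d} \<inter> \<kappa> ` ({..<d} - {l}) = {}"
  shows "(\<integral>x. residual (\<lambda>i. x (\<iota> i)) * residual (\<lambda>i. x (\<kappa> i)) \<partial>seq_space) = 0"
proof -
  have dep: "depends_on (- \<kappa> ` ({..<d} - {l})) (\<lambda>x. residual (\<lambda>i. x (\<iota> i)))"
    unfolding depends_on_def using disj by (auto intro!: depends_onD[OF residual_depends])
  have "(\<integral>x. residual (\<lambda>i. x (\<iota> i)) * residual (\<lambda>i. x (\<kappa> i)) \<partial>seq_space) =
     (\<integral>x. residual (\<lambda>i. x (\<iota> i)) * (\<integral>y. residual (\<lambda>k. resample (\<kappa> ` ({..<d} - {l})) x y (\<kappa> k)) \<partial>seq_space) \<partial>seq_space)"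
    by (rule integral_mult_resample[OF _ _ residual_bound residual_bound dep]) measurable
  also have "\<dots> = (\<integral>x. 0 \<partial>seq_space)"
  proof (intro Bochner_Integration.integral_cong refl)
    fix x assume "x \<in> space seq_space"
    then have "x (\<kappa> l) \<in> space Q" by (auto simp: space_PiM)
    then show "residual (\<lambda>i. x (\<iota> i)) * (\<integral>y. residual (\<lambda>k. resample (\<kappa> ` ({..<d} - {l})) x y (\<kappa> k)) \<partial>seq_space) = 0"
      by (simp add: integral_resample_tuple[OF residual_measurable residual_depends \<kappa> l] integral_residual_upd l)
  qed
  finally show ?thesis by simp
qed

end

section \<open>U-statistics of a fixed number of points\<close>

lemma finite_inj_tuples: "finite I \<Longrightarrow> finite (inj_tuples n I)"
  using finite_PiE[of "{..<n}" "\<lambda>_. I"] by (auto simp: inj_tuples_def)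

lemma card_inj_tuples: "finite I \<Longrightarrow> card (inj_tuples n I) = (\<Prod>k<n. card I - k)"
  using card_inj_tuples_label[of I n "\<lambda>_. ()" "\<lambda>_. ()"] by (simp add: lessThan_def[symmetric])

lemma card_inj_tuples_le: "finite I \<Longrightarrow> card (inj_tuples n I) \<le> card I ^ n"
  unfolding card_inj_tuples by (rule order_trans[OF prod_mono[where g = "\<lambda>_. card I"]]) auto

text \<open>Exchanging two values in all tuples maps those with \<open>i\<close> in slot
  \<open>k\<close> injectively to those with \<open>j\<close> there, so every index occupies the
  slot equally often.\<close>

lemma sum_inj_tuples_component:
  fixes g :: "nat \<Rightarrow> real"
  assumes k: "k < d" and n: "n > 0"
  shows "(\<Sum>\<iota>\<in>inj_tuples d {..<n}. g (\<iota> k)) = real (card (inj_tuples d {..<n})) / n * (\<Sum>i<n. g i)"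
proof -
  let ?S = "inj_tuples d {..<n}"
  define c where "c i = card {\<iota>\<in>?S. \<iota> k = i}" for i
  have le: "c i \<le> c j" if ij: "i < n" "j < n" for i j
    unfolding c_def
  proof (rule card_inj_on_le[where f = "\<lambda>\<iota>. \<lambda>l\<in>{..<d}. Transposition.transpose i j (\<iota> l)"])
    show "finite {\<iota> \<in> ?S. \<iota> k = j}" by (auto intro: finite_subset[OF _ finite_inj_tuples[of "{..<n}" d]])
    show "inj_on (\<lambda>\<iota>. \<lambda>l\<in>{..<d}. Transposition.transpose i j (\<iota> l)) {\<iota> \<in> ?S. \<iota> k = i}"
    proof (rule inj_onI)
      fix x y assume x: "x \<in> {\<iota> \<in> ?S. \<iota> k = i}" and y: "y \<in> {\<iota> \<in> ?S. \<iota> k = i}"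
        and eq: "(\<lambda>l\<in>{..<d}. Transposition.transpose i j (x l)) = (\<lambda>l\<in>{..<d}. Transposition.transpose i j (y l))"
      have "x l = y l" if "l \<in> {..<d}" for l
        using arg_cong[OF fun_cong[OF eq, of l], of "Transposition.transpose i j"] that by simp
      then show "x = y" using x y by (auto simp: inj_tuples_def intro: PiE_ext)
    qed
    show "(\<lambda>\<iota>. \<lambda>l\<in>{..<d}. Transposition.transpose i j (\<iota> l)) ` {\<iota> \<in> ?S. \<iota> k = i} \<subseteq> {\<iota> \<in> ?S. \<iota> k = j}"
      using ij k by (auto simp: inj_tuples_def inj_on_def PiE_iff Transposition.transpose_def split: if_splits)
  qed
  have c: "c i = c 0" if "i < n" for i using le[of i 0] le[of 0 i] that n by simp
  have "card ?S = (\<Sum>i<n. c i)"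
    unfolding c_def
  proof (rule card_label_fibres[symmetric])
    show "\<forall>\<iota>\<in>?S. \<iota> k \<in> {..<n}" using k by (auto simp: inj_tuples_def)
  qed (simp_all add: finite_inj_tuples)
  also have "\<dots> = (\<Sum>i<n. c 0)" by (intro sum.cong refl c) simp
  also have "\<dots> = n * c 0" by simp
  finally have card: "real (card ?S) / n = real (c 0)" using n by simp
  have "(\<Sum>\<iota>\<in>?S. g (\<iota> k)) = (\<Sum>i<n. \<Sum>\<iota>\<in>{\<iota>\<in>?S. \<iota> k = i}. g (\<iota> k))"
    using k by (intro sum.group[symmetric] finite_inj_tuples) (auto simp: inj_tuples_def)
  also have "\<dots> = (\<Sum>i<n. real (c i) * g i)" by (intro sum.cong) (auto simp: c_def)
  also have "\<dots> = (\<Sum>i<n. real (c 0) * g i)"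
    by (intro sum.cong refl arg_cong2[where f = "(*)"] arg_cong[where f = real] c) simp
  also have "\<dots> = real (c 0) * (\<Sum>i<n. g i)"
    by (simp add: sum_distrib_left)
  finally show ?thesis by (simp add: card)
qed

text \<open>Two slots of \<open>\<kappa>\<close> are pinned to entries of \<open>\<iota>\<close>,
  which can be specified in at most \<open>d ^ 4\<close> ways, and \<open>d - 2\<close> slots remain
  free. The factor \<open>n\<^sup>2\<close> on the left keeps truncated subtraction out of the
  exponent.\<close>

lemma card_double_overlap:
  assumes \<iota>: "\<iota> \<in> inj_tuples d {..<n}"
  shows "card {\<kappa>\<in>inj_tuples d {..<n}. \<exists>k1<d. \<exists>k2<d. \<exists>l1<d. \<exists>l2<d. l1 \<noteq> l2 \<and> \<kappa> l1 = \<iota> k1 \<and> \<kappa> l2 = \<iota> k2}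
     * n\<^sup>2 \<le> d ^ 4 * n ^ d"
proof -
  let ?D = "{..<d} \<times> {..<d} \<times> {..<d} \<times> {..<d}"
  define F where "F = (\<lambda>(k1, k2, l1, l2). if l1 = l2 then {} else
      PiE {..<d} (\<lambda>i. if i = l1 then {\<iota> k1} else if i = l2 then {\<iota> k2} else {..<n}))"
  have fin: "finite (F z)" for z
    by (auto simp: F_def split: prod.splits intro!: finite_PiE)
  have card: "card (F z) * n\<^sup>2 \<le> n ^ d" if "z \<in> ?D" for z
  proof -
    obtain k1 k2 l1 l2 where z: "z = (k1, k2, l1, l2)" by (cases z) auto
    show ?thesis
    proof (cases "l1 = l2")
      case False
      have "card (F z) = (\<Prod>i<d. if i = l1 then 1 else if i = l2 then 1 else n)"
        using False by (auto simp: F_def z card_PiE intro!: prod.cong)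
      also have "\<dots> = (\<Prod>i\<in>{..<d} - {l1, l2}. n)"
        using that by (intro prod.mono_neutral_cong_right) (auto simp: z)
      also have "\<dots> = n ^ (d - 2)"
      proof -
        have "card ({..<d} - {l1, l2}) = d - 2"
          using False that by (subst card_Diff_subset) (auto simp: z)
        then show ?thesis by simp
      qed
      finally have "card (F z) * n\<^sup>2 = n ^ (d - 2 + 2)" by (simp only: power_add)
      also have "d - 2 + 2 = d" using False that by (auto simp: z)
      finally show ?thesis by simp
    qed (simp add: F_def z)
  qed
  have "{\<kappa>\<in>inj_tuples d {..<n}. \<exists>k1<d. \<exists>k2<d. \<exists>l1<d. \<exists>l2<d. l1 \<noteq> l2 \<and> \<kappa> l1 = \<iota> k1 \<and> \<kappa> l2 = \<iota> k2} \<subseteq> (\<Union>z\<in>?D. F z)"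
  proof
    fix \<kappa> assume "\<kappa> \<in> {\<kappa>\<in>inj_tuples d {..<n}. \<exists>k1<d. \<exists>k2<d. \<exists>l1<d. \<exists>l2<d. l1 \<noteq> l2 \<and> \<kappa> l1 = \<iota> k1 \<and> \<kappa> l2 = \<iota> k2}"
    then obtain k1 k2 l1 l2 where k: "\<kappa> \<in> inj_tuples d {..<n}" "k1 < d" "k2 < d" "l1 < d" "l2 < d" "l1 \<noteq> l2"
      "\<kappa> l1 = \<iota> k1" "\<kappa> l2 = \<iota> k2" by blast
    then have "\<kappa> \<in> F (k1, k2, l1, l2)" by (auto simp: F_def inj_tuples_def PiE_iff)
    then show "\<kappa> \<in> (\<Union>z\<in>?D. F z)" using k by auto
  qed
  then have "card {\<kappa>\<in>inj_tuples d {..<n}. \<exists>k1<d. \<exists>k2<d. \<exists>l1<d. \<exists>l2<d. l1 \<noteq> l2 \<and> \<kappa> l1 = \<iota> k1 \<and> \<kappa> l2 = \<iota> k2}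
     \<le> card (\<Union>z\<in>?D. F z)"
    using fin by (intro card_mono) auto
  also have "\<dots> \<le> (\<Sum>z\<in>?D. card (F z))" by (rule card_UN_le) auto
  finally have "card {\<kappa>\<in>inj_tuples d {..<n}. \<exists>k1<d. \<exists>k2<d. \<exists>l1<d. \<exists>l2<d. l1 \<noteq> l2 \<and> \<kappa> l1 = \<iota> k1 \<and> \<kappa> l2 = \<iota> k2} * n\<^sup>2
     \<le> (\<Sum>z\<in>?D. card (F z)) * n\<^sup>2" by (rule mult_right_mono) auto
  also have "\<dots> = (\<Sum>z\<in>?D. card (F z) * n\<^sup>2)" by (rule sum_distrib_right)
  also have "\<dots> \<le> (\<Sum>z\<in>?D. n ^ d)" by (rule sum_mono) (rule card)
  also have "\<dots> = d ^ 4 * n ^ d" by (simp add: card_cartesian_product power4_eq_xxxx)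
  finally show ?thesis .
qed

text \<open>The Cauchy-Schwarz bound in the form of the inequality of the arithmetic and geometric
  mean: \<open>2 * \<bar>g x\<bar>\<close> is at most \<open>(g x)\<^sup>2 / b + b\<close>, and both
  terms have mean at most \<open>b\<close>.\<close>

lemma (in prob_space) expectation_abs_le_of_square:
  fixes g :: "'a \<Rightarrow> real"
  assumes "g \<in> borel_measurable M" "integrable M (\<lambda>x. (g x)\<^sup>2)"
    and le: "(\<integral>x. (g x)\<^sup>2 \<partial>M) \<le> b\<^sup>2" and "b > 0"
  shows "(\<integral>x. \<bar>g x\<bar> \<partial>M) \<le> b"
proof -
  have am: "\<bar>g x\<bar> \<le> ((g x)\<^sup>2 / b + b) / 2" for x
  proof -
    have "0 \<le> (\<bar>g x\<bar> - b)\<^sup>2 / b" using \<open>b > 0\<close> by simp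
    also have "\<dots> = (g x)\<^sup>2 / b + b - 2 * \<bar>g x\<bar>" using \<open>b > 0\<close>
      by (simp add: power2_diff field_simps power2_eq_square)
    finally show ?thesis by simp
  qed
  have i: "integrable M (\<lambda>x. ((g x)\<^sup>2 / b + b) / 2)" using assms(2) by simp
  have "(\<integral>x. \<bar>g x\<bar> \<partial>M) \<le> (\<integral>x. ((g x)\<^sup>2 / b + b) / 2 \<partial>M)"
  proof (intro integral_mono Bochner_Integration.integrable_bound[OF i] i am)
    show "AE x in M. norm \<bar>g x\<bar> \<le> norm (((g x)\<^sup>2 / b + b) / 2)"
      using order_trans[OF am abs_ge_self] by simp
  qed (use assms(1) in measurable)
  also have "\<dots> = ((\<integral>x. (g x)\<^sup>2 \<partial>M) / b + b) / 2" using assms(2) by (simp add: prob_space)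
  also have "\<dots> \<le> (b\<^sup>2 / b + b) / 2"
    using \<open>b > 0\<close> le by (intro divide_right_mono add_mono) auto
  also have "\<dots> = b" using \<open>b > 0\<close> by (simp add: power2_eq_square)
  finally show ?thesis .
qed

section \<open>Decomposition of the U-statistic and moment bounds\<close>

context bounded_symmetric_kernel
begin

text \<open>A sum and not an average: division by \<open>fact d\<close> counts every set of
  \<open>d\<close> indices once, as in \<open>intersection_count\<close>.\<close>

definition ustat :: "nat \<Rightarrow> (nat \<Rightarrow> 'x) \<Rightarrow> real" where
  "ustat n x = (\<Sum>\<iota>\<in>inj_tuples d {..<n}. f (\<lambda>k. x (\<iota> k))) / fact d"

definition ustat_residual :: "nat \<Rightarrow> (nat \<Rightarrow> 'x) \<Rightarrow> real" where
  "ustat_residual n x = (\<Sum>\<iota>\<in>inj_tuples d {..<n}. residual (\<lambda>k. x (\<iota> k))) / fact d"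

lemma ustat_measurable [measurable]: "ustat n \<in> borel_measurable seq_space"
  unfolding ustat_def by measurable

lemma ustat_residual_measurable [measurable]: "ustat_residual n \<in> borel_measurable seq_space"
  unfolding ustat_residual_def by measurable

text \<open>The definition of the residual is summed over all tuples; as every index fills each of
  the \<open>d\<close> slots with the same frequency, the projections add up to a multiple of their
  plain sum.\<close>

lemma ustat_decomposition:
  assumes "n > 0"
  shows "ustat n x = ustat_residual n x +
    real (card (inj_tuples d {..<n})) * (mean + d * ((\<Sum>i<n. proj (x i)) / n - mean)) / fact d"
proof -
  let ?S = "inj_tuples d {..<n}"
  have "(\<Sum>\<iota>\<in>?S. f (\<lambda>k. x (\<iota> k))) =
    (\<Sum>\<iota>\<in>?S. residual (\<lambda>k. x (\<iota> k)) + mean - d * mean + (\<Sum>k<d. proj (x (\<iota> k))))"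
    by (simp add: residual_def sum_subtractf)
  also have "\<dots> = (\<Sum>\<iota>\<in>?S. residual (\<lambda>k. x (\<iota> k))) + card ?S * mean - card ?S * (d * mean)
      + (\<Sum>k<d. \<Sum>\<iota>\<in>?S. proj (x (\<iota> k)))"
    by (simp add: sum.distrib sum_subtractf sum.swap[of _ "{..<d}"])
  also have "(\<Sum>k<d. \<Sum>\<iota>\<in>?S. proj (x (\<iota> k))) = d * (card ?S / n * (\<Sum>i<n. proj (x i)))"
    using assms by (simp add: sum_inj_tuples_component[of _ d n "\<lambda>i. proj (x i)"])
  finally show ?thesis
    unfolding ustat_def ustat_residual_def by (simp add: field_simps)
qed

text \<open>The square is expanded over pairs of tuples, and only pairs sharing at least two points
  survive. Of these there are at most \<open>d ^ 4 * n ^ d * n ^ d / n\<^sup>2\<close>, each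
  contributing at most the square of the bound \<open>2 * d + 2\<close> for the residual. The
  right-hand side is the product of these numbers.\<close>

lemma expectation_ustat_residual_square:
  "(\<integral>x. (ustat_residual n x)\<^sup>2 \<partial>seq_space) \<le> ((2 * d + 2) * d\<^sup>2 * n ^ (d - 1))\<^sup>2"
proof -
  let ?S = "inj_tuples d {..<n}"
  let ?b = "real (2 * d + 2)"
  let ?I = "\<lambda>\<iota> \<kappa>. \<integral>x. residual (\<lambda>i. x (\<iota> i)) * residual (\<lambda>i. x (\<kappa> i)) \<partial>seq_space"
  let ?bad = "\<lambda>\<iota>. {\<kappa>\<in>?S. \<exists>k1<d. \<exists>k2<d. \<exists>l1<d. \<exists>l2<d. l1 \<noteq> l2 \<and> \<kappa> l1 = \<iota> k1 \<and> \<kappa> l2 = \<iota> k2}"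
  have fin: "finite ?S" by (simp add: finite_inj_tuples)
  have bd: "\<bar>residual (\<lambda>i. x (\<iota> i)) * residual (\<lambda>i. x (\<kappa> i))\<bar> \<le> ?b * ?b" for x \<iota> \<kappa>
    unfolding abs_mult using residual_bound by (intro mult_mono) auto
  have int: "integrable seq_space (\<lambda>x. residual (\<lambda>i. x (\<iota> i)) * residual (\<lambda>i. x (\<kappa> i)))" for \<iota> \<kappa>
    by (rule integrable_bounded[OF _ bd]) measurable
  have good: "?I \<iota> \<kappa> = 0" if "\<iota> \<in> ?S" "\<kappa> \<in> ?S - ?bad \<iota>" for \<iota> \<kappa>
  proof -
    \<comment> \<open>If the tuples meet, \<open>l\<close> is the slot of the single common point;
      if they are disjoint, any slot will do.\<close>
    have "\<exists>l<d. \<iota> ` {..<d} \<inter> \<kappa> ` ({..<d} - {l}) = {}"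
    proof (cases "\<exists>l<d. \<kappa> l \<in> \<iota> ` {..<d}")
      case True
      then obtain l k where l: "l < d" "k < d" "\<kappa> l = \<iota> k" by auto
      have "\<iota> ` {..<d} \<inter> \<kappa> ` ({..<d} - {l}) = {}"
        using that l by fastforce
      then show ?thesis using l by auto
    next
      case False
      then have "\<kappa> ` {..<d} \<inter> \<iota> ` {..<d} = {}" by (auto simp only: lessThan_iff)
      then have "\<iota> ` {..<d} \<inter> \<kappa> ` ({..<d} - {0}) = {}" by (auto simp only:)
      with d_pos show ?thesis by (intro exI[of _ 0] conjI)
    qed
    then obtain l where "l < d" "\<iota> ` {..<d} \<inter> \<kappa> ` ({..<d} - {l}) = {}" by auto
    then show ?thesis using that by (intro integral_residual_overlap) (auto simp: inj_tuples_def)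
  qed
  have "(\<integral>x. (ustat_residual n x)\<^sup>2 \<partial>seq_space) =
    (\<integral>x. (\<Sum>\<iota>\<in>?S. \<Sum>\<kappa>\<in>?S. residual (\<lambda>i. x (\<iota> i)) * residual (\<lambda>i. x (\<kappa> i))) / (fact d)\<^sup>2 \<partial>seq_space)"
    unfolding ustat_residual_def power2_eq_square by (simp add: sum_product)
  also have "\<dots> = (\<Sum>\<iota>\<in>?S. \<Sum>\<kappa>\<in>?S. ?I \<iota> \<kappa>) / (fact d)\<^sup>2"
    using int by (simp add: Bochner_Integration.integral_sum)
  also have "\<dots> \<le> \<bar>\<Sum>\<iota>\<in>?S. \<Sum>\<kappa>\<in>?S. ?I \<iota> \<kappa>\<bar>"
  proof -
    have "(1::real) \<le> (fact d)\<^sup>2" by (simp add: power2_eq_square mult_ge1_I)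
    have "(\<Sum>\<iota>\<in>?S. \<Sum>\<kappa>\<in>?S. ?I \<iota> \<kappa>) / (fact d)\<^sup>2 \<le> \<bar>\<Sum>\<iota>\<in>?S. \<Sum>\<kappa>\<in>?S. ?I \<iota> \<kappa>\<bar> / (fact d)\<^sup>2"
      by (intro divide_right_mono) auto
    also have "\<dots> \<le> \<bar>\<Sum>\<iota>\<in>?S. \<Sum>\<kappa>\<in>?S. ?I \<iota> \<kappa>\<bar> / 1"
      using \<open>1 \<le> (fact d)\<^sup>2\<close> by (intro divide_left_mono) auto
    finally show ?thesis by simp
  qed
  also have "\<dots> \<le> (\<Sum>\<iota>\<in>?S. ?b * ?b * real (card (?bad \<iota>)))"
  proof (rule order_trans[OF sum_abs], rule sum_mono)
    fix \<iota> assume \<iota>: "\<iota> \<in> ?S"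
    have eq: "(\<Sum>\<kappa>\<in>?S. ?I \<iota> \<kappa>) = (\<Sum>\<kappa>\<in>?bad \<iota>. ?I \<iota> \<kappa>)"
      using good[OF \<iota>] fin by (intro sum.mono_neutral_right) auto
    have "\<bar>\<Sum>\<kappa>\<in>?bad \<iota>. ?I \<iota> \<kappa>\<bar> \<le> (\<Sum>\<kappa>\<in>?bad \<iota>. ?b * ?b)"
    proof (rule order_trans[OF sum_abs], rule sum_mono)
      show "\<bar>?I \<iota> \<kappa>\<bar> \<le> ?b * ?b" for \<kappa>
        by (intro abs_integral_le S.prob_space_axioms bd)
    qed
    also have "\<dots> = ?b * ?b * real (card (?bad \<iota>))" by simp
    finally show "\<bar>\<Sum>\<kappa>\<in>?S. ?I \<iota> \<kappa>\<bar> \<le> ?b * ?b * real (card (?bad \<iota>))"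
      unfolding eq .
  qed
  finally have *: "(\<integral>x. (ustat_residual n x)\<^sup>2 \<partial>seq_space) \<le> (\<Sum>\<iota>\<in>?S. ?b * ?b * real (card (?bad \<iota>)))" .
  show ?thesis
  proof (cases "n = 0")
    case True
    then have "?S = {}" using d_pos by (auto simp: inj_tuples_def PiE_eq_empty_iff)
    then show ?thesis by (simp add: ustat_residual_def)
  next
    case False
    have "(\<Sum>\<iota>\<in>?S. ?b * ?b * real (card (?bad \<iota>))) * (real n)\<^sup>2 = (\<Sum>\<iota>\<in>?S. ?b * ?b * real (card (?bad \<iota>) * n\<^sup>2))"
      by (simp add: sum_distrib_right mult.assoc)
    also have "\<dots> \<le> (\<Sum>\<iota>\<in>?S. ?b * ?b * real (d ^ 4 * n ^ d))"
      by (intro sum_mono mult_left_mono of_nat_mono card_double_overlap) auto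
    also have "\<dots> = ?b * ?b * real (d ^ 4 * n ^ d) * real (card ?S)" by simp
    also have "\<dots> \<le> ?b * ?b * real (d ^ 4 * n ^ d) * real (n ^ d)"
      using card_inj_tuples_le[of "{..<n}" d] by (intro mult_left_mono of_nat_mono) auto
    also have "\<dots> = ((2 * d + 2) * d\<^sup>2 * n ^ (d - 1))\<^sup>2 * (real n)\<^sup>2"
    proof -
      have "n ^ d = n ^ (d - 1) * n" using d_pos by (simp add: power_eq_if)
      then show ?thesis by (simp add: power2_eq_square power4_eq_xxxx algebra_simps)
    qed
    finally show ?thesis using False * by simp
  qed
qed

text \<open>Too crude for the limit, since it is of order \<open>n ^ d\<close>; it serves
  integrability.\<close>

lemma ustat_residual_bound: "\<bar>ustat_residual n x\<bar> \<le> real (card (inj_tuples d {..<n})) * (2 * d + 2)"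
proof -
  have "\<bar>ustat_residual n x\<bar> \<le> \<bar>\<Sum>\<iota>\<in>inj_tuples d {..<n}. residual (\<lambda>k. x (\<iota> k))\<bar> / 1"
    unfolding ustat_residual_def abs_divide by (intro divide_left_mono) (auto simp: fact_ge_1)
  also have "\<dots> \<le> (\<Sum>\<iota>\<in>inj_tuples d {..<n}. real (2 * d + 2))"
    unfolding div_by_1 by (rule order_trans[OF sum_abs], rule sum_mono) (rule residual_bound)
  finally show ?thesis by simp
qed

lemma expectation_abs_ustat_residual:
  assumes "n > 0"
  shows "(\<integral>x. \<bar>ustat_residual n x\<bar> \<partial>seq_space) \<le> (2 * d + 2) * d\<^sup>2 * n ^ (d - 1)"
proof (rule S.expectation_abs_le_of_square)
  show "(\<integral>x. (ustat_residual n x)\<^sup>2 \<partial>seq_space) \<le> (real ((2 * d + 2) * d\<^sup>2 * n ^ (d - 1)))\<^sup>2"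
    using expectation_ustat_residual_square[of n] by simp
  show "integrable seq_space (\<lambda>x. (ustat_residual n x)\<^sup>2)"
  proof (rule integrable_bounded)
    show "\<bar>(ustat_residual n x)\<^sup>2\<bar> \<le> (real (card (inj_tuples d {..<n})) * (2 * d + 2))\<^sup>2" for x
      using power_mono[OF ustat_residual_bound[of n x], of 2] by simp
  qed measurable
  show "0 < real ((2 * d + 2) * d\<^sup>2 * n ^ (d - 1))"
    using assms d_pos by (simp only: of_nat_0_less_iff) simp
qed measurable

lemma lin_bound: "\<bar>(\<Sum>i<n. proj (x i)) - real n * mean\<bar> \<le> 2 * real n"
proof -
  have "\<bar>\<Sum>i<n. proj (x i) - mean\<bar> \<le> (\<Sum>i<n. 2)"
  proof (rule order_trans[OF sum_abs], rule sum_mono)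
    show "\<bar>proj (x k) - mean\<bar> \<le> 2" for k
      using proj_bound[of "x k"] mean_bound by linarith
  qed
  then show ?thesis by (simp add: sum_subtractf)
qed

text \<open>The variance of a sum of independent variables: resampling coordinate \<open>j\<close>
  alone kills the mixed terms, and each diagonal term is at most the second moment of
  \<open>proj\<close>, hence at most 1.\<close>

lemma expectation_lin_square:
  "(\<integral>x. ((\<Sum>i<n. proj (x i)) - n * mean)\<^sup>2 \<partial>seq_space) \<le> n"
proof -
  let ?I = "\<lambda>i j. \<integral>x. (proj (x i) - mean) * (proj (x j) - mean) \<partial>seq_space"
  have pb: "\<bar>proj a - mean\<bar> \<le> 2" for a using proj_bound[of a] mean_bound by linarith
  have bd: "\<bar>(proj (x i) - mean) * (proj (x j) - mean)\<bar> \<le> 2 * 2" for x i j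
    unfolding abs_mult using pb by (intro mult_mono) auto
  have int: "integrable seq_space (\<lambda>x. (proj (x i) - mean) * (proj (x j) - mean))" for i j
    by (rule integrable_bounded[OF _ bd]) measurable
  have intp: "integrable seq_space (\<lambda>x. proj (x i))" for i
    by (rule integrable_bounded[OF _ proj_bound]) measurable
  have off: "?I i j = 0" if "i \<noteq> j" for i j
  proof -
    have "?I i j = (\<integral>x. (proj (x i) - mean) * (\<integral>y. proj (resample {j} x y j) - mean \<partial>seq_space) \<partial>seq_space)"
      using that by (intro integral_mult_resample[OF _ _ pb pb]) (auto simp: depends_on_def)
    moreover have "(\<integral>y. proj (resample {j} x y j) - mean \<partial>seq_space) = 0" for x
      by (simp add: resample_def intp S.prob_space integral_component integral_proj)
    ultimately show ?thesis by simp
  qed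
  have diag: "?I i i \<le> 1" for i
  proof -
    have sq: "integrable seq_space (\<lambda>x. (proj (x i))\<^sup>2)"
      using proj_bound by (intro integrable_bounded[where b = 1]) (auto simp: abs_square_le_1)
    have "?I i i = (\<integral>x. (proj (x i))\<^sup>2 - 2 * mean * proj (x i) + mean\<^sup>2 \<partial>seq_space)"
      by (intro Bochner_Integration.integral_cong refl) (simp add: power2_eq_square algebra_simps)
    also have "\<dots> = (\<integral>x. (proj (x i))\<^sup>2 \<partial>seq_space) - mean\<^sup>2"
      using sq intp by (simp add: S.prob_space integral_component integral_proj power2_eq_square)
    also have "(\<integral>x. (proj (x i))\<^sup>2 \<partial>seq_space) \<le> (\<integral>x. 1 \<partial>seq_space)"
      using sq proj_bound by (intro integral_mono) (auto simp: abs_square_le_1)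
    finally have "?I i i \<le> 1 - mean\<^sup>2" by (simp add: S.prob_space)
    then show ?thesis using zero_le_power2[of mean] by linarith
  qed
  have "(\<Sum>i<n. proj (x i)) - n * mean = (\<Sum>i<n. proj (x i) - mean)" for x by (simp add: sum_subtractf)
  then have "(\<integral>x. ((\<Sum>i<n. proj (x i)) - n * mean)\<^sup>2 \<partial>seq_space) =
    (\<integral>x. (\<Sum>i<n. \<Sum>j<n. (proj (x i) - mean) * (proj (x j) - mean)) \<partial>seq_space)"
    by (simp add: power2_eq_square sum_product)
  also have "\<dots> = (\<Sum>i<n. \<Sum>j<n. ?I i j)" using int by simp
  also have "\<dots> = (\<Sum>i<n. \<Sum>j<n. if j = i then ?I i i else 0)"
    using off by (intro sum.cong refl) auto
  also have "\<dots> = (\<Sum>i<n. ?I i i)" by simp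
  also have "\<dots> \<le> (\<Sum>i<n. 1)" by (rule sum_mono) (rule diag)
  finally show ?thesis by simp
qed

lemma char_lin:
  "(\<integral>x. iexp (s * (\<Sum>i<n. proj (x i))) \<partial>seq_space) = (\<integral>a. iexp (s * proj a) \<partial>Q) ^ n"
proof -
  interpret PS: product_sigma_finite "\<lambda>_::nat. Q" by unfold_locales
  let ?F = "\<lambda>x. \<Prod>i<n. iexp (s * proj (x i))"
  have m: "?F \<in> borel_measurable (PiM {..<n} (\<lambda>_. Q))" by measurable
  have "(\<integral>x. iexp (s * (\<Sum>i<n. proj (x i))) \<partial>seq_space) = (\<integral>x. ?F x \<partial>seq_space)"
    by (simp add: exp_sum[symmetric] sum_distrib_left)
  also have "\<dots> = (\<integral>x. ?F x \<partial>PiM {..<n} (\<lambda>_. Q))"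
    using integral_reindex[OF m, of "\<lambda>k. k"] by (simp add: depends_on_def)
  also have "\<dots> = (\<Prod>i<n. \<integral>a. iexp (s * proj a) \<partial>Q)"
    by (intro PS.product_integral_prod) (auto intro!: integrable_const_bound[where B = 1])
  finally show ?thesis by simp
qed

end

section \<open>Poisson moments and falling factorials\<close>

text \<open>Poisson expectations become exponential series, with the factor
  \<open>exp (- \<mu>)\<close> kept apart so that the library series can be used. Absolute
  convergence is what makes \<open>g\<close> integrable; otherwise its expectation would be 0 by
  convention.\<close>

lemma integral_poisson_pmf:
  fixes g :: "nat \<Rightarrow> 'c::{banach, second_countable_topology}"
  assumes \<mu>: "\<mu> > 0" and abs: "summable (\<lambda>n. \<mu> ^ n / fact n * norm (g n))"
    and s: "(\<lambda>n. (\<mu> ^ n / fact n) *\<^sub>R g n) sums s"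
  shows "integrable (measure_pmf (poisson_pmf \<mu>)) g"
    and "measure_pmf.expectation (poisson_pmf \<mu>) g = exp (- \<mu>) *\<^sub>R s"
proof -
  let ?h = "\<lambda>n. pmf (poisson_pmf \<mu>) n *\<^sub>R g n"
  have "(\<lambda>n. norm (?h n)) = (\<lambda>n. exp (- \<mu>) * (\<mu> ^ n / fact n * norm (g n)))"
    using \<mu> by (auto simp: fun_eq_iff)
  then have int: "integrable (count_space UNIV) ?h"
    unfolding integrable_count_space_nat_iff using summable_mult[OF abs, of "exp (- \<mu>)"] by simp
  have "?h = (\<lambda>n. exp (- \<mu>) *\<^sub>R ((\<mu> ^ n / fact n) *\<^sub>R g n))"
    using \<mu> by (auto simp: fun_eq_iff)
  then have sums: "?h sums (exp (- \<mu>) *\<^sub>R s)" using sums_scaleR_right[OF s, of "exp (- \<mu>)"] by simp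
  show "integrable (measure_pmf (poisson_pmf \<mu>)) g"
    unfolding measure_pmf_eq_density using int by (subst integrable_density) auto
  have "measure_pmf.expectation (poisson_pmf \<mu>) g = (\<integral>n. ?h n \<partial>count_space UNIV)"
    unfolding measure_pmf_eq_density by (subst integral_density) auto
  also have "\<dots> = exp (- \<mu>) *\<^sub>R s"
    using integral_count_space_nat[OF int] sums by (simp add: sums_iff)
  finally show "measure_pmf.expectation (poisson_pmf \<mu>) g = exp (- \<mu>) *\<^sub>R s" .
qed

text \<open>The generating function at a complex argument. With \<open>z\<close> the characteristic
  function of a single summand it gives that of a compound Poisson sum.\<close>

lemma poisson_pmf_power:
  fixes z :: complex
  assumes "\<mu> > 0"
  shows "measure_pmf.expectation (poisson_pmf \<mu>) (\<lambda>n. z ^ n) = exp (\<mu> * (z - 1))"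
proof -
  have "measure_pmf.expectation (poisson_pmf \<mu>) (\<lambda>n. z ^ n) = exp (- \<mu>) *\<^sub>R exp (\<mu> *\<^sub>R z)"
  proof (rule integral_poisson_pmf(2)[OF assms])
    show "summable (\<lambda>n. \<mu> ^ n / fact n * norm (z ^ n))"
      using summable_exp[of "\<mu> * norm z"] by (simp add: norm_power power_mult_distrib field_simps)
    show "(\<lambda>n. (\<mu> ^ n / fact n) *\<^sub>R z ^ n) sums exp (\<mu> *\<^sub>R z)"
      using exp_converges[of "\<mu> *\<^sub>R z"] by (simp add: scaleR_power divide_inverse_commute)
  qed
  also have "\<dots> = exp (\<mu> * (z - 1))"
    by (simp add: scaleR_conv_of_real exp_of_real[symmetric] exp_add[symmetric] algebra_simps del: exp_of_real)
  finally show ?thesis .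
qed

text \<open>The series for the first and second moments follow from lower ones by shifting the
  index, since a factor \<open>n\<close> cancels against \<open>fact n\<close> and leaves a factor
  \<open>\<mu>\<close>.\<close>

lemma poisson_pmf_variance:
  assumes "\<mu> > 0"
  shows "integrable (measure_pmf (poisson_pmf \<mu>)) (\<lambda>n. (real n - \<mu>)\<^sup>2)"
    and "measure_pmf.expectation (poisson_pmf \<mu>) (\<lambda>n. (real n - \<mu>)\<^sup>2) = \<mu>"
proof -
  let ?w = "\<lambda>n. \<mu> ^ n / fact n"
  have s0: "?w sums exp \<mu>"
    using exp_converges[of \<mu>] by (simp add: divide_inverse_commute)
  have s1: "(\<lambda>n. ?w n * real n) sums (\<mu> * exp \<mu>)"
  proof -
    have "(\<lambda>n. \<mu> * ?w n) sums (\<mu> * exp \<mu>)" by (rule sums_mult[OF s0])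
    also have "(\<lambda>n. \<mu> * ?w n) = (\<lambda>n. ?w (Suc n) * real (Suc n))"
      by (auto simp: fun_eq_iff fact_Suc simp del: of_nat_Suc)
    finally have "(\<lambda>n. ?w (Suc n) * real (Suc n)) sums (\<mu> * exp \<mu>)" .
    then show ?thesis using sums_Suc_iff[of "\<lambda>n. ?w n * real n" "\<mu> * exp \<mu>"] by (simp del: of_nat_Suc)
  qed
  have s2: "(\<lambda>n. ?w n * (real n * real n)) sums (\<mu> * (\<mu> * exp \<mu> + exp \<mu>))"
  proof -
    have "(\<lambda>n. \<mu> * (?w n * real n + ?w n)) sums (\<mu> * (\<mu> * exp \<mu> + exp \<mu>))"
      by (rule sums_mult[OF sums_add[OF s1 s0]])
    also have "(\<lambda>n. \<mu> * (?w n * real n + ?w n)) = (\<lambda>n. ?w (Suc n) * (real (Suc n) * real (Suc n)))"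
    proof
      fix n
      have "?w (Suc n) * real (Suc n) = \<mu> * ?w n" by (simp add: fact_Suc del: of_nat_Suc)
      then have "?w (Suc n) * (real (Suc n) * real (Suc n)) = \<mu> * ?w n * real (Suc n)"
        by (simp only: mult.assoc[symmetric])
      then show "\<mu> * (?w n * real n + ?w n) = ?w (Suc n) * (real (Suc n) * real (Suc n))"
        by (simp add: distrib_left mult.assoc add.commute)
    qed
    finally have "(\<lambda>n. ?w (Suc n) * (real (Suc n) * real (Suc n))) sums (\<mu> * (\<mu> * exp \<mu> + exp \<mu>))" .
    then show ?thesis using sums_Suc_iff[of "\<lambda>n. ?w n * (real n * real n)" "\<mu> * (\<mu> * exp \<mu> + exp \<mu>)"]
      by (simp del: of_nat_Suc)
  qed
  have "(\<lambda>n. ?w n * (real n * real n) + (- 2 * \<mu>) * (?w n * real n) + \<mu>\<^sup>2 * ?w n) sums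
     (\<mu> * (\<mu> * exp \<mu> + exp \<mu>) + (- 2 * \<mu>) * (\<mu> * exp \<mu>) + \<mu>\<^sup>2 * exp \<mu>)"
    by (intro sums_add sums_mult s0 s1 s2)
  also have "(\<lambda>n. ?w n * (real n * real n) + (- 2 * \<mu>) * (?w n * real n) + \<mu>\<^sup>2 * ?w n) = (\<lambda>n. ?w n * (real n - \<mu>)\<^sup>2)"
    by (auto simp: fun_eq_iff power2_eq_square algebra_simps)
  also have "\<mu> * (\<mu> * exp \<mu> + exp \<mu>) + (- 2 * \<mu>) * (\<mu> * exp \<mu>) + \<mu>\<^sup>2 * exp \<mu> = \<mu> * exp \<mu>"
    by (simp add: power2_eq_square algebra_simps)
  finally have s: "(\<lambda>n. ?w n * (real n - \<mu>)\<^sup>2) sums (\<mu> * exp \<mu>)" .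
  then have sm: "summable (\<lambda>n. ?w n * norm ((real n - \<mu>)\<^sup>2))" by (simp add: sums_iff)
  have s': "(\<lambda>n. ?w n *\<^sub>R (real n - \<mu>)\<^sup>2) sums (\<mu> * exp \<mu>)" using s by simp
  show "integrable (measure_pmf (poisson_pmf \<mu>)) (\<lambda>n. (real n - \<mu>)\<^sup>2)"
    by (rule integral_poisson_pmf(1)[OF assms sm s'])
  show "measure_pmf.expectation (poisson_pmf \<mu>) (\<lambda>n. (real n - \<mu>)\<^sup>2) = \<mu>"
    using integral_poisson_pmf(2)[OF assms sm s'] by (simp add: exp_minus field_simps)
qed

text \<open>In the induction the old remainder is multiplied by at most 2, and the new cross term is
  at most \<open>d * \<epsilon>\<^sup>2\<close>, hence at most
  \<open>4 ^ d * \<epsilon>\<^sup>2\<close>. A factor 3 per step would do; 4 is taken for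
  convenience.\<close>

lemma prod_one_plus_expansion:
  fixes a :: "nat \<Rightarrow> real"
  assumes "0 \<le> \<epsilon>" "\<epsilon> \<le> 1" "\<forall>i<d. \<bar>a i\<bar> \<le> \<epsilon>"
  shows "\<bar>(\<Prod>i<d. 1 + a i) - 1 - (\<Sum>i<d. a i)\<bar> \<le> 4 ^ d * \<epsilon>\<^sup>2"
  using assms(3)
proof (induction d)
  case (Suc d)
  let ?R = "(\<Prod>i<d. 1 + a i) - 1 - (\<Sum>i<d. a i)"
  have "\<bar>?R\<bar> \<le> 4 ^ d * \<epsilon>\<^sup>2" using Suc by simp
  moreover have "\<bar>1 + a d\<bar> \<le> 2" using Suc.prems assms(2) by (auto dest!: spec[of _ d])
  ultimately have 1: "\<bar>?R * (1 + a d)\<bar> \<le> 4 ^ d * \<epsilon>\<^sup>2 * 2"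
    unfolding abs_mult by (intro mult_mono) auto
  have "\<bar>\<Sum>i<d. a i\<bar> \<le> (\<Sum>i<d. \<epsilon>)"
    by (rule order_trans[OF sum_abs], rule sum_mono) (use Suc.prems in auto)
  moreover have "\<bar>a d\<bar> \<le> \<epsilon>" using Suc.prems by simp
  ultimately have 2: "\<bar>a d * (\<Sum>i<d. a i)\<bar> \<le> \<epsilon> * (d * \<epsilon>)"
    unfolding abs_mult using assms(1) by (intro mult_mono) auto
  have "real d < 2 ^ d" by (rule of_nat_less_two_power)
  moreover have "(2::real) ^ d \<le> 4 ^ d" by (rule power_mono) auto
  ultimately have "real d \<le> 4 ^ d" by linarith
  then have 3: "d * \<epsilon>\<^sup>2 \<le> 4 ^ d * \<epsilon>\<^sup>2" by (intro mult_right_mono) auto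
  have "(\<Prod>i<Suc d. 1 + a i) - 1 - (\<Sum>i<Suc d. a i) = ?R * (1 + a d) + a d * (\<Sum>i<d. a i)"
    by (simp add: algebra_simps)
  then have "\<bar>(\<Prod>i<Suc d. 1 + a i) - 1 - (\<Sum>i<Suc d. a i)\<bar> \<le> 4 ^ d * \<epsilon>\<^sup>2 * 2 + \<epsilon> * (d * \<epsilon>)"
    using 1 2 by linarith
  also have "\<dots> \<le> 4 ^ Suc d * \<epsilon>\<^sup>2"
  proof -
    have "\<epsilon> * (d * \<epsilon>) = d * \<epsilon>\<^sup>2" by (simp add: power2_eq_square)
    moreover have "4 ^ Suc d * \<epsilon>\<^sup>2 = 4 * (4 ^ d * \<epsilon>\<^sup>2)" by simp
    moreover have "0 \<le> 4 ^ d * \<epsilon>\<^sup>2" by simp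
    ultimately show ?thesis using 3 by linarith
  qed
  finally show ?case .
qed simp

text \<open>\<open>A\<close> is the number of injective tuples relative to \<open>\<mu> ^ d\<close>.
  It is a product of factors \<open>1 + a i\<close> with \<open>a i\<close> at most
  \<open>\<epsilon>\<close> in absolute value, whose sum is \<open>d * (n / \<mu> - 1)\<close> up to
  an error of at most \<open>d\<^sup>2 / \<mu>\<close>. From \<open>\<epsilon> \<le> 1 / 2\<close>
  it follows that \<open>n\<close> is at least half of \<open>\<mu>\<close>, whence the factor 2 in
  the third bound, and that no subtraction \<open>n - i\<close> is truncated.\<close>

lemma falling_factorial_ratio:
  fixes \<mu> \<epsilon> :: real and n d :: nat
  defines "A \<equiv> real (\<Prod>i<d. n - i) / \<mu> ^ d"
  assumes \<mu>: "\<mu> > 0" and \<epsilon>: "\<epsilon> \<le> 1 / 2" "\<bar>n / \<mu> - 1\<bar> + d / \<mu> \<le> \<epsilon>"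
  shows "n > 0" "\<bar>A - 1 - d * (n / \<mu> - 1)\<bar> \<le> 4 ^ d * \<epsilon>\<^sup>2 + d\<^sup>2 / \<mu>"
    "\<bar>A * \<mu> / n - 1\<bar> \<le> 2 * (d + 4 ^ d + 1) * \<epsilon>" "n / \<mu> \<le> 2"
proof -
  have e0: "0 \<le> \<epsilon>" using \<epsilon>(2) \<mu> by (smt (verit) divide_nonneg_pos of_nat_0_le_iff)
  have d0: "0 \<le> d / \<mu>" using \<mu> by simp
  have u: "\<bar>n / \<mu> - 1\<bar> \<le> \<epsilon>" "d / \<mu> \<le> \<epsilon>" using \<epsilon>(2) d0 by linarith+
  have n: "n / \<mu> \<ge> 1 / 2" using u \<epsilon> by linarith
  then show n0: "n > 0" by (cases "n = 0") auto
  show "n / \<mu> \<le> 2" using u \<epsilon> by linarith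
  define a where "a i = (real n - real i) / \<mu> - 1" for i
  have a: "\<bar>a i\<bar> \<le> \<epsilon>" if "i < d" for i
  proof -
    have "a i = (n / \<mu> - 1) - i / \<mu>" by (simp add: a_def diff_divide_distrib)
    moreover have "0 \<le> i / \<mu>" "i / \<mu> \<le> d / \<mu>" using \<mu> that by (auto simp: divide_right_mono)
    ultimately show ?thesis using \<epsilon>(2) by linarith
  qed
  have le: "i \<le> n" if "i < d" for i
  proof -
    have "(real n - real i) / \<mu> > 0" using a[OF that] \<epsilon>(1) unfolding a_def by linarith
    then show ?thesis using \<mu> by (simp add: zero_less_divide_iff)
  qed
  have A: "A = (\<Prod>i<d. 1 + a i)"
  proof -
    have "(\<Prod>i<d. 1 + a i) = (\<Prod>i<d. real (n - i) / \<mu>)"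
      using le by (intro prod.cong) (auto simp: a_def of_nat_diff)
    then show ?thesis by (simp add: A_def prod_dividef)
  qed
  have R: "\<bar>A - 1 - (\<Sum>i<d. a i)\<bar> \<le> 4 ^ d * \<epsilon>\<^sup>2"
    unfolding A using a e0 \<epsilon> by (intro prod_one_plus_expansion) auto
  have sa: "(\<Sum>i<d. a i) = d * (n / \<mu> - 1) - (\<Sum>i<d. i / \<mu>)"
  proof -
    have "a i = (n / \<mu> - 1) - i / \<mu>" for i by (simp add: a_def diff_divide_distrib)
    then show ?thesis by (simp only: sum_subtractf) (simp add: right_diff_distrib)
  qed
  have "(\<Sum>i<d. i / \<mu>) \<le> (\<Sum>i<d. d / \<mu>)" using \<mu> by (intro sum_mono divide_right_mono) auto
  then have si: "(\<Sum>i<d. i / \<mu>) \<le> d\<^sup>2 / \<mu>" by (simp add: power2_eq_square)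
  have si0: "0 \<le> (\<Sum>i<d. i / \<mu>)" using \<mu> by (intro sum_nonneg) auto
  show "\<bar>A - 1 - d * (n / \<mu> - 1)\<bar> \<le> 4 ^ d * \<epsilon>\<^sup>2 + d\<^sup>2 / \<mu>"
    using R sa si si0 by linarith
  have sabs: "\<bar>\<Sum>i<d. a i\<bar> \<le> d * \<epsilon>"
    using order_trans[OF sum_abs sum_mono[of "{..<d}" "\<lambda>i. \<bar>a i\<bar>" "\<lambda>_. \<epsilon>"]] a by simp
  have "4 ^ d * \<epsilon>\<^sup>2 \<le> 4 ^ d * \<epsilon>"
    using e0 \<epsilon> by (intro mult_left_mono) (auto simp: power2_eq_square mult_left_le)
  then have "\<bar>A - n / \<mu>\<bar> \<le> (d + 4 ^ d + 1) * \<epsilon>"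
  proof -
    have "(d + 4 ^ d + 1) * \<epsilon> = d * \<epsilon> + 4 ^ d * \<epsilon> + \<epsilon>" by (simp add: algebra_simps)
    then show ?thesis using \<open>4 ^ d * \<epsilon>\<^sup>2 \<le> 4 ^ d * \<epsilon>\<close> R sabs u by linarith
  qed
  have "A * \<mu> / n - 1 = (A - n / \<mu>) / (n / \<mu>)" using n0 \<mu> by (simp add: field_simps)
  then have "\<bar>A * \<mu> / n - 1\<bar> = \<bar>A - n / \<mu>\<bar> / (n / \<mu>)" using n \<mu> by (simp add: abs_divide abs_mult)
  also have "\<dots> \<le> \<bar>A - n / \<mu>\<bar> / (1 / 2)"
    using n n0 \<mu> by (intro divide_left_mono) auto
  also have "\<dots> \<le> 2 * (d + 4 ^ d + 1) * \<epsilon>"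
  proof -
    have "X / (1 / 2) \<le> 2 * Y" if "X \<le> Y" for X Y :: real using that by simp
    from this[OF \<open>\<bar>A - n / \<mu>\<bar> \<le> (d + 4 ^ d + 1) * \<epsilon>\<close>] show ?thesis
      by (simp only: of_nat_mult of_nat_numeral mult.assoc)
  qed
  finally show "\<bar>A * \<mu> / n - 1\<bar> \<le> 2 * (d + 4 ^ d + 1) * \<epsilon>" .
qed

section \<open>The normalised U-statistic and its linear part\<close>

context bounded_symmetric_kernel
begin

definition ustat_normalized :: "real \<Rightarrow> nat \<Rightarrow> (nat \<Rightarrow> 'x) \<Rightarrow> real" where
  "ustat_normalized \<mu> n x = fact (d - 1) / \<mu> powr (d - 1 / 2) * (ustat n x - \<mu> ^ d / fact d * mean)"

text \<open>The centring uses \<open>\<mu>\<close> and not \<open>n\<close>: for Poisson distributed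
  \<open>n\<close> this is a centred compound Poisson sum, of variance equal to the second moment of
  \<open>proj\<close>.\<close>

definition linear_normalized :: "real \<Rightarrow> nat \<Rightarrow> (nat \<Rightarrow> 'x) \<Rightarrow> real" where
  "linear_normalized \<mu> n x = ((\<Sum>i<n. proj (x i)) - \<mu> * mean) / sqrt \<mu>"

lemma ustat_normalized_measurable [measurable]: "ustat_normalized \<mu> n \<in> borel_measurable seq_space"
  unfolding ustat_normalized_def by measurable

lemma linear_normalized_measurable [measurable]: "linear_normalized \<mu> n \<in> borel_measurable seq_space"
  unfolding linear_normalized_def by measurable

text \<open>Write the sum \<open>S\<close> of the projections as
  \<open>(S - n * mean) + n * mean\<close>. The fluctuation for given \<open>n\<close> keeps the
  factor \<open>A * \<mu> / n - 1\<close>, which is small; in the part proportional to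
  \<open>mean\<close>, the centring by \<open>\<mu>\<close> removes exactly the first-order
  expansion of \<open>A\<close> in \<open>n / \<mu> - 1\<close>.\<close>

lemma normalized_diff:
  assumes \<mu>: "\<mu> > 0" and n: "n > 0"
  defines "A \<equiv> real (\<Prod>i<d. n - i) / \<mu> ^ d"
  shows "ustat_normalized \<mu> n x - linear_normalized \<mu> n x =
    fact (d - 1) / \<mu> powr (d - 1 / 2) * ustat_residual n x +
    ((\<Sum>i<n. proj (x i)) - n * mean) / sqrt \<mu> * (A * \<mu> / n - 1) +
    sqrt \<mu> / d * mean * (A - 1 - d * (n / \<mu> - 1))"
proof -
  define S where "S = (\<Sum>i<n. proj (x i))"
  define H where "H = ustat_residual n x"
  define q where "q = sqrt \<mu>"
  have q: "q > 0" "\<mu> = q\<^sup>2" using \<mu> by (auto simp: q_def)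
  have powr: "\<mu> powr (d - 1 / 2) = \<mu> ^ d / q"
    using \<mu> by (simp add: powr_diff powr_realpow powr_half_sqrt q_def)
  have fd: "fact d = real d * fact (d - 1)" using d_pos by (cases d) auto
  have dd: "real d > 0" using d_pos by simp
  have card: "real (card (inj_tuples d {..<n})) = A * \<mu> ^ d"
    using \<mu> by (simp add: A_def card_inj_tuples)
  have "ustat_normalized \<mu> n x - linear_normalized \<mu> n x =
    fact (d - 1) / (\<mu> ^ d / q) * (H + A * \<mu> ^ d * (mean + d * (S / n - mean)) / fact d - \<mu> ^ d / fact d * mean)
      - (S - \<mu> * mean) / q"
    unfolding ustat_normalized_def linear_normalized_def ustat_decomposition[OF n] powr card S_def H_def q_def ..
  also have "\<dots> = fact (d - 1) / (\<mu> ^ d / q) * H + (q / d * (A * (mean + d * (S / n - mean)) - mean) - (S - \<mu> * mean) / q)"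
    using \<mu> q(1) dd unfolding fd by (simp add: field_simps)
  also have "q / d * (A * (mean + d * (S / n - mean)) - mean) - (S - \<mu> * mean) / q =
    (S - n * mean) / q * (A * \<mu> / n - 1) + q / d * mean * (A - 1 - d * (n / \<mu> - 1))"
    using q(1) dd n unfolding q(2) by (simp add: field_simps power2_eq_square)
  finally show ?thesis unfolding powr S_def H_def q_def by (simp add: add.assoc)
qed

end

section \<open>Comparison of characteristic functions\<close>

lemma norm_iexp_diff_le: "cmod (iexp u - iexp v) \<le> \<bar>u - v\<bar>"
proof -
  have "iexp u - iexp v = iexp v * (iexp (u - v) - 1)"
    by (simp add: algebra_simps exp_diff)
  then have "cmod (iexp u - iexp v) = cmod (iexp (u - v) - 1)" by (simp add: norm_mult)
  also have "\<dots> \<le> \<bar>u - v\<bar>" using iexp_approx1[of "u - v" 0] by simp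
  finally show ?thesis .
qed

text \<open>The summands bound the three terms of \<open>normalized_diff\<close> in mean: residual,
  fluctuation of the linear sum, falling factorial. The power of 2 comes from
  \<open>n \<le> 2 * \<mu>\<close>. For \<open>\<epsilon>\<close> of order
  \<open>\<mu> powr (- 3/8)\<close> the slowest term, from
  \<open>sqrt \<mu> * \<epsilon>\<^sup>2\<close>, is of order
  \<open>\<mu> powr (- 1/4)\<close>.\<close>

definition clt_error :: "nat \<Rightarrow> real \<Rightarrow> real \<Rightarrow> real" where
  "clt_error d \<mu> \<epsilon> = real (fact (d - 1) * 2 ^ (d - 1) * ((2 * d + 2) * d\<^sup>2)) / sqrt \<mu> +
     real (4 * (d + 4 ^ d + 1)) * \<epsilon> + sqrt \<mu> * (4 ^ d * \<epsilon>\<^sup>2 + real (d\<^sup>2) / \<mu>)"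

context bounded_symmetric_kernel
begin

lemma expectation_abs_lin:
  assumes "n > 0"
  shows "(\<integral>x. \<bar>(\<Sum>i<n. proj (x i)) - n * mean\<bar> \<partial>seq_space) \<le> sqrt n"
proof (rule S.expectation_abs_le_of_square)
  show "integrable seq_space (\<lambda>x. ((\<Sum>i<n. proj (x i)) - n * mean)\<^sup>2)"
  proof (rule integrable_bounded)
    show "\<bar>((\<Sum>i<n. proj (x i)) - n * mean)\<^sup>2\<bar> \<le> (2 * real n)\<^sup>2" for x
      using power_mono[OF lin_bound[of x n], of 2] by simp
  qed measurable
qed (use assms expectation_lin_square[of n] in auto)

lemma expectation_normalized_diff:
  assumes \<mu>: "\<mu> > 0" and \<epsilon>: "\<epsilon> \<le> 1 / 2" "\<bar>n / \<mu> - 1\<bar> + d / \<mu> \<le> \<epsilon>"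
  shows "(\<integral>x. \<bar>ustat_normalized \<mu> n x - linear_normalized \<mu> n x\<bar> \<partial>seq_space) \<le> clt_error d \<mu> \<epsilon>"
proof -
  note F = falling_factorial_ratio[OF \<mu> \<epsilon>]
  define A where "A = real (\<Prod>i<d. n - i) / \<mu> ^ d"
  define T where "T x = (\<Sum>i<n. proj (x i)) - n * mean" for x
  define c where "c = fact (d - 1) / \<mu> powr (d - 1 / 2)"
  define \<beta> where "\<beta> = \<bar>A * \<mu> / n - 1\<bar> / sqrt \<mu>"
  define \<gamma> where "\<gamma> = sqrt \<mu> / d * (\<bar>mean\<bar> * \<bar>A - 1 - d * (n / \<mu> - 1)\<bar>)"
  have c0: "c \<ge> 0" by (simp add: c_def)
  have \<beta>0: "\<beta> \<ge> 0" using \<mu> by (simp add: \<beta>_def)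
  have e0: "0 \<le> \<epsilon>" using \<epsilon>(2) \<mu> by (smt (verit) divide_nonneg_pos of_nat_0_le_iff)
  have [measurable]: "T \<in> borel_measurable seq_space" unfolding T_def by measurable
  have iT: "integrable seq_space (\<lambda>x. \<bar>T x\<bar>)"
    by (rule integrable_bounded[where b = "2 * real n"]) (use lin_bound in \<open>auto simp: T_def\<close>)
  have iH: "integrable seq_space (\<lambda>x. \<bar>ustat_residual n x\<bar>)"
    by (rule integrable_bounded) (use ustat_residual_bound in auto)
  have le: "\<bar>ustat_normalized \<mu> n x - linear_normalized \<mu> n x\<bar> \<le> c * \<bar>ustat_residual n x\<bar> + \<beta> * \<bar>T x\<bar> + \<gamma>" for x
  proof -
    have "\<bar>ustat_normalized \<mu> n x - linear_normalized \<mu> n x\<bar> \<le> \<bar>c * ustat_residual n x\<bar> +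
      \<bar>T x / sqrt \<mu> * (A * \<mu> / n - 1)\<bar> + \<bar>sqrt \<mu> / d * mean * (A - 1 - d * (n / \<mu> - 1))\<bar>"
      unfolding normalized_diff[OF \<mu> F(1), folded A_def T_def c_def]
      by (rule order_trans[OF abs_triangle_ineq add_mono[OF abs_triangle_ineq order_refl]])
    also have "\<dots> = c * \<bar>ustat_residual n x\<bar> + \<beta> * \<bar>T x\<bar> + \<gamma>"
      using c0 \<mu> by (simp add: abs_mult \<beta>_def \<gamma>_def mult_ac)
    finally show ?thesis .
  qed
  have int: "integrable seq_space (\<lambda>x. c * \<bar>ustat_residual n x\<bar> + \<beta> * \<bar>T x\<bar> + \<gamma>)"
    using iT iH by simp
  have "(\<integral>x. \<bar>ustat_normalized \<mu> n x - linear_normalized \<mu> n x\<bar> \<partial>seq_space) \<le>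
     (\<integral>x. c * \<bar>ustat_residual n x\<bar> + \<beta> * \<bar>T x\<bar> + \<gamma> \<partial>seq_space)"
  proof (intro integral_mono Bochner_Integration.integrable_bound[OF int] int le)
    show "AE x in seq_space. norm \<bar>ustat_normalized \<mu> n x - linear_normalized \<mu> n x\<bar> \<le>
       norm (c * \<bar>ustat_residual n x\<bar> + \<beta> * \<bar>T x\<bar> + \<gamma>)"
      using order_trans[OF le abs_ge_self] by simp
  qed measurable
  also have "\<dots> = c * (\<integral>x. \<bar>ustat_residual n x\<bar> \<partial>seq_space) + \<beta> * (\<integral>x. \<bar>T x\<bar> \<partial>seq_space) + \<gamma>"
    using iT iH by (simp add: S.prob_space)
  also have "\<dots> \<le> fact (d - 1) * 2 ^ (d - 1) * ((2 * d + 2) * d\<^sup>2) / sqrt \<mu> +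
     4 * (d + 4 ^ d + 1) * \<epsilon> + sqrt \<mu> * (4 ^ d * \<epsilon>\<^sup>2 + d\<^sup>2 / \<mu>)"
  proof (intro add_mono)
    have n2: "real n \<le> 2 * \<mu>" using F(4) \<mu> by (simp add: field_simps)
    have "c * (\<integral>x. \<bar>ustat_residual n x\<bar> \<partial>seq_space) \<le> c * ((2 * d + 2) * d\<^sup>2 * n ^ (d - 1))"
      using c0 expectation_abs_ustat_residual[OF F(1)] by (intro mult_left_mono) auto
    also have "\<dots> = c * (real ((2 * d + 2) * d\<^sup>2) * real n ^ (d - 1))" by simp
    also have "\<dots> \<le> c * (real ((2 * d + 2) * d\<^sup>2) * (2 * \<mu>) ^ (d - 1))"
      by (intro mult_left_mono power_mono n2 c0) auto
    also have "\<dots> = fact (d - 1) * 2 ^ (d - 1) * ((2 * d + 2) * d\<^sup>2) * (\<mu> ^ (d - 1) / \<mu> powr (d - 1 / 2))"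
      by (simp add: c_def power_mult_distrib)
    \<comment> \<open>Here the degeneracy pays off: the mean size of the residual statistic is below
      the normalisation by one factor \<open>sqrt \<mu>\<close>.\<close>
    also have "\<mu> ^ (d - 1) / \<mu> powr (d - 1 / 2) = 1 / sqrt \<mu>"
    proof -
      have "\<mu> ^ (d - 1) = \<mu> powr (real d - 1)" using \<mu> d_pos by (subst powr_realpow[symmetric]) (auto simp: of_nat_diff)
      then have "\<mu> ^ (d - 1) / \<mu> powr (d - 1 / 2) = \<mu> powr (- (1 / 2))"
        by (simp only: powr_diff[symmetric]) simp
      also have "\<dots> = 1 / sqrt \<mu>" using \<mu> by (simp only: powr_minus_divide powr_half_sqrt less_imp_le)
      finally show ?thesis .
    qed
    finally show "c * (\<integral>x. \<bar>ustat_residual n x\<bar> \<partial>seq_space) \<le> fact (d - 1) * 2 ^ (d - 1) * ((2 * d + 2) * d\<^sup>2) / sqrt \<mu>"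
      by simp
    have "\<beta> * (\<integral>x. \<bar>T x\<bar> \<partial>seq_space) \<le> \<beta> * sqrt n"
      using expectation_abs_lin[OF F(1)] \<beta>0 unfolding T_def by (intro mult_left_mono) auto
    also have "\<dots> = \<bar>A * \<mu> / n - 1\<bar> * sqrt (n / \<mu>)"
      by (simp add: \<beta>_def real_sqrt_divide)
    also have "\<dots> \<le> (2 * (d + 4 ^ d + 1) * \<epsilon>) * 2"
    proof (intro mult_mono)
      show "\<bar>A * \<mu> / n - 1\<bar> \<le> 2 * (d + 4 ^ d + 1) * \<epsilon>" using F(3) by (simp add: A_def)
      show "sqrt (n / \<mu>) \<le> 2" using F(4) by (intro real_le_lsqrt) auto
    qed (use e0 \<mu> in auto)
    finally show "\<beta> * (\<integral>x. \<bar>T x\<bar> \<partial>seq_space) \<le> 4 * (d + 4 ^ d + 1) * \<epsilon>"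
      by (simp add: algebra_simps)
    \<comment> \<open>Division by \<open>d\<close> and multiplication by the absolute value of
      \<open>mean\<close> are both estimated by a factor 1.\<close>
    have "\<gamma> \<le> sqrt \<mu> / 1 * (1 * (4 ^ d * \<epsilon>\<^sup>2 + d\<^sup>2 / \<mu>))"
      unfolding \<gamma>_def using F(2) d_pos \<mu> mean_bound
      by (intro mult_mono divide_left_mono) (auto simp: A_def)
    then show "\<gamma> \<le> sqrt \<mu> * (4 ^ d * \<epsilon>\<^sup>2 + d\<^sup>2 / \<mu>)" by simp
  qed
  finally show ?thesis unfolding clt_error_def .
qed

lemma integrable_normalized_diff:
  "integrable seq_space (\<lambda>x. ustat_normalized \<mu> n x - linear_normalized \<mu> n x)"
proof -
  have "integrable seq_space (ustat n)"
  proof (rule integrable_bounded[OF ustat_measurable])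
    fix x
    have "\<bar>ustat n x\<bar> \<le> \<bar>\<Sum>\<iota>\<in>inj_tuples d {..<n}. f (\<lambda>k. x (\<iota> k))\<bar> / 1"
      unfolding ustat_def abs_divide by (intro divide_left_mono) (auto simp: fact_ge_1)
    also have "\<dots> \<le> (\<Sum>\<iota>\<in>inj_tuples d {..<n}. 1)"
      unfolding div_by_1 by (rule order_trans[OF sum_abs], rule sum_mono) (rule f_bound)
    finally show "\<bar>ustat n x\<bar> \<le> (\<Sum>\<iota>\<in>inj_tuples d {..<n}. 1)" .
  qed
  moreover have "integrable seq_space (\<lambda>x. proj (x i))" for i
    by (rule integrable_bounded[OF _ proj_bound]) measurable
  ultimately show ?thesis
    unfolding ustat_normalized_def linear_normalized_def by simp
qed

text \<open>The number \<open>n\<close> enters as an exponent only, so that averaging over it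
  amounts to evaluating a generating function.\<close>

lemma integral_iexp_linear_normalized:
  assumes "\<mu> > 0"
  shows "(\<integral>x. iexp (t * linear_normalized \<mu> n x) \<partial>seq_space) =
    iexp (- (t * sqrt \<mu> * mean)) * (\<integral>a. iexp (t / sqrt \<mu> * proj a) \<partial>Q) ^ n"
proof -
  have "t * linear_normalized \<mu> n x = - (t * sqrt \<mu> * mean) + t / sqrt \<mu> * (\<Sum>i<n. proj (x i))" for x
    using assms by (simp add: linear_normalized_def field_simps)
  then have "iexp (t * linear_normalized \<mu> n x) = iexp (- (t * sqrt \<mu> * mean)) * iexp (t / sqrt \<mu> * (\<Sum>i<n. proj (x i)))" for x
    by (simp only: exp_add[symmetric] of_real_add distrib_left)
  then show ?thesis using char_lin[of "t / sqrt \<mu>" n] by simp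
qed

lemma norm_expectation_iexp_le:
  assumes "prob_space M"
  shows "cmod (\<integral>x. iexp (g x) \<partial>M) \<le> 1"
proof -
  interpret M: prob_space M by fact
  have "cmod (\<integral>x. iexp (g x) \<partial>M) \<le> (\<integral>x. cmod (iexp (g x)) \<partial>M)" by (rule integral_norm_bound)
  then show ?thesis by (simp add: M.prob_space)
qed

text \<open>For \<open>n\<close> within \<open>\<delta>\<close> of \<open>\<mu>\<close> the two
  normalised statistics are close in mean, and so are their characteristic functions. For other
  \<open>n\<close> these differ by at most 2, which costs
  \<open>2 * \<mu> / \<delta>\<^sup>2\<close> after averaging. With
  \<open>\<delta> = \<mu> powr (5/8)\<close> this cost is \<open>2 * \<mu> powr (- 1/4)\<close>, and
  \<open>\<delta> / \<mu> = \<mu> powr (- 3/8)\<close> explains \<open>\<epsilon>\<close>.\<close>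

lemma poisson_ustat_char_approx:
  fixes \<mu> t :: real
  defines "\<epsilon> \<equiv> (1 + d) * \<mu> powr (- 3 / 8)"
  assumes \<mu>: "\<mu> \<ge> 1" and \<epsilon>: "\<epsilon> \<le> 1 / 2"
  shows "cmod (measure_pmf.expectation (poisson_pmf \<mu>) (\<lambda>n. \<integral>x. iexp (t * ustat_normalized \<mu> n x) \<partial>seq_space) -
      exp (\<mu> * ((\<integral>a. iexp (t / sqrt \<mu> * proj a) \<partial>Q) - 1) - \<i> * (t * sqrt \<mu> * mean)))
    \<le> \<bar>t\<bar> * clt_error d \<mu> \<epsilon> + 2 * \<mu> powr (- 1 / 4)"
proof -
  have \<mu>0: "\<mu> > 0" using \<mu> by simp
  define a where "a n = (\<integral>x. iexp (t * ustat_normalized \<mu> n x) \<partial>seq_space)" for n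
  define b where "b n = (\<integral>x. iexp (t * linear_normalized \<mu> n x) \<partial>seq_space)" for n
  define \<delta> where "\<delta> = \<mu> powr (5 / 8)"
  have d0: "\<delta> > 0" using \<mu> by (simp add: \<delta>_def)
  have e0: "\<epsilon> \<ge> 0" by (simp add: \<epsilon>_def)
  have K0: "clt_error d \<mu> \<epsilon> \<ge> 0" using \<mu> e0 by (simp add: clt_error_def)
  have a1: "cmod (a n) \<le> 1" for n
    unfolding a_def by (rule norm_expectation_iexp_le[OF S.prob_space_axioms])
  have b1: "cmod (b n) \<le> 1" for n
    unfolding b_def by (rule norm_expectation_iexp_le[OF S.prob_space_axioms])
  have ia: "integrable seq_space (\<lambda>x. iexp (t * ustat_normalized \<mu> n x))" for n
    by (rule S.integrable_const_bound[where B = 1]) auto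
  have ib: "integrable seq_space (\<lambda>x. iexp (t * linear_normalized \<mu> n x))" for n
    by (rule S.integrable_const_bound[where B = 1]) auto
  have near: "cmod (a n - b n) \<le> \<bar>t\<bar> * clt_error d \<mu> \<epsilon>" if n: "\<bar>n - \<mu>\<bar> \<le> \<delta>" for n :: nat
  proof -
    have "n / \<mu> - 1 = (n - \<mu>) / \<mu>" using \<mu>0 by (simp add: field_simps)
    then have "\<bar>n / \<mu> - 1\<bar> = \<bar>n - \<mu>\<bar> / \<mu>" using \<mu>0 by (simp add: abs_divide)
    also have "\<dots> \<le> \<delta> / \<mu>" using n \<mu>0 by (intro divide_right_mono) auto
    also have "\<dots> = \<mu> powr (5 / 8) / \<mu> powr 1" using \<mu>0 by (simp add: \<delta>_def)
    also have "\<dots> = \<mu> powr (- 3 / 8)" by (simp only: powr_diff[symmetric]) simp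
    finally have 1: "\<bar>n / \<mu> - 1\<bar> \<le> \<mu> powr (- 3 / 8)" .
    have "1 / \<mu> = \<mu> powr (- 1)" using \<mu>0 by (simp add: powr_minus divide_inverse)
    \<comment> \<open>Since \<open>\<mu> \<ge> 1\<close>, the correction \<open>d / \<mu>\<close>
      fits under the same power; this is the summand \<open>d\<close> in the factor
      \<open>1 + d\<close> of \<open>\<epsilon>\<close>.\<close>
    also have "\<dots> \<le> \<mu> powr (- 3 / 8)" using \<mu> by (intro powr_mono) auto
    finally have "d * (1 / \<mu>) \<le> d * \<mu> powr (- 3 / 8)" by (intro mult_left_mono) auto
    with 1 have "\<bar>n / \<mu> - 1\<bar> + d / \<mu> \<le> \<epsilon>" by (simp add: \<epsilon>_def algebra_simps)
    note L1 = expectation_normalized_diff[OF \<mu>0 \<epsilon> this]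
    have "cmod (a n - b n) = cmod (\<integral>x. iexp (t * ustat_normalized \<mu> n x) - iexp (t * linear_normalized \<mu> n x) \<partial>seq_space)"
      using ia ib by (simp add: a_def b_def)
    also have "\<dots> \<le> (\<integral>x. cmod (iexp (t * ustat_normalized \<mu> n x) - iexp (t * linear_normalized \<mu> n x)) \<partial>seq_space)"
      by (rule integral_norm_bound)
    also have "\<dots> \<le> (\<integral>x. \<bar>t\<bar> * \<bar>ustat_normalized \<mu> n x - linear_normalized \<mu> n x\<bar> \<partial>seq_space)"
    proof (rule integral_mono)
      show "cmod (iexp (t * ustat_normalized \<mu> n x) - iexp (t * linear_normalized \<mu> n x)) \<le>
         \<bar>t\<bar> * \<bar>ustat_normalized \<mu> n x - linear_normalized \<mu> n x\<bar>" for x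
        using norm_iexp_diff_le[of "t * ustat_normalized \<mu> n x" "t * linear_normalized \<mu> n x"]
        by (simp add: abs_mult[symmetric] right_diff_distrib)
      show "integrable seq_space (\<lambda>x. cmod (iexp (t * ustat_normalized \<mu> n x) - iexp (t * linear_normalized \<mu> n x)))"
        by (intro integrable_norm Bochner_Integration.integrable_diff ia ib)
      have "integrable seq_space (\<lambda>x. ustat_normalized \<mu> n x - linear_normalized \<mu> n x)"
        by (rule integrable_normalized_diff)
      then show "integrable seq_space (\<lambda>x. \<bar>t\<bar> * \<bar>ustat_normalized \<mu> n x - linear_normalized \<mu> n x\<bar>)" by simp
    qed
    also have "\<dots> \<le> \<bar>t\<bar> * clt_error d \<mu> \<epsilon>" using L1 by (simp add: mult_left_mono)
    finally show ?thesis .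
  qed
  \<comment> \<open>Chebyshev's inequality in pointwise form; \<open>\<delta>\<close> lies between the standard deviation
    \<open>\<mu> powr (1/2)\<close> and \<open>\<mu> powr (3/4)\<close>, where \<open>clt_error\<close> ceases to vanish\<close>
  have pt: "cmod (a n - b n) \<le> \<bar>t\<bar> * clt_error d \<mu> \<epsilon> + 2 / \<delta>\<^sup>2 * (real n - \<mu>)\<^sup>2" for n
  proof (cases "\<bar>n - \<mu>\<bar> \<le> \<delta>")
    case True
    have "0 \<le> 2 / \<delta>\<^sup>2 * (real n - \<mu>)\<^sup>2" by simp
    then show ?thesis using near[OF True] by linarith
  next
    case False
    then have "\<delta>\<^sup>2 \<le> \<bar>real n - \<mu>\<bar>\<^sup>2" using d0 by (intro power_mono) auto
    then have "1 \<le> (real n - \<mu>)\<^sup>2 / \<delta>\<^sup>2" using d0 by (simp add: le_divide_eq)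
    moreover have "cmod (a n - b n) \<le> 2" using norm_triangle_ineq4[of "a n" "b n"] a1[of n] b1[of n] by linarith
    moreover have "0 \<le> \<bar>t\<bar> * clt_error d \<mu> \<epsilon>" using K0 by simp
    ultimately show ?thesis by simp
  qed
  have pa: "integrable (measure_pmf (poisson_pmf \<mu>)) a" and pb: "integrable (measure_pmf (poisson_pmf \<mu>)) b"
    using a1 b1 by (auto intro!: measure_pmf.integrable_const_bound[where B = 1])
  note var = poisson_pmf_variance[OF \<mu>0]
  have "cmod (measure_pmf.expectation (poisson_pmf \<mu>) a - measure_pmf.expectation (poisson_pmf \<mu>) b)
     \<le> measure_pmf.expectation (poisson_pmf \<mu>) (\<lambda>n. cmod (a n - b n))"
    using pa pb integral_norm_bound[of "measure_pmf (poisson_pmf \<mu>)" "\<lambda>n. a n - b n"] by simp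
  also have "\<dots> \<le> measure_pmf.expectation (poisson_pmf \<mu>) (\<lambda>n. \<bar>t\<bar> * clt_error d \<mu> \<epsilon> + 2 / \<delta>\<^sup>2 * (real n - \<mu>)\<^sup>2)"
    using pa pb var(1) by (intro integral_mono pt) auto
  also have "\<dots> = \<bar>t\<bar> * clt_error d \<mu> \<epsilon> + 2 / \<delta>\<^sup>2 * \<mu>"
    using var by simp
  also have "2 / \<delta>\<^sup>2 * \<mu> = 2 * \<mu> powr (- 1 / 4)"
  proof -
    have "\<delta>\<^sup>2 = \<mu> powr (5 / 4)" by (simp add: \<delta>_def power2_eq_square powr_add[symmetric])
    then have "\<mu> / \<delta>\<^sup>2 = \<mu> powr 1 / \<mu> powr (5 / 4)" using \<mu>0 by simp
    also have "\<dots> = \<mu> powr (- 1 / 4)" by (simp only: powr_diff[symmetric]) simp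
    finally show ?thesis by simp
  qed
  also have "measure_pmf.expectation (poisson_pmf \<mu>) b =
      exp (\<mu> * ((\<integral>a. iexp (t / sqrt \<mu> * proj a) \<partial>Q) - 1) - \<i> * (t * sqrt \<mu> * mean))"
    unfolding b_def integral_iexp_linear_normalized[OF \<mu>0]
    by (simp add: poisson_pmf_power[OF \<mu>0] exp_add[symmetric] algebra_simps)
  finally show ?thesis unfolding a_def .
qed

text \<open>Taylor expansion of \<open>iexp\<close> to second order at
  \<open>s = t / sqrt \<mu>\<close>. Multiplied by \<open>\<mu>\<close>, the term of order 0 cancels
  with the 1, the term of order 1 with the centring, and the term of order 2 gives the second
  moment. No square of \<open>mean\<close> appears, because the exponent of a compound Poisson law
  is affine in the characteristic function of the summands and involves no logarithm.\<close>

lemma char_exponent_approx: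
  assumes \<mu>: "\<mu> > 0"
  shows "cmod (\<mu> * ((\<integral>a. iexp (t / sqrt \<mu> * proj a) \<partial>Q) - 1) - \<i> * (t * sqrt \<mu> * mean) +
     complex_of_real (t\<^sup>2 / 2 * (\<integral>a. (proj a)\<^sup>2 \<partial>Q))) \<le> \<bar>t\<bar> ^ 3 / (6 * sqrt \<mu>)"
proof -
  define s where "s = t / sqrt \<mu>"
  let ?r = "\<lambda>a. iexp (s * proj a) - (1 + \<i> * (s * proj a) - complex_of_real ((s * proj a)\<^sup>2 / 2))"
  have i1: "integrable Q (\<lambda>a. iexp (s * proj a))"
    by (rule integrable_const_bound[where B = 1]) auto
  have i2: "integrable Q proj"
    by (rule integrable_const_bound[where B = 1]) (use proj_bound in auto)
  have i3: "integrable Q (\<lambda>a. (proj a)\<^sup>2)"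
    by (rule integrable_const_bound[where B = 1]) (use proj_bound in \<open>auto simp: abs_square_le_1\<close>)
  have r: "cmod (?r a) \<le> \<bar>s\<bar> ^ 3 / 6" for a
  proof -
    have "(\<Sum>k\<le>2. (\<i> * complex_of_real (s * proj a)) ^ k / fact k) =
      1 + \<i> * (s * proj a) - complex_of_real ((s * proj a)\<^sup>2 / 2)"
      by (simp add: numeral_2_eq_2 power2_eq_square[unfolded numeral_2_eq_2] power_mult_distrib)
    then have "cmod (?r a) \<le> \<bar>s * proj a\<bar> ^ 3 / 6"
      using iexp_approx1[of "s * proj a" 2] by (simp add: eval_nat_numeral)
    also have "\<bar>s * proj a\<bar> ^ 3 \<le> \<bar>s\<bar> ^ 3"
      using proj_bound by (intro power_mono) (auto simp: abs_mult mult_left_le)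
    finally show ?thesis by simp
  qed
  have "(\<integral>a. ?r a \<partial>Q) = (\<integral>a. iexp (s * proj a) - 1 - (\<i> * s) * complex_of_real (proj a) +
      complex_of_real (s\<^sup>2 / 2) * complex_of_real ((proj a)\<^sup>2) \<partial>Q)"
    by (intro Bochner_Integration.integral_cong refl) (simp add: power_mult_distrib)
  also have "\<dots> = (\<integral>a. iexp (s * proj a) \<partial>Q) - 1 - (\<i> * s) * complex_of_real mean +
      complex_of_real (s\<^sup>2 / 2) * complex_of_real (\<integral>a. (proj a)\<^sup>2 \<partial>Q)"
  proof -
    have j2: "integrable Q (\<lambda>a. (\<i> * s) * complex_of_real (proj a))"
      using i2 by (intro integrable_mult_right) simp
    have j3: "integrable Q (\<lambda>a. complex_of_real (s\<^sup>2 / 2) * complex_of_real ((proj a)\<^sup>2))"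
      using i3 by (intro integrable_mult_right) (simp del: of_real_power)
    have k2: "(\<integral>a. (\<i> * s) * complex_of_real (proj a) \<partial>Q) = (\<i> * s) * complex_of_real mean"
      by (simp add: integral_proj)
    have k3: "(\<integral>a. complex_of_real (s\<^sup>2 / 2) * complex_of_real ((proj a)\<^sup>2) \<partial>Q) =
       complex_of_real (s\<^sup>2 / 2) * complex_of_real (\<integral>a. (proj a)\<^sup>2 \<partial>Q)"
      by (simp del: of_real_power)
    have one: "(\<integral>a. (1 :: complex) \<partial>Q) = 1" by (simp add: prob_space)
    have i0: "integrable Q (\<lambda>a. 1 :: complex)" by simp
    note I1 = Bochner_Integration.integrable_diff[OF i1 i0]
    note I2 = Bochner_Integration.integrable_diff[OF I1 j2]
    show ?thesis
      unfolding Bochner_Integration.integral_add[OF I2 j3] Bochner_Integration.integral_diff[OF I1 j2]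
        Bochner_Integration.integral_diff[OF i1 i0] k2 k3 one ..
  qed
  finally have int: "(\<integral>a. ?r a \<partial>Q) = (\<integral>a. iexp (s * proj a) \<partial>Q) - 1 - (\<i> * s) * complex_of_real mean +
      complex_of_real (s\<^sup>2 / 2) * complex_of_real (\<integral>a. (proj a)\<^sup>2 \<partial>Q)" .
  have "\<mu> * s = t * (\<mu> / sqrt \<mu>)" by (simp add: s_def)
  then have "\<mu> * s = t * sqrt \<mu>" using \<mu> by (simp only: real_div_sqrt less_imp_le)
  then have m1: "complex_of_real \<mu> * s = complex_of_real (t * sqrt \<mu>)" by (simp only: of_real_mult[symmetric])
  have "\<mu> * (s\<^sup>2 / 2) = t\<^sup>2 / 2" using \<mu> by (simp add: s_def power_divide)
  then have m2: "complex_of_real \<mu> * complex_of_real (s\<^sup>2 / 2) = complex_of_real (t\<^sup>2 / 2)"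
    by (simp only: of_real_mult[symmetric])
  have eq: "\<mu> * ((\<integral>a. iexp (t / sqrt \<mu> * proj a) \<partial>Q) - 1) - \<i> * (t * sqrt \<mu> * mean) +
     complex_of_real (t\<^sup>2 / 2 * (\<integral>a. (proj a)\<^sup>2 \<partial>Q)) = \<mu> * (\<integral>a. ?r a \<partial>Q)"
  proof -
    have "\<mu> * (\<integral>a. ?r a \<partial>Q) = \<mu> * ((\<integral>a. iexp (s * proj a) \<partial>Q) - 1) - \<i> * ((complex_of_real \<mu> * s) * mean) +
      (complex_of_real \<mu> * complex_of_real (s\<^sup>2 / 2)) * complex_of_real (\<integral>a. (proj a)\<^sup>2 \<partial>Q)"
      unfolding int by (simp only: distrib_left right_diff_distrib mult_ac)
    then show ?thesis unfolding m1 m2 unfolding s_def by (simp only: of_real_mult)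
  qed
  have "cmod (\<integral>a. ?r a \<partial>Q) \<le> (\<integral>a. cmod (?r a) \<partial>Q)" by (rule integral_norm_bound)
  also have "\<dots> \<le> (\<integral>a. \<bar>s\<bar> ^ 3 / 6 \<partial>Q)"
    using r by (intro integral_mono integrable_const_bound[where B = "\<bar>s\<bar> ^ 3 / 6"]) auto
  finally have "cmod (\<integral>a. ?r a \<partial>Q) \<le> \<bar>s\<bar> ^ 3 / 6" by (simp add: prob_space)
  then have "cmod (\<mu> * (\<integral>a. ?r a \<partial>Q)) \<le> \<mu> * (\<bar>s\<bar> ^ 3 / 6)"
    using \<mu> by (simp only: norm_mult norm_of_real) (simp add: mult_left_mono)
  also have "\<dots> = \<bar>t\<bar> ^ 3 / (6 * sqrt \<mu>)"
  proof -
    have "\<mu> = sqrt \<mu> ^ 2" using \<mu> by simp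
    then have "sqrt \<mu> ^ 3 = \<mu> * sqrt \<mu>" by (simp add: eval_nat_numeral)
    then show ?thesis using \<mu> by (simp add: s_def abs_divide power_divide)
  qed
  finally show ?thesis unfolding eq .
qed

end

lemma clt_error_tendsto:
  "((\<lambda>\<mu>. \<bar>t\<bar> * clt_error d \<mu> ((1 + d) * \<mu> powr (- 3 / 8)) + 2 * \<mu> powr (- 1 / 4)) \<longlongrightarrow> 0) at_top"
  unfolding clt_error_def by real_asymp

section \<open>The sum over a Poisson process as a U-statistic\<close>

lemma bij_betw_inj_tuples_compose:
  assumes e: "bij_betw e {..<n} I"
  shows "bij_betw (\<lambda>\<iota>. \<lambda>k\<in>{..<d}. e (\<iota> k)) (inj_tuples d {..<n}) (inj_tuples d I)"
proof (rule bij_betwI[where g = "\<lambda>\<iota>. \<lambda>k\<in>{..<d}. the_inv_into {..<n} e (\<iota> k)"])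
  have inj: "inj_on e {..<n}" and im: "e ` {..<n} = I" using e by (auto simp: bij_betw_def)
  note inv = the_inv_into_f_f[OF inj] f_the_inv_into_f[OF inj, unfolded im]
  have ran: "the_inv_into {..<n} e i \<in> {..<n}" if "i \<in> I" for i
    using the_inv_into_into[OF inj, of i "{..<n}"] that im by auto
  show "(\<lambda>\<iota>. \<lambda>k\<in>{..<d}. e (\<iota> k)) \<in> inj_tuples d {..<n} \<rightarrow> inj_tuples d I"
    using inj im by (auto simp: inj_tuples_def inj_on_def PiE_iff)
  show "(\<lambda>\<iota>. \<lambda>k\<in>{..<d}. the_inv_into {..<n} e (\<iota> k)) \<in> inj_tuples d I \<rightarrow> inj_tuples d {..<n}"
  proof
    fix \<iota> assume \<iota>: "\<iota> \<in> inj_tuples d I"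
    have "the_inv_into {..<n} e (\<iota> k) = the_inv_into {..<n} e (\<iota> l) \<Longrightarrow> k < d \<Longrightarrow> l < d \<Longrightarrow> k = l" for k l
    proof -
      assume a: "the_inv_into {..<n} e (\<iota> k) = the_inv_into {..<n} e (\<iota> l)" "k < d" "l < d"
      have "\<iota> k = \<iota> l"
        using arg_cong[OF a(1), of e] \<iota> a(2,3) inv(2) by (auto simp: inj_tuples_def PiE_iff)
      then show "k = l" using \<iota> a(2,3) by (auto simp: inj_tuples_def inj_on_def)
    qed
    then show "(\<lambda>k\<in>{..<d}. the_inv_into {..<n} e (\<iota> k)) \<in> inj_tuples d {..<n}"
      using \<iota> ran by (auto simp: inj_tuples_def inj_on_def PiE_iff)
  qed
  show "(\<lambda>k\<in>{..<d}. the_inv_into {..<n} e ((\<lambda>k\<in>{..<d}. e (\<iota> k)) k)) = \<iota>" if "\<iota> \<in> inj_tuples d {..<n}" for \<iota>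
    using that inv(1) by (auto simp: inj_tuples_def PiE_iff extensional_def fun_eq_iff)
  show "(\<lambda>k\<in>{..<d}. e ((\<lambda>k\<in>{..<d}. the_inv_into {..<n} e (\<iota> k)) k)) = \<iota>" if "\<iota> \<in> inj_tuples d I" for \<iota>
    using that inv(2) by (auto simp: inj_tuples_def PiE_iff extensional_def fun_eq_iff)
qed

lemma card_inj_tuples_self: "finite I \<Longrightarrow> card I = n \<Longrightarrow> card (inj_tuples n I) = fact n"
  by (simp add: card_inj_tuples prod_falling_eq_fact)

lemma (in prob_space) distr_seq_space_restrict:
  "distr seq_space (PiM {..<n} (\<lambda>_. M)) (\<lambda>x. \<lambda>k\<in>{..<n}. x k) = PiM {..<n} (\<lambda>_. M)"
  using distr_PiM_reindex[of UNIV "\<lambda>_. M" "\<lambda>k. k" "{..<n}"] prob_space_axioms by auto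

context bounded_symmetric_kernel
begin

lemma ustat_depends: "depends_on {..<n} (ustat n)"
proof -
  have "f (\<lambda>k. x (\<iota> k)) = f (\<lambda>k. y (\<iota> k))"
    if "\<forall>i\<in>{..<n}. x i = y i" "\<iota> \<in> inj_tuples d {..<n}" for x y \<iota>
    using that by (intro depends_onD[OF f_depends]) (auto simp: inj_tuples_def)
  then show ?thesis by (auto simp: depends_on_def ustat_def intro!: sum.cong)
qed

lemma ustat_measurable_finite: "ustat n \<in> borel_measurable (PiM {..<n} (\<lambda>_. Q))"
proof -
  have "(\<lambda>x. f (\<lambda>k. x (\<iota> k))) \<in> borel_measurable (PiM {..<n} (\<lambda>_. Q))" if "\<iota> \<in> inj_tuples d {..<n}" for \<iota>
    using that by (intro measurable_depends_on_reindex[OF f_measurable f_depends]) (auto simp: inj_tuples_def)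
  then show ?thesis unfolding ustat_def by (intro borel_measurable_divide borel_measurable_sum) auto
qed

text \<open>The point process yields integrals over \<open>n\<close> coordinates, while the
  estimates live on the space of sequences, the same for all \<open>n\<close>.\<close>

lemma emeasure_ustat_finite:
  assumes S: "S \<in> sets borel"
  shows "(\<integral>\<^sup>+x. indicator S (ustat n x) \<partial>PiM {..<n} (\<lambda>_. Q)) = emeasure seq_space {x \<in> space seq_space. ustat n x \<in> S}"
proof -
  note ustat_measurable_finite[of n, measurable] S[measurable]
  have "(\<integral>\<^sup>+x. indicator S (ustat n x) \<partial>PiM {..<n} (\<lambda>_. Q)) =
    (\<integral>\<^sup>+x. indicator S (ustat n x) \<partial>distr seq_space (PiM {..<n} (\<lambda>_. Q)) (\<lambda>x. \<lambda>k\<in>{..<n}. x k))"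
    by (simp only: distr_seq_space_restrict)
  also have "\<dots> = (\<integral>\<^sup>+x. indicator S (ustat n (\<lambda>k\<in>{..<n}. x k)) \<partial>seq_space)"
    by (rule nn_integral_distr) measurable
  also have "\<dots> = (\<integral>\<^sup>+x. indicator {x \<in> space seq_space. ustat n x \<in> S} x \<partial>seq_space)"
  proof (intro nn_integral_cong)
    fix x assume "x \<in> space seq_space"
    moreover have "ustat n (\<lambda>k\<in>{..<n}. x k) = ustat n x" by (rule depends_onD[OF ustat_depends]) auto
    ultimately show "indicator S (ustat n (\<lambda>k\<in>{..<n}. x k)) = (indicator {x \<in> space seq_space. ustat n x \<in> S} x :: ennreal)"
      by (simp add: indicator_def)
  qed
  also have "\<dots> = emeasure seq_space {x \<in> space seq_space. ustat n x \<in> S}"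
    by (rule nn_integral_indicator) measurable
  finally show ?thesis .
qed

end

text \<open>The condition \<open>f_zero\<close> localises the kernel: a tuple with a point outside
  \<open>W\<close> contributes nothing, so a sum over the whole process involves the points in
  \<open>W\<close> only. It is asked for points of the space only, as for hyperplanes it relies on
  unit normals.\<close>

locale poisson_ustat = M: prob_space M
  for M :: "'w measure" and \<Lambda> :: "'x measure" and Y :: "nat \<Rightarrow> 'w \<Rightarrow> 'x" and W d f +
  assumes process: "poisson_process M \<Lambda> Y"
    and W_sets: "W \<in> sets \<Lambda>" and W_finite: "emeasure \<Lambda> W < \<infinity>" and W_pos: "measure \<Lambda> W > 0"
    and kernel: "bounded_symmetric_kernel (uniform_measure \<Lambda> W) d f"
    and f_zero: "\<And>x k. \<forall>i<d. x i \<in> space \<Lambda> \<Longrightarrow> k < d \<Longrightarrow> x k \<notin> W \<Longrightarrow> f x = 0"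
begin

sublocale K: bounded_symmetric_kernel "uniform_measure \<Lambda> W" d f by (rule kernel)

lemma Y_measurable [measurable]: "Y i \<in> measurable M \<Lambda>"
  using process by (simp add: poisson_process_def)

definition total :: "'w \<Rightarrow> real" where
  "total \<omega> = (\<Sum>\<^sub>\<infinity>\<iota>\<in>inj_tuples d UNIV. f (\<lambda>k. Y (\<iota> k) \<omega>)) / fact d"

lemma infsum_eq_sum_points:
  assumes fin: "finite {i. Y i \<omega> \<in> W}" and \<omega>: "\<omega> \<in> space M"
  shows "(\<Sum>\<^sub>\<infinity>\<iota>\<in>inj_tuples d UNIV. f (\<lambda>k. Y (\<iota> k) \<omega>)) = (\<Sum>\<iota>\<in>inj_tuples d {i. Y i \<omega> \<in> W}. f (\<lambda>k. Y (\<iota> k) \<omega>))"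
proof -
  have sp: "Y i \<omega> \<in> space \<Lambda>" for i using measurable_space[OF Y_measurable \<omega>] .
  have "(\<Sum>\<^sub>\<infinity>\<iota>\<in>inj_tuples d UNIV. f (\<lambda>k. Y (\<iota> k) \<omega>)) = (\<Sum>\<^sub>\<infinity>\<iota>\<in>inj_tuples d {i. Y i \<omega> \<in> W}. f (\<lambda>k. Y (\<iota> k) \<omega>))"
  proof (rule infsum_cong_neutral)
    fix \<iota> assume "\<iota> \<in> inj_tuples d UNIV - inj_tuples d {i. Y i \<omega> \<in> W}"
    then obtain k where "k < d" "Y (\<iota> k) \<omega> \<notin> W" by (auto simp: inj_tuples_def PiE_iff)
    then show "f (\<lambda>k. Y (\<iota> k) \<omega>) = 0" using sp by (intro f_zero) auto
  qed (auto simp: inj_tuples_def PiE_iff)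
  then show ?thesis using fin by (simp add: infsum_finite finite_inj_tuples)
qed

text \<open>Any enumeration of the points in \<open>W\<close> carries the injective tuples of
  \<open>{..<n}\<close> bijectively to those of the indices of these points.\<close>

lemma ustat_eq_total:
  assumes pc: "point_count Y W \<omega> = of_nat n" and \<omega>: "\<omega> \<in> space M"
    and e: "e \<in> inj_tuples n UNIV" "\<forall>k<n. Y (e k) \<omega> \<in> W"
  shows "K.ustat n (\<lambda>k\<in>{..<n}. Y (e k) \<omega>) = total \<omega>"
proof -
  let ?I = "{i. Y i \<omega> \<in> W}"
  have I: "finite ?I" "card ?I = n" using pc by (auto simp: point_count_eq_of_nat_iff)
  have inj: "inj_on e {..<n}" using e(1) by (simp add: inj_tuples_def)
  have "e ` {..<n} = ?I"
    using I e inj by (intro card_subset_eq) (auto simp: card_image)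
  then have bij: "bij_betw e {..<n} ?I" using inj by (simp add: bij_betw_def)
  have "(\<Sum>\<iota>\<in>inj_tuples d {..<n}. f (\<lambda>k. (\<lambda>k\<in>{..<n}. Y (e k) \<omega>) (\<iota> k))) =
    (\<Sum>\<iota>\<in>inj_tuples d {..<n}. f (\<lambda>k. Y ((\<lambda>k\<in>{..<d}. e (\<iota> k)) k) \<omega>))"
    by (intro sum.cong refl depends_onD[OF K.f_depends]) (auto simp: inj_tuples_def)
  also have "\<dots> = (\<Sum>\<iota>\<in>inj_tuples d ?I. f (\<lambda>k. Y (\<iota> k) \<omega>))"
    by (rule sum.reindex_bij_betw[OF bij_betw_inj_tuples_compose[OF bij]])
  finally show ?thesis
    by (simp add: K.ustat_def total_def infsum_eq_sum_points[OF I(1) \<omega>])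
qed

text \<open>The Janossy formula is applied to the indicator of an event that all enumerations decide
  alike. So the left side acquires the factor \<open>fact n\<close>, the same that separates the
  constant of the formula from the Poisson weight; being neither 0 nor infinite, it cancels.\<close>

lemma emeasure_total_given_count:
  assumes [measurable]: "total \<in> borel_measurable M" and S[measurable]: "S \<in> sets borel"
  shows "emeasure M {\<omega> \<in> space M. total \<omega> \<in> S \<and> point_count Y W \<omega> = of_nat n} =
    ennreal (pmf (poisson_pmf (measure \<Lambda> W)) n) * emeasure K.seq_space {x \<in> space K.seq_space. K.ustat n x \<in> S}"
proof -
  note W_sets[measurable]
  let ?G = "\<lambda>x. indicator S (K.ustat n x) :: ennreal"
  have sets: "sets (PiM {..<n} (\<lambda>_. \<Lambda>)) = sets (PiM {..<n} (\<lambda>_. uniform_measure \<Lambda> W))"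
    by (intro sets_PiM_cong) auto
  have [measurable]: "K.ustat n \<in> borel_measurable (PiM {..<n} (\<lambda>_. \<Lambda>))"
    using K.ustat_measurable_finite[of n] by (subst measurable_cong_sets[OF sets refl])
  have "(\<integral>\<^sup>+\<omega>. (\<integral>\<^sup>+e. (\<Prod>k<n. indicator W (Y (e k) \<omega>)) * ?G (\<lambda>k\<in>{..<n}. Y (e k) \<omega>)
        \<partial>count_space (inj_tuples n UNIV)) * indicator {\<omega>. point_count Y W \<omega> = of_nat n} \<omega> \<partial>M) =
    (\<integral>\<^sup>+\<omega>. fact n * indicator {\<omega> \<in> space M. total \<omega> \<in> S \<and> point_count Y W \<omega> = of_nat n} \<omega> \<partial>M)"
  proof (intro nn_integral_cong)
    fix \<omega> assume \<omega>: "\<omega> \<in> space M"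
    show "(\<integral>\<^sup>+e. (\<Prod>k<n. indicator W (Y (e k) \<omega>)) * ?G (\<lambda>k\<in>{..<n}. Y (e k) \<omega>)
        \<partial>count_space (inj_tuples n UNIV)) * indicator {\<omega>. point_count Y W \<omega> = of_nat n} \<omega> =
      (fact n :: ennreal) * indicator {\<omega> \<in> space M. total \<omega> \<in> S \<and> point_count Y W \<omega> = of_nat n} \<omega>"
    proof (cases "point_count Y W \<omega> = of_nat n")
      case True
      let ?I = "{i. Y i \<omega> \<in> W}"
      have I: "finite ?I" "card ?I = n" using True by (auto simp: point_count_eq_of_nat_iff)
      have "(\<integral>\<^sup>+e. (\<Prod>k<n. indicator W (Y (e k) \<omega>)) * ?G (\<lambda>k\<in>{..<n}. Y (e k) \<omega>) \<partial>count_space (inj_tuples n UNIV)) =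
         (\<integral>\<^sup>+e. indicator S (total \<omega>) * indicator (inj_tuples n ?I) e \<partial>count_space (inj_tuples n UNIV))"
      proof (intro nn_integral_cong)
        fix e :: "nat \<Rightarrow> nat" assume "e \<in> space (count_space (inj_tuples n UNIV))"
        then have e: "e \<in> inj_tuples n UNIV" by simp
        then have "e \<in> inj_tuples n ?I \<longleftrightarrow> (\<forall>k<n. Y (e k) \<omega> \<in> W)"
          by (auto simp: inj_tuples_def PiE_iff)
        then show "(\<Prod>k<n. indicator W (Y (e k) \<omega>)) * ?G (\<lambda>k\<in>{..<n}. Y (e k) \<omega>) =
          indicator S (total \<omega>) * (indicator (inj_tuples n ?I) e :: ennreal)"
          using ustat_eq_total[OF True \<omega> e] by (auto simp: prod_indicator_ennreal indicator_def)
      qed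
      also have "\<dots> = indicator S (total \<omega>) * fact n"
      proof -
        have "inj_tuples n ?I \<subseteq> inj_tuples n UNIV" by (auto simp: inj_tuples_def)
        then show ?thesis
          using I by (simp add: nn_integral_cmult emeasure_count_space_finite finite_inj_tuples card_inj_tuples_self)
      qed
      finally show ?thesis using True \<omega> by (simp add: indicator_def)
    qed simp
  qed
  also have "\<dots> = fact n * emeasure M {\<omega> \<in> space M. total \<omega> \<in> S \<and> point_count Y W \<omega> = of_nat n}"
    by (rule nn_integral_cmult_indicator) measurable
  finally have "fact n * emeasure M {\<omega> \<in> space M. total \<omega> \<in> S \<and> point_count Y W \<omega> = of_nat n} =
    ennreal (exp (- measure \<Lambda> W) * measure \<Lambda> W ^ n) * emeasure K.seq_space {x \<in> space K.seq_space. K.ustat n x \<in> S}"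
    using poisson_process_janossy[OF M.prob_space_axioms process W_sets W_finite W_pos, of ?G n]
      K.emeasure_ustat_finite[OF S, of n] by simp
  also have "ennreal (exp (- measure \<Lambda> W) * measure \<Lambda> W ^ n) = fact n * ennreal (pmf (poisson_pmf (measure \<Lambda> W)) n)"
  proof -
    have "(fact n :: ennreal) = ennreal (fact n)" by (metis ennreal_of_nat_eq_real_of_nat of_nat_fact)
    then show ?thesis using W_pos by (simp add: ennreal_mult[symmetric])
  qed
  finally have eq: "fact n * emeasure M {\<omega> \<in> space M. total \<omega> \<in> S \<and> point_count Y W \<omega> = of_nat n} =
    fact n * (ennreal (pmf (poisson_pmf (measure \<Lambda> W)) n) * emeasure K.seq_space {x \<in> space K.seq_space. K.ustat n x \<in> S})"
    by (simp add: mult.assoc)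
  have "(fact n :: ennreal) = of_nat (fact n)" by simp
  then have "(fact n :: ennreal) \<noteq> 0" "(fact n :: ennreal) \<noteq> \<top>"
    by (simp, metis ennreal_of_nat_neq_top of_nat_fact)
  with eq show ?thesis by (simp add: ennreal_mult_cancel_left)
qed

text \<open>The events of exactly \<open>n\<close> points are disjoint, so that summing
  \<open>emeasure_total_given_count\<close> over \<open>n\<close> bounds the mixture from above by
  the law of \<open>total\<close>.\<close>

lemma distr_total:
  assumes [measurable]: "total \<in> borel_measurable M"
  shows "distr M borel total =
    distr (measure_pmf (poisson_pmf (measure \<Lambda> W)) \<Otimes>\<^sub>M K.seq_space) borel (\<lambda>z. K.ustat (fst z) (snd z))"
    (is "?D1 = ?D2")
proof -
  note W_sets[measurable]
  let ?p = "poisson_pmf (measure \<Lambda> W)"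
  interpret PP: pair_prob_space "measure_pmf ?p" K.seq_space by unfold_locales
  have "(\<lambda>z. K.ustat (fst z) (snd z)) \<in> borel_measurable (count_space UNIV \<Otimes>\<^sub>M K.seq_space)"
    by (rule measurable_pair_measure_countable1) auto
  then have [measurable]: "(\<lambda>z. K.ustat (fst z) (snd z)) \<in> borel_measurable (measure_pmf ?p \<Otimes>\<^sub>M K.seq_space)"
    by (subst measurable_cong_sets[OF sets_pair_measure_cong[OF sets_measure_pmf_count_space refl] refl])
  interpret D1: prob_space ?D1 by (rule M.prob_space_distr) measurable
  interpret D2: prob_space ?D2 by (rule PP.P.prob_space_distr) measurable
  \<comment> \<open>For two probability measures one inequality on all sets suffices, so the null event of infinitely
    many points in \<open>W\<close> never has to be discussed.\<close>
  have le: "emeasure ?D2 S \<le> emeasure ?D1 S" if S[measurable]: "S \<in> sets borel" for S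
  proof -
    have "emeasure ?D2 S = emeasure (measure_pmf ?p \<Otimes>\<^sub>M K.seq_space) {z \<in> space (measure_pmf ?p \<Otimes>\<^sub>M K.seq_space). K.ustat (fst z) (snd z) \<in> S}"
      by (subst emeasure_distr) (auto intro!: arg_cong2[where f = emeasure])
    also have "\<dots> = (\<integral>\<^sup>+n. emeasure K.seq_space (Pair n -` {z \<in> space (measure_pmf ?p \<Otimes>\<^sub>M K.seq_space). K.ustat (fst z) (snd z) \<in> S}) \<partial>measure_pmf ?p)"
      by (rule K.S.emeasure_pair_measure_alt) measurable
    also have "\<dots> = (\<integral>\<^sup>+n. emeasure K.seq_space {x \<in> space K.seq_space. K.ustat n x \<in> S} \<partial>measure_pmf ?p)"
      by (intro nn_integral_cong arg_cong2[where f = emeasure]) (auto simp: space_pair_measure)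
    also have "\<dots> = (\<integral>\<^sup>+n. ennreal (pmf ?p n) * emeasure K.seq_space {x \<in> space K.seq_space. K.ustat n x \<in> S} \<partial>count_space UNIV)"
      by (rule nn_integral_measure_pmf)
    also have "\<dots> = (\<Sum>n. ennreal (pmf ?p n) * emeasure K.seq_space {x \<in> space K.seq_space. K.ustat n x \<in> S})"
      by (rule nn_integral_count_space_nat)
    also have "\<dots> = (\<Sum>n. emeasure M {\<omega> \<in> space M. total \<omega> \<in> S \<and> point_count Y W \<omega> = of_nat n})"
      by (simp only: emeasure_total_given_count[OF assms S])
    also have "\<dots> = emeasure M (\<Union>n. {\<omega> \<in> space M. total \<omega> \<in> S \<and> point_count Y W \<omega> = of_nat n})"
      by (rule suminf_emeasure) (measurable, auto simp: disjoint_family_on_def)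
    also have "\<dots> \<le> emeasure M (total -` S \<inter> space M)"
      by (rule emeasure_mono) (auto intro: measurable_sets[OF assms S])
    also have "\<dots> = emeasure ?D1 S" by (subst emeasure_distr) auto
    finally show ?thesis .
  qed
  have le': "measure ?D2 S \<le> measure ?D1 S" if "S \<in> sets borel" for S
    using le[OF that] by (simp add: D1.emeasure_eq_measure D2.emeasure_eq_measure)
  show ?thesis
  proof (rule measure_eqI)
    fix S assume "S \<in> sets ?D1"
    then have S: "S \<in> sets borel" by simp
    have "measure ?D1 (space ?D1 - S) = 1 - measure ?D1 S" using S by (intro D1.prob_compl) simp
    moreover have "measure ?D2 (space ?D2 - S) = 1 - measure ?D2 S" using S by (intro D2.prob_compl) simp
    ultimately have "measure ?D1 S = measure ?D2 S"
      using le'[OF S] le'[of "- S"] S by (simp add: Compl_eq_Diff_UNIV)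
    then show "emeasure ?D1 S = emeasure ?D2 S" by (simp add: D1.emeasure_eq_measure D2.emeasure_eq_measure)
  qed simp
qed

lemma expectation_total:
  fixes g :: "real \<Rightarrow> complex"
  assumes [measurable]: "total \<in> borel_measurable M" "g \<in> borel_measurable borel" and g: "\<And>y. cmod (g y) \<le> b"
  shows "(\<integral>\<omega>. g (total \<omega>) \<partial>M) =
    measure_pmf.expectation (poisson_pmf (measure \<Lambda> W)) (\<lambda>n. \<integral>x. g (K.ustat n x) \<partial>K.seq_space)"
proof -
  let ?p = "poisson_pmf (measure \<Lambda> W)"
  interpret PP: pair_prob_space "measure_pmf ?p" K.seq_space by unfold_locales
  have "(\<lambda>z. K.ustat (fst z) (snd z)) \<in> borel_measurable (count_space UNIV \<Otimes>\<^sub>M K.seq_space)"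
    by (rule measurable_pair_measure_countable1) auto
  then have [measurable]: "(\<lambda>z. K.ustat (fst z) (snd z)) \<in> borel_measurable (measure_pmf ?p \<Otimes>\<^sub>M K.seq_space)"
    by (subst measurable_cong_sets[OF sets_pair_measure_cong[OF sets_measure_pmf_count_space refl] refl])
  have "(\<integral>\<omega>. g (total \<omega>) \<partial>M) = (\<integral>y. g y \<partial>distr M borel total)"
    by (rule integral_distr[symmetric]) measurable
  also have "\<dots> = (\<integral>z. g (K.ustat (fst z) (snd z)) \<partial>(measure_pmf ?p \<Otimes>\<^sub>M K.seq_space))"
    unfolding distr_total[OF assms(1)] by (rule integral_distr) measurable
  also have "\<dots> = measure_pmf.expectation ?p (\<lambda>n. \<integral>x. g (K.ustat n x) \<partial>K.seq_space)"
    by (subst PP.integral_fst'[symmetric]) (auto intro!: PP.P.integrable_const_bound[where B = b] simp: g)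
  finally show ?thesis .
qed

end

section \<open>The hyperplane kernel\<close>

lemma sort_tuple_cong:
  fixes v w :: "nat \<Rightarrow> real ^ 'n::{finite,linorder}"
  assumes "\<And>i. i < CARD('n) \<Longrightarrow> v i = w i"
  shows "sort_tuple R v = sort_tuple R w"
proof -
  have "v (\<pi> i) = w (\<pi> i)" if "\<pi> permutes {..<CARD('n)}" "i < CARD('n)" for \<pi> i
    using that assms permutes_in_image[OF that(1), of i] by auto
  then show ?thesis
    unfolding sort_tuple_def by (intro arg_cong[where f = The] ext) auto
qed

text \<open>Composition with \<open>p\<close> and with its inverse permutes the candidates for
  \<open>\<pi>\<close>, so both sides are described by the same predicate.\<close>

lemma sort_tuple_permute:
  fixes v :: "nat \<Rightarrow> real ^ 'n::{finite,linorder}"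
  assumes p: "p permutes {..<CARD('n)}"
  shows "sort_tuple R (\<lambda>i. v (p i)) = sort_tuple R v"
proof -
  have "(\<exists>\<pi>. \<pi> permutes {..<CARD('n)} \<and> (\<forall>i<CARD('n). w i = v (p (\<pi> i)))) \<longleftrightarrow>
        (\<exists>\<pi>. \<pi> permutes {..<CARD('n)} \<and> (\<forall>i<CARD('n). w i = v (\<pi> i)))" for w
  proof
    assume "\<exists>\<pi>. \<pi> permutes {..<CARD('n)} \<and> (\<forall>i<CARD('n). w i = v (p (\<pi> i)))"
    then obtain \<pi> where "\<pi> permutes {..<CARD('n)}" "\<forall>i<CARD('n). w i = v (p (\<pi> i))" by auto
    then show "\<exists>\<pi>. \<pi> permutes {..<CARD('n)} \<and> (\<forall>i<CARD('n). w i = v (\<pi> i))"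
      using p by (intro exI[of _ "p \<circ> \<pi>"]) (auto intro: permutes_compose)
  next
    assume "\<exists>\<pi>. \<pi> permutes {..<CARD('n)} \<and> (\<forall>i<CARD('n). w i = v (\<pi> i))"
    then obtain \<pi> where "\<pi> permutes {..<CARD('n)}" "\<forall>i<CARD('n). w i = v (\<pi> i)" by auto
    then show "\<exists>\<pi>. \<pi> permutes {..<CARD('n)} \<and> (\<forall>i<CARD('n). w i = v (p (\<pi> i)))"
      using p by (intro exI[of _ "Hilbert_Choice.inv p \<circ> \<pi>"])
        (auto intro: permutes_compose permutes_inv simp: permutes_inverses)
  qed
  then show ?thesis unfolding sort_tuple_def by simp
qed

lemma hyp_kernel_bound: "\<bar>hyp_kernel R r B x\<bar> \<le> 1"
  by (simp add: hyp_kernel_def chi_def indicator_def)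

lemma hyp_kernel_depends:
  "depends_on {..<CARD('n)} (hyp_kernel R r B :: (nat \<Rightarrow> real \<times> (real ^ 'n::{finite,linorder})) \<Rightarrow> real)"
proof -
  have "hyp_kernel R r B x = hyp_kernel R r B y" if "\<forall>i\<in>{..<CARD('n)}. x i = y i"
    for x y :: "nat \<Rightarrow> real \<times> (real ^ 'n::{finite,linorder})"
    using that sort_tuple_cong[of "\<lambda>i. snd (x i)" "\<lambda>i. snd (y i)" R] by (simp add: hyp_kernel_def)
  then show ?thesis by (auto simp: depends_on_def)
qed

lemma hyp_kernel_permute:
  fixes x :: "nat \<Rightarrow> real \<times> (real ^ 'n::{finite,linorder})"
  assumes p: "p permutes {..<CARD('n)}"
  shows "hyp_kernel R r B (\<lambda>i. x (p i)) = hyp_kernel R r B x"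
proof -
  have "(\<Inter>i<CARD('n). hyperplane (fst (x (p i))) (snd (x (p i)))) =
     (\<Inter>i\<in>p ` {..<CARD('n)}. hyperplane (fst (x i)) (snd (x i)))" by simp
  then show ?thesis
    using sort_tuple_permute[OF p, of R "\<lambda>i. snd (x i)"] by (simp add: hyp_kernel_def permutes_image[OF p])
qed

text \<open>By Cauchy-Schwarz, a unit normal has inner product at most \<open>r\<close> in absolute
  value with every point of the ball.\<close>

lemma hyp_kernel_zero:
  fixes x :: "nat \<Rightarrow> real \<times> (real ^ 'n::{finite,linorder})"
  assumes k: "k < CARD('n)" and v: "snd (x k) \<in> half_sphere" and p: "fst (x k) \<notin> {-r..r}"
  shows "hyp_kernel R r B x = 0"
proof -
  have "\<bar>y \<bullet> snd (x k)\<bar> \<le> r" if "y \<in> cball 0 r" for y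
    using that Cauchy_Schwarz_ineq2[of y "snd (x k)"] v by (simp add: half_sphere_def)
  then have "(\<Inter>i<CARD('n). hyperplane (fst (x i)) (snd (x i))) \<inter> cball 0 r = {}"
    using k p by (fastforce simp: hyperplane_def abs_le_iff)
  then show ?thesis by (simp add: hyp_kernel_def chi_def)
qed

text \<open>A dilation by \<open>c\<close> moves the common point of the hyperplanes along with the
  ball and leaves the normals unchanged.\<close>

lemma hyp_kernel_scale:
  fixes x :: "nat \<Rightarrow> real \<times> (real ^ 'n::{finite,linorder})"
  assumes c: "c > 0"
  shows "hyp_kernel R (c * r) B (\<lambda>i. (c * fst (x i), snd (x i))) = hyp_kernel R r B x"
proof -
  have "(\<exists>y. (\<forall>i<CARD('n). y \<bullet> snd (x i) = c * fst (x i)) \<and> norm y \<le> c * r) \<longleftrightarrow>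
    (\<exists>y. (\<forall>i<CARD('n). y \<bullet> snd (x i) = fst (x i)) \<and> norm y \<le> r)"
  proof
    assume "\<exists>y. (\<forall>i<CARD('n). y \<bullet> snd (x i) = c * fst (x i)) \<and> norm y \<le> c * r"
    then obtain y where "\<forall>i<CARD('n). y \<bullet> snd (x i) = c * fst (x i)" "norm y \<le> c * r" by auto
    then show "\<exists>y. (\<forall>i<CARD('n). y \<bullet> snd (x i) = fst (x i)) \<and> norm y \<le> r"
      using c by (intro exI[of _ "inverse c *\<^sub>R y"]) (auto simp: field_simps)
  next
    assume "\<exists>y. (\<forall>i<CARD('n). y \<bullet> snd (x i) = fst (x i)) \<and> norm y \<le> r"
    then obtain y where "\<forall>i<CARD('n). y \<bullet> snd (x i) = fst (x i)" "norm y \<le> r" by auto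
    then show "\<exists>y. (\<forall>i<CARD('n). y \<bullet> snd (x i) = c * fst (x i)) \<and> norm y \<le> c * r"
      using c by (intro exI[of _ "c *\<^sub>R y"]) auto
  qed
  then show ?thesis
    unfolding hyp_kernel_def chi_def by (auto simp: hyperplane_def set_eq_iff)
qed

text \<open>Existence of a common point quantifies over an uncountable set, which threatens
  measurability. It is replaced by approximate solutions in a countable dense set, for every
  tolerance. Unit normals make the equations Lipschitz with constant 1, so a solution can be
  approximated; conversely, approximate solutions lie in the compact ball of radius
  \<open>r + 1\<close>, and a limit point solves the equations exactly.\<close>

lemma hyperplanes_meet_ball_iff:
  fixes x :: "nat \<Rightarrow> real \<times> 'a::euclidean_space"
  assumes D: "\<And>S :: 'a set. open S \<Longrightarrow> S \<noteq> {} \<Longrightarrow> \<exists>d\<in>D. d \<in> S"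
    and v: "\<forall>i<n. norm (snd (x i)) = 1"
  shows "(\<exists>y. (\<forall>i<n. y \<bullet> snd (x i) = fst (x i)) \<and> norm y \<le> r) \<longleftrightarrow>
    (\<forall>k. \<exists>y\<in>D. (\<forall>i<n. \<bar>y \<bullet> snd (x i) - fst (x i)\<bar> < inverse (Suc k)) \<and> norm y \<le> r + inverse (Suc k))"
proof
  assume "\<exists>y. (\<forall>i<n. y \<bullet> snd (x i) = fst (x i)) \<and> norm y \<le> r"
  then obtain y where y: "\<forall>i<n. y \<bullet> snd (x i) = fst (x i)" "norm y \<le> r" by auto
  show "\<forall>k. \<exists>y\<in>D. (\<forall>i<n. \<bar>y \<bullet> snd (x i) - fst (x i)\<bar> < inverse (Suc k)) \<and> norm y \<le> r + inverse (Suc k)"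
  proof
    fix k
    have "ball y (inverse (Suc k)) \<noteq> {}" by simp
    then obtain z where z: "z \<in> D" "norm (z - y) < inverse (Suc k)"
      using D[of "ball y (inverse (Suc k))"] by (auto simp: dist_norm norm_minus_commute)
    have "\<bar>z \<bullet> snd (x i) - fst (x i)\<bar> < inverse (Suc k)" if "i < n" for i
    proof -
      have "\<bar>z \<bullet> snd (x i) - fst (x i)\<bar> = \<bar>(z - y) \<bullet> snd (x i)\<bar>" using y that by (simp add: inner_diff_left)
      also have "\<dots> \<le> norm (z - y)" using Cauchy_Schwarz_ineq2[of "z - y" "snd (x i)"] v that by simp
      finally show ?thesis using z by simp
    qed
    moreover have "norm z \<le> r + inverse (Suc k)" using norm_triangle_sub[of z y] y z by linarith
    ultimately show "\<exists>y\<in>D. (\<forall>i<n. \<bar>y \<bullet> snd (x i) - fst (x i)\<bar> < inverse (Suc k)) \<and> norm y \<le> r + inverse (Suc k)"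
      using z(1) by blast
  qed
next
  assume "\<forall>k. \<exists>y\<in>D. (\<forall>i<n. \<bar>y \<bullet> snd (x i) - fst (x i)\<bar> < inverse (Suc k)) \<and> norm y \<le> r + inverse (Suc k)"
  then obtain y where y: "\<And>k i. i < n \<Longrightarrow> \<bar>y k \<bullet> snd (x i) - fst (x i)\<bar> < inverse (Suc k)"
    "\<And>k. norm (y k) \<le> r + inverse (Suc k)" by metis
  have "y k \<in> cball 0 (r + 1)" for k
    using y(2)[of k] inverse_le_1_iff[of "real (Suc k)"] by simp
  moreover have "compact (cball (0 :: 'a) (r + 1))" by (rule compact_cball)
  ultimately obtain l s where s: "strict_mono (s :: nat \<Rightarrow> nat)" and l: "(y \<circ> s) \<longlonglongrightarrow> l"
    unfolding compact_def by (metis (no_types, lifting))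
  have inv0: "(\<lambda>k. inverse (real (Suc (s k)))) \<longlonglongrightarrow> 0"
    using LIMSEQ_subseq_LIMSEQ[OF LIMSEQ_inverse_real_of_nat s] by (simp add: o_def)
  have "norm l \<le> r"
  proof (rule LIMSEQ_le)
    show "(\<lambda>k. norm (y (s k))) \<longlonglongrightarrow> norm l" using tendsto_norm[OF l] by (simp add: o_def)
    show "(\<lambda>k. r + inverse (real (Suc (s k)))) \<longlonglongrightarrow> r" using tendsto_add[OF tendsto_const inv0, of r] by simp
  qed (use y(2) in auto)
  moreover have "l \<bullet> snd (x i) = fst (x i)" if "i < n" for i
  proof -
    have "(\<lambda>k. \<bar>y (s k) \<bullet> snd (x i) - fst (x i)\<bar>) \<longlonglongrightarrow> \<bar>l \<bullet> snd (x i) - fst (x i)\<bar>"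
      using l by (intro tendsto_intros) (simp add: o_def)
    moreover have "(\<lambda>k. \<bar>y (s k) \<bullet> snd (x i) - fst (x i)\<bar>) \<longlonglongrightarrow> 0"
      using y(1)[OF that] by (intro real_tendsto_sandwich[OF _ _ tendsto_const inv0]) (auto intro!: always_eventually less_imp_le)
    ultimately have "\<bar>l \<bullet> snd (x i) - fst (x i)\<bar> = 0" by (rule LIMSEQ_unique)
    then show ?thesis by simp
  qed
  ultimately show "\<exists>y. (\<forall>i<n. y \<bullet> snd (x i) = fst (x i)) \<and> norm y \<le> r" by auto
qed

text \<open>Of \<open>Q\<close> only the sigma-algebra enters, so the result serves both the law of
  the points in the window and the state space of the process.\<close>

lemma hyp_kernel_measurable:
  fixes R :: "(real ^ 'n::{finite,linorder}) rel" and Q :: "(real \<times> (real ^ 'n::{finite,linorder})) measure"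
  assumes Q: "sets Q = sets (borel \<Otimes>\<^sub>M half_sphere_borel)"
    and R: "sort_tuple R \<in> measurable tuple_borel tuple_borel" and B: "B \<in> sets tuple_borel"
  shows "hyp_kernel R r B \<in> borel_measurable (PiM {..<CARD('n)} (\<lambda>_. Q))"
proof -
  let ?P = "PiM {..<CARD('n)} (\<lambda>_. Q)"
  obtain D :: "(real ^ 'n::{finite,linorder}) set" where D: "countable D" "\<And>S. open S \<Longrightarrow> S \<noteq> {} \<Longrightarrow> \<exists>d\<in>D. d \<in> S"
    using countable_dense_exists[where 'a = "real ^ 'n::{finite,linorder}"] by auto
  have spQ: "space Q = UNIV \<times> half_sphere"
    using sets_eq_imp_space_eq[OF Q] by (simp add: space_pair_measure space_restrict_space)
  have fst_m: "fst \<in> borel_measurable Q"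
    by (subst measurable_cong_sets[OF Q refl]) (rule measurable_fst)
  have snd_m: "snd \<in> measurable Q half_sphere_borel"
    by (subst measurable_cong_sets[OF Q refl]) (rule measurable_snd)
  then have snd_b: "snd \<in> borel_measurable Q"
    by (simp add: measurable_restrict_space2_iff)
  have comp [measurable]: "(\<lambda>x. x i) \<in> measurable ?P Q" if "i < CARD('n)" for i
    using that by simp
  have [measurable]: "(\<lambda>x. fst (x i)) \<in> borel_measurable ?P" "(\<lambda>x. snd (x i)) \<in> borel_measurable ?P" if "i < CARD('n)" for i
    using measurable_compose[OF comp[OF that] fst_m] measurable_compose[OF comp[OF that] snd_b] by auto
  let ?A = "{x \<in> space ?P. \<forall>k. \<exists>y\<in>D. (\<forall>i\<in>{..<CARD('n)}. \<bar>y \<bullet> snd (x i) - fst (x i)\<bar> < inverse (Suc k)) \<and> norm y \<le> r + inverse (Suc k)}"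
  have A: "?A \<in> sets ?P"
    using D(1) by measurable
  have eq: "chi ((\<Inter>i<CARD('n). hyperplane (fst (x i)) (snd (x i))) \<inter> cball 0 r) = indicator ?A x"
    if x: "x \<in> space ?P" for x
  proof -
    have v: "\<forall>i<CARD('n). norm (snd (x i)) = 1"
      using x spQ by (auto simp: space_PiM PiE_iff half_sphere_def mem_Times_iff)
    have "(\<Inter>i<CARD('n). hyperplane (fst (x i)) (snd (x i))) \<inter> cball 0 r \<noteq> {} \<longleftrightarrow>
      (\<exists>y. (\<forall>i<CARD('n). y \<bullet> snd (x i) = fst (x i)) \<and> norm y \<le> r)"
      by (auto simp: hyperplane_def)
    also have "\<dots> \<longleftrightarrow> x \<in> ?A"
      using hyperplanes_meet_ball_iff[OF D(2) v, of r] x by (simp add: Ball_def)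
    finally show ?thesis by (auto simp: chi_def indicator_def)
  qed
  have sort: "(\<lambda>x. sort_tuple R (\<lambda>i\<in>{..<CARD('n)}. snd (x i))) \<in> measurable ?P tuple_borel"
    by (intro measurable_compose[OF _ R] measurable_restrict measurable_compose[OF comp snd_m]) auto
  have "(\<lambda>x. indicator ?A x * indicator B (sort_tuple R (\<lambda>i\<in>{..<CARD('n)}. snd (x i))) :: real) \<in> borel_measurable ?P"
    using A B by (intro borel_measurable_times borel_measurable_indicator measurable_compose[OF sort]) auto
  moreover have "hyp_kernel R r B x = indicator ?A x * indicator B (sort_tuple R (\<lambda>i\<in>{..<CARD('n)}. snd (x i)))"
    if "x \<in> space ?P" for x
    unfolding hyp_kernel_def eq[OF that] using sort_tuple_cong[of "\<lambda>i\<in>{..<CARD('n)}. snd (x i)" "\<lambda>i. snd (x i)" R] by simp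
  ultimately show ?thesis by (simp cong: measurable_cong)
qed

section \<open>The law of the points in the window and its scaling\<close>

lemma emeasure_lborel_symmetric: "r > 0 \<Longrightarrow> emeasure lborel {-r..r} = ennreal (2 * r)"
  by (subst emeasure_lborel_Icc) auto

lemma prob_space_uniform_interval: "r > 0 \<Longrightarrow> prob_space (uniform_measure lborel {-r..r :: real})"
  by (rule prob_space_uniform_measure) (simp_all only: emeasure_lborel_symmetric, simp_all)

text \<open>The intensity cancels in the normalisation, and the window is a full strip in the
  direction of the marks, so the product structure survives.\<close>

lemma uniform_measure_window:
  fixes \<Theta> :: "'a measure" and lam r :: real
  assumes "prob_space \<Theta>" and lam: "lam > 0" and r: "r > 0"
  shows "uniform_measure (scale_measure (ennreal lam) (lborel \<Otimes>\<^sub>M \<Theta>)) ({-r..r} \<times> space \<Theta>) =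
    uniform_measure lborel {-r..r} \<Otimes>\<^sub>M \<Theta>"
proof -
  interpret T: prob_space \<Theta> by fact
  interpret U: prob_space "uniform_measure lborel {-r..r}"
    using r by (rule prob_space_uniform_interval)
  interpret LT: pair_sigma_finite lborel \<Theta> ..
  show ?thesis
  proof (rule pair_measure_eqI[symmetric])
    show "sigma_finite_measure (uniform_measure lborel {-r..r})" by unfold_locales
    show "sigma_finite_measure \<Theta>" by unfold_locales
    show "sets (uniform_measure lborel {-r..r} \<Otimes>\<^sub>M \<Theta>) =
       sets (uniform_measure (scale_measure (ennreal lam) (lborel \<Otimes>\<^sub>M \<Theta>)) ({-r..r} \<times> space \<Theta>))"
      by (simp cong: sets_pair_measure_cong)
    fix A B assume A: "A \<in> sets (uniform_measure lborel {-r..r})" and B: "B \<in> sets \<Theta>"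
    then have A': "A \<in> sets lborel" by simp
    have "({-r..r} \<times> space \<Theta>) \<inter> (A \<times> B) = ({-r..r} \<inter> A) \<times> B"
      using sets.sets_into_space[OF B] by auto
    moreover have "emeasure (lborel \<Otimes>\<^sub>M \<Theta>) (({-r..r} \<inter> A) \<times> B) = emeasure lborel ({-r..r} \<inter> A) * emeasure \<Theta> B"
      using A' B by (intro T.emeasure_pair_measure_Times) auto
    moreover have "emeasure (lborel \<Otimes>\<^sub>M \<Theta>) ({-r..r} \<times> space \<Theta>) = emeasure lborel {-r..r} * emeasure \<Theta> (space \<Theta>)"
      by (intro T.emeasure_pair_measure_Times) auto
    ultimately have "emeasure (uniform_measure (scale_measure (ennreal lam) (lborel \<Otimes>\<^sub>M \<Theta>)) ({-r..r} \<times> space \<Theta>)) (A \<times> B) =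
      (ennreal lam * (emeasure lborel ({-r..r} \<inter> A) * emeasure \<Theta> B)) / (ennreal lam * emeasure lborel {-r..r})"
      using A' B by (simp add: T.emeasure_space_1)
    also have "\<dots> = emeasure lborel ({-r..r} \<inter> A) / emeasure lborel {-r..r} * emeasure \<Theta> B"
    proof -
      have "emeasure lborel ({-r..r} \<inter> A) \<le> emeasure lborel {-r..r}" using A' by (intro emeasure_mono) auto
      then have "emeasure lborel ({-r..r} \<inter> A) < \<infinity>" by (rule le_less_trans) (simp add: emeasure_lborel_Icc_eq)
      \<comment> \<open>Cancelling \<open>lam\<close> takes place among reals, where no infinite
        values interfere.\<close>
      then obtain a where a: "emeasure lborel ({-r..r} \<inter> A) = ennreal a" "a \<ge> 0"
        by (cases "emeasure lborel ({-r..r} \<inter> A)") auto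
      define b where "b = measure \<Theta> B"
      have b: "b \<ge> 0" by (simp add: b_def)
      have len: "emeasure lborel {-r..r} = ennreal (2 * r)" using r by simp
      have 1: "ennreal lam * (ennreal a * ennreal b) = ennreal (lam * (a * b))"
        using lam a(2) b by (simp only: ennreal_mult mult_nonneg_nonneg less_imp_le)
      have 2: "ennreal lam * ennreal (2 * r) = ennreal (lam * (2 * r))"
        using lam r by (intro ennreal_mult[symmetric]) auto
      have 3: "ennreal (a / (2 * r)) * ennreal b = ennreal (a / (2 * r) * b)"
        using a(2) b r by (intro ennreal_mult[symmetric]) auto
      have 4: "ennreal (lam * (a * b)) / ennreal (lam * (2 * r)) = ennreal (lam * (a * b) / (lam * (2 * r)))"
        using lam a(2) b r by (intro divide_ennreal) auto
      have 5: "ennreal a / ennreal (2 * r) = ennreal (a / (2 * r))"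
        using a(2) r by (intro divide_ennreal) auto
      have 6: "lam * (a * b) / (lam * (2 * r)) = a / (2 * r) * b" using lam by simp
      show ?thesis unfolding a T.emeasure_eq_measure b_def[symmetric] len 1 2 4 5 3 6 ..
    qed
    finally show "emeasure (uniform_measure lborel {-r..r}) A * emeasure \<Theta> B =
      emeasure (uniform_measure (scale_measure (ennreal lam) (lborel \<Otimes>\<^sub>M \<Theta>)) ({-r..r} \<times> space \<Theta>)) (A \<times> B)"
      using A' by simp
  qed
qed

lemma iid_marked_points_joint_law:
  fixes X :: "nat \<Rightarrow> 'v \<Rightarrow> real \<times> (real ^ 'n::{finite,linorder})"
  assumes "prob_space N" "iid_marked_points N \<Theta> r X"
  shows "distr N (PiM UNIV (\<lambda>_. lborel \<Otimes>\<^sub>M \<Theta>)) (\<lambda>\<omega> i. X i \<omega>) = PiM UNIV (\<lambda>_. uniform_measure lborel {-r..r} \<Otimes>\<^sub>M \<Theta>)"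
    and "X i \<in> measurable N (lborel \<Otimes>\<^sub>M \<Theta>)"
proof -
  interpret prob_space N by fact
  have ind: "indep_vars (\<lambda>_. lborel \<Otimes>\<^sub>M \<Theta>) X UNIV"
    and law: "distr N (lborel \<Otimes>\<^sub>M \<Theta>) (X i) = uniform_measure lborel {-r..r} \<Otimes>\<^sub>M \<Theta>" for i
    using assms(2) by (auto simp: iid_marked_points_def)
  have rv: "X i \<in> measurable N (lborel \<Otimes>\<^sub>M \<Theta>)" for i using ind by (auto simp: indep_vars_def)
  then show "X i \<in> measurable N (lborel \<Otimes>\<^sub>M \<Theta>)" .
  have "distr N (PiM UNIV (\<lambda>_. lborel \<Otimes>\<^sub>M \<Theta>)) (\<lambda>\<omega>. \<lambda>i\<in>UNIV. X i \<omega>) = PiM UNIV (\<lambda>i. distr N (lborel \<Otimes>\<^sub>M \<Theta>) (X i))"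
    using ind rv by (subst indep_vars_iff_distr_eq_PiM[symmetric]) auto
  then show "distr N (PiM UNIV (\<lambda>_. lborel \<Otimes>\<^sub>M \<Theta>)) (\<lambda>\<omega> i. X i \<omega>) = PiM UNIV (\<lambda>_. uniform_measure lborel {-r..r} \<Otimes>\<^sub>M \<Theta>)"
    by (simp add: law restrict_def)
qed

text \<open>The factor \<open>inverse c\<close> from the substitution is compensated by the length
  of the longer interval in the normalisation.\<close>

lemma distr_uniform_scale:
  assumes c: "c > 0" and r: "r > 0"
  shows "distr (uniform_measure lborel {-r..r}) lborel (\<lambda>p. c * p) = uniform_measure lborel {-(c * r)..c * r :: real}"
proof (rule measure_eqI)
  fix A :: "real set" assume "A \<in> sets (distr (uniform_measure lborel {-r..r}) lborel (\<lambda>p. c * p))"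
  then have A[measurable]: "A \<in> sets borel" by simp
  have [measurable]: "(\<lambda>p. c * p) -` A \<in> sets borel"
    using measurable_sets[of "\<lambda>p. c * p" borel borel A] by simp
  have "- (c * r) \<le> c * p \<longleftrightarrow> - r \<le> p" "c * p \<le> c * r \<longleftrightarrow> p \<le> r" for p
    using mult_le_cancel_left_pos[OF c, of "- r" p] mult_le_cancel_left_pos[OF c, of p r] by simp_all
  then have "{-r..r} \<inter> (\<lambda>p. c * p) -` A = (\<lambda>p. c * p) -` ({-(c * r)..c * r} \<inter> A)"
    by auto
  then have "emeasure lborel ({-r..r} \<inter> (\<lambda>p. c * p) -` A) = emeasure (distr lborel borel ((*) c)) ({-(c * r)..c * r} \<inter> A)"
    by (simp add: emeasure_distr)
  also have "\<dots> = ennreal (inverse c) * emeasure lborel ({-(c * r)..c * r} \<inter> A)"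
    using c by (subst lborel_distr_mult) (auto simp: emeasure_density nn_integral_cmult_indicator)
  finally have eq: "emeasure lborel ({-r..r} \<inter> (\<lambda>p. c * p) -` A) = ennreal (inverse c) * emeasure lborel ({-(c * r)..c * r} \<inter> A)" .
  have "emeasure lborel ({-(c * r)..c * r} \<inter> A) \<le> emeasure lborel {-(c * r)..c * r}" by (intro emeasure_mono) auto
  then have "emeasure lborel ({-(c * r)..c * r} \<inter> A) < \<infinity>"
    by (rule le_less_trans) (simp add: emeasure_lborel_Icc_eq)
  then obtain a where a: "emeasure lborel ({-(c * r)..c * r} \<inter> A) = ennreal a" "a \<ge> 0"
    by (cases "emeasure lborel ({-(c * r)..c * r} \<inter> A)") auto
  have "emeasure (distr (uniform_measure lborel {-r..r}) lborel (\<lambda>p. c * p)) A =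
     emeasure lborel ({-r..r} \<inter> (\<lambda>p. c * p) -` A) / ennreal (2 * r)"
    by (simp add: emeasure_distr emeasure_lborel_symmetric[OF r, symmetric] del: emeasure_lborel_Icc)
  also have "\<dots> = ennreal (inverse c) * ennreal a / ennreal (2 * r)" by (simp only: eq a(1))
  also have "ennreal (inverse c) * ennreal a = ennreal (inverse c * a)"
    using c a(2) by (intro ennreal_mult[symmetric]) auto
  also have "ennreal (inverse c * a) / ennreal (2 * r) = ennreal (inverse c * a / (2 * r))"
    using c r a(2) by (intro divide_ennreal) auto
  also have "inverse c * a / (2 * r) = a / (2 * (c * r))" using c r by (simp add: field_simps)
  also have "ennreal (a / (2 * (c * r))) = ennreal a / ennreal (2 * (c * r))"
    using c r a(2) by (intro divide_ennreal[symmetric]) auto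
  also have "\<dots> = emeasure (uniform_measure lborel {-(c * r)..c * r}) A"
    using emeasure_lborel_symmetric[of "c * r"] c r
    by (simp only: emeasure_uniform_measure a(1) mult_pos_pos borel_closed closed_atLeastAtMost A sets_lborel)
  finally show "emeasure (distr (uniform_measure lborel {-r..r}) lborel (\<lambda>p. c * p)) A =
     emeasure (uniform_measure lborel {-(c * r)..c * r}) A" .
qed simp

lemma iid_marked_points_scale:
  fixes X :: "nat \<Rightarrow> 'v \<Rightarrow> real \<times> (real ^ 'n::{finite,linorder})"
  assumes N: "prob_space N" and T: "prob_space \<Theta>" and X: "iid_marked_points N \<Theta> r X" and c: "c > 0" and r: "r > 0"
  shows "iid_marked_points N \<Theta> (c * r) (\<lambda>i \<omega>. (c * fst (X i \<omega>), snd (X i \<omega>)))"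
proof -
  interpret prob_space N by fact
  interpret T: prob_space \<Theta> by fact
  let ?s = "\<lambda>x :: real \<times> (real ^ 'n::{finite,linorder}). (c * fst x, snd x)"
  have ind: "indep_vars (\<lambda>_. lborel \<Otimes>\<^sub>M \<Theta>) X UNIV"
    and law: "distr N (lborel \<Otimes>\<^sub>M \<Theta>) (X i) = uniform_measure lborel {-r..r} \<Otimes>\<^sub>M \<Theta>" for i
    using X by (auto simp: iid_marked_points_def)
  note X_m = iid_marked_points_joint_law(2)[OF N X]
  have s: "?s \<in> measurable (lborel \<Otimes>\<^sub>M \<Theta>) (lborel \<Otimes>\<^sub>M \<Theta>)" by measurable
  have "indep_vars (\<lambda>_. lborel \<Otimes>\<^sub>M \<Theta>) (\<lambda>i \<omega>. ?s (X i \<omega>)) UNIV"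
    by (rule indep_vars_compose2[OF ind]) (rule s)
  moreover have "distr N (lborel \<Otimes>\<^sub>M \<Theta>) (\<lambda>\<omega>. ?s (X i \<omega>)) = uniform_measure lborel {-(c * r)..c * r} \<Otimes>\<^sub>M \<Theta>" for i
  proof -
    interpret U: prob_space "uniform_measure lborel {-r..r}"
      using r by (rule prob_space_uniform_interval)
    interpret U': prob_space "uniform_measure lborel {-(c * r)..c * r}"
      using r c by (intro prob_space_uniform_interval mult_pos_pos)
    have "distr N (lborel \<Otimes>\<^sub>M \<Theta>) (\<lambda>\<omega>. ?s (X i \<omega>)) = distr (distr N (lborel \<Otimes>\<^sub>M \<Theta>) (X i)) (lborel \<Otimes>\<^sub>M \<Theta>) ?s"
      using X_m s by (subst distr_distr) (auto simp: o_def)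
    also have "\<dots> = distr (uniform_measure lborel {-r..r} \<Otimes>\<^sub>M \<Theta>) (lborel \<Otimes>\<^sub>M \<Theta>) (\<lambda>(p, v). (c * p, v))"
      by (simp add: law split_beta')
    also have "\<dots> = distr (uniform_measure lborel {-r..r}) lborel (\<lambda>p. c * p) \<Otimes>\<^sub>M distr \<Theta> \<Theta> (\<lambda>v. v)"
      by (rule pair_measure_distr[symmetric]) (auto simp: distr_id2 intro: T.sigma_finite_measure_axioms)
    finally show ?thesis by (simp add: distr_uniform_scale[OF c r] distr_id2)
  qed
  ultimately show ?thesis by (simp add: iid_marked_points_def)
qed

section \<open>Convergence in distribution\<close>

text \<open>For real functions, summability is absolute summability, and both sides are 0 by
  convention when it fails. Measurability of an infinite sum thus becomes measurability of a
  parametric integral.\<close>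

lemma infsum_eq_integral_count_space:
  fixes f :: "'a \<Rightarrow> real"
  shows "infsum f A = (\<integral>x. f x \<partial>count_space A)"
proof (cases "f summable_on A")
  case True
  then have "Infinite_Set_Sum.abs_summable_on f A"
    using abs_summable_equivalent[of f A] summable_on_iff_abs_summable_on_real[of f A] by blast
  then have "infsetsum f A = infsum f A" by (rule infsetsum_infsum)
  then show ?thesis by (simp add: infsetsum_def)
next
  case False
  then have "\<not> Infinite_Set_Sum.abs_summable_on f A"
    using abs_summable_equivalent[of f A] summable_on_iff_abs_summable_on_real[of f A] by blast
  then show ?thesis
    using False by (simp add: infsum_not_exists abs_summable_on_def not_integrable_integral_eq)
qed

lemma borel_measurable_infsum:
  fixes g :: "'i \<Rightarrow> 'a \<Rightarrow> real"
  assumes "countable A" and g: "\<And>i. i \<in> A \<Longrightarrow> g i \<in> borel_measurable M"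
  shows "(\<lambda>x. \<Sum>\<^sub>\<infinity>i\<in>A. g i x) \<in> borel_measurable M"
proof -
  interpret sigma_finite_measure "count_space A"
    by (rule sigma_finite_measure_count_space_countable) fact
  have "(\<lambda>z. g (snd z) (fst z)) \<in> borel_measurable (M \<Otimes>\<^sub>M count_space A)"
    by (rule measurable_compose_countable'[where f = "\<lambda>i z. g i (fst z)" and g = snd and I = A])
       (auto intro: measurable_compose[OF measurable_fst g] \<open>countable A\<close>)
  then show ?thesis
    unfolding infsum_eq_integral_count_space
    by (intro borel_measurable_lebesgue_integral) (simp add: split_beta')
qed

lemma gaussian_eq_distr:
  assumes "s2 > 0"
  shows "gaussian 0 s2 = distr std_normal_distribution borel (\<lambda>x. sqrt s2 * x)"
proof -
  interpret prob_space std_normal_distribution by (rule prob_space_normal_density) simp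
  have "distributed std_normal_distribution lborel (\<lambda>x. x) (normal_density 0 1)"
    by (auto simp: distributed_def distr_id2)
  then have "distributed std_normal_distribution lborel (\<lambda>x. 0 + sqrt s2 * x) (normal_density (0 + sqrt s2 * 0) (\<bar>sqrt s2\<bar> * 1))"
    by (rule normal_density_affine) (use assms in auto)
  then have "distr std_normal_distribution lborel (\<lambda>x. sqrt s2 * x) = density lborel (normal_density 0 (sqrt s2))"
    using assms by (simp add: distributed_def)
  moreover have "distr std_normal_distribution lborel (\<lambda>x. sqrt s2 * x) = distr std_normal_distribution borel (\<lambda>x. sqrt s2 * x)"
    by (rule distr_cong) auto
  ultimately show ?thesis by (simp add: gaussian_def)
qed

lemma real_distribution_gaussian: "s2 > 0 \<Longrightarrow> real_distribution (gaussian 0 s2)"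
  unfolding gaussian_eq_distr
  by (intro prob_space.real_distribution_distr prob_space_normal_density) auto

lemma char_gaussian:
  assumes "s2 > 0"
  shows "char (gaussian 0 s2) t = exp (- complex_of_real (t\<^sup>2 / 2 * s2))"
proof -
  have "char (gaussian 0 s2) t = (CLINT x|std_normal_distribution. iexp (t * (sqrt s2 * x)))"
    unfolding char_def gaussian_eq_distr[OF assms] by (rule integral_distr) auto
  also have "\<dots> = char std_normal_distribution (t * sqrt s2)"
    by (simp add: char_def mult.assoc)
  also have "\<dots> = complex_of_real (exp (- (t\<^sup>2 / 2 * s2)))"
  proof -
    have "- ((t * sqrt s2)\<^sup>2) / 2 = - (t\<^sup>2 / 2 * s2)"
      using assms by (simp add: power_mult_distrib)
    then show ?thesis by (simp only: char_std_normal_distribution)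
  qed
  also have "\<dots> = exp (- complex_of_real (t\<^sup>2 / 2 * s2))"
    by (simp only: exp_of_real[symmetric] of_real_minus)
  finally show ?thesis .
qed

text \<open>Levy's continuity theorem concerns sequences; a limit along real \<open>r\<close>
  follows from the limits along all sequences that tend to infinity.\<close>

lemma converges_in_distribution_char:
  fixes Z :: "real \<Rightarrow> 'w \<Rightarrow> real"
  assumes "prob_space M" and Z: "\<And>r. r > 0 \<Longrightarrow> Z r \<in> borel_measurable M" and \<mu>: "real_distribution \<mu>"
    and lim: "\<And>t. ((\<lambda>r. char (distr M borel (Z r)) t) \<longlongrightarrow> char \<mu> t) at_top"
  shows "converges_in_distribution M Z \<mu> at_top"
  unfolding converges_in_distribution_def
proof (intro conjI allI impI)
  interpret prob_space M by fact
  show "\<forall>\<^sub>F r in at_top. Z r \<in> borel_measurable M"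
    using eventually_gt_at_top[of 0] by eventually_elim (rule Z)
  \<comment> \<open>A sequence tending to infinity may have finitely many terms
    \<open>r \<le> 0\<close>, where nothing is known about \<open>Z r\<close>; the continuity
    theorem wants every term to be a probability law.\<close>
  define Z' where "Z' r = (if r > 0 then Z r else (\<lambda>_. 0))" for r
  have Z'_m: "Z' r \<in> borel_measurable M" for r using Z by (simp add: Z'_def)
  have Z': "\<forall>\<^sub>F r in at_top. Z' r = Z r"
    using eventually_gt_at_top[of 0] by eventually_elim (simp add: Z'_def)
  fix x assume x: "isCont (cdf \<mu>) x"
  have "((\<lambda>r. cdf (distr M borel (Z' r)) x) \<longlongrightarrow> cdf \<mu> x) at_top"
  proof (rule tendsto_at_topI_sequentially)
    fix X :: "nat \<Rightarrow> real" assume X: "filterlim X at_top sequentially"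
    have "weak_conv_m (\<lambda>n. distr M borel (Z' (X n))) \<mu>"
    proof (rule levy_continuity[OF _ \<mu>])
      show "real_distribution (distr M borel (Z' (X n)))" for n
        using Z'_m by (rule real_distribution_distr)
      fix t
      have "((\<lambda>r. char (distr M borel (Z' r)) t) \<longlongrightarrow> char \<mu> t) at_top"
        by (rule Lim_transform_eventually[OF lim]) (use Z' in eventually_elim, simp)
      then show "(\<lambda>n. char (distr M borel (Z' (X n))) t) \<longlonglongrightarrow> char \<mu> t"
        by (rule filterlim_compose[OF _ X])
    qed
    then show "(\<lambda>n. cdf (distr M borel (Z' (X n))) x) \<longlonglongrightarrow> cdf \<mu> x"
      using x by (simp add: weak_conv_m_def weak_conv_def)
  qed
  then show "((\<lambda>r. cdf (distr M borel (Z r)) x) \<longlongrightarrow> cdf \<mu> x) at_top"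
    by (rule Lim_transform_eventually) (use Z' in eventually_elim, simp)
qed

context poisson_ustat
begin

text \<open>The exponent involves the projection and the mean of the kernel, which vary with the
  window. Hiding it behind an existential leaves a statement that can be used uniformly: all that
  matters is how far it is from the Gaussian exponent.\<close>

lemma total_normalized_char_approx:
  fixes t :: real
  defines "\<mu> \<equiv> measure \<Lambda> W"
  defines "\<epsilon> \<equiv> (1 + d) * \<mu> powr (- 3 / 8)"
  assumes total: "total \<in> borel_measurable M" and \<mu>: "\<mu> \<ge> 1" and \<epsilon>: "\<epsilon> \<le> 1 / 2"
  shows "\<exists>z. cmod (char (distr M borel (\<lambda>\<omega>. fact (d - 1) / \<mu> powr (d - 1 / 2) * (total \<omega> - \<mu> ^ d / fact d * K.mean))) t - exp z)
      \<le> \<bar>t\<bar> * clt_error d \<mu> \<epsilon> + 2 * \<mu> powr (- 1 / 4) \<and>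
    cmod (z + complex_of_real (t\<^sup>2 / 2 * (\<integral>a. (K.proj a)\<^sup>2 \<partial>uniform_measure \<Lambda> W))) \<le> \<bar>t\<bar> ^ 3 / (6 * sqrt \<mu>)"
proof (intro exI conjI)
  note total[measurable]
  let ?z = "\<mu> * ((\<integral>a. iexp (t / sqrt \<mu> * K.proj a) \<partial>uniform_measure \<Lambda> W) - 1) - \<i> * (t * sqrt \<mu> * K.mean)"
  let ?Z = "\<lambda>y. fact (d - 1) / \<mu> powr (d - 1 / 2) * (y - \<mu> ^ d / fact d * K.mean)"
  have "char (distr M borel (\<lambda>\<omega>. ?Z (total \<omega>))) t = (\<integral>\<omega>. iexp (t * ?Z (total \<omega>)) \<partial>M)"
    unfolding char_def by (rule integral_distr) measurable
  also have "\<dots> = measure_pmf.expectation (poisson_pmf \<mu>) (\<lambda>n. \<integral>x. iexp (t * ?Z (K.ustat n x)) \<partial>K.seq_space)"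
    unfolding \<mu>_def
  proof (rule expectation_total[where b = 1])
    show "cmod (iexp y) \<le> 1" for y by (simp only: norm_exp_i_times order_refl)
  qed measurable
  also have "\<dots> = measure_pmf.expectation (poisson_pmf \<mu>) (\<lambda>n. \<integral>x. iexp (t * K.ustat_normalized \<mu> n x) \<partial>K.seq_space)"
    by (simp only: K.ustat_normalized_def)
  finally show "cmod (char (distr M borel (\<lambda>\<omega>. ?Z (total \<omega>))) t - exp ?z)
      \<le> \<bar>t\<bar> * clt_error d \<mu> \<epsilon> + 2 * \<mu> powr (- 1 / 4)"
    using K.poisson_ustat_char_approx[OF \<mu>] \<epsilon> unfolding \<epsilon>_def by simp
  show "cmod (?z + complex_of_real (t\<^sup>2 / 2 * (\<integral>a. (K.proj a)\<^sup>2 \<partial>uniform_measure \<Lambda> W))) \<le> \<bar>t\<bar> ^ 3 / (6 * sqrt \<mu>)"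
    using \<mu> by (intro K.char_exponent_approx) simp
qed

end

section \<open>The hyperplane kernel as an instance of the abstract setting\<close>

lemma hyp_kernel_bounded_symmetric:
  fixes R :: "(real ^ 'n::{finite,linorder}) rel" and \<Theta> :: "(real ^ 'n::{finite,linorder}) measure"
  assumes T: "prob_space \<Theta>" and sets_T: "sets \<Theta> = sets half_sphere_borel" and r: "r > 0"
    and R: "sort_tuple R \<in> measurable tuple_borel tuple_borel" and B: "B \<in> sets tuple_borel"
  shows "bounded_symmetric_kernel (uniform_measure lborel {-r..r} \<Otimes>\<^sub>M \<Theta>) CARD('n) (hyp_kernel R r B)"
proof -
  interpret T: prob_space \<Theta> by fact
  interpret U: prob_space "uniform_measure lborel {-r..r}" using r by (rule prob_space_uniform_interval)
  interpret UT: pair_prob_space "uniform_measure lborel {-r..r}" \<Theta> ..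
  show ?thesis
  proof (unfold_locales)
    show "hyp_kernel R r B \<in> borel_measurable (PiM {..<CARD('n)} (\<lambda>_. uniform_measure lborel {-r..r} \<Otimes>\<^sub>M \<Theta>))"
      by (rule hyp_kernel_measurable[OF _ R B]) (intro sets_pair_measure_cong; simp add: sets_T)
  qed (simp_all add: hyp_kernel_bound hyp_kernel_depends hyp_kernel_permute)
qed

lemma kernel_mean_sigma1_eq:
  fixes R :: "(real ^ 'n::{finite,linorder}) rel" and \<Theta> :: "(real ^ 'n::{finite,linorder}) measure"
  assumes T: "prob_space \<Theta>" and sets_T: "sets \<Theta> = sets half_sphere_borel" and r: "r > 0"
    and R: "sort_tuple R \<in> measurable tuple_borel tuple_borel" and B: "B \<in> sets tuple_borel"
    and N: "prob_space N" and X: "iid_marked_points N \<Theta> r X"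
  defines "Q \<equiv> uniform_measure lborel {-r..r} \<Otimes>\<^sub>M \<Theta>"
  shows "kernel_mean R N X r B = bounded_symmetric_kernel.mean Q (hyp_kernel R r B)"
    and "sigma1 R N X r B = (\<integral>a. (bounded_symmetric_kernel.proj Q (hyp_kernel R r B) a)\<^sup>2 \<partial>Q)"
proof -
  let ?f = "hyp_kernel R r B"
  interpret K: bounded_symmetric_kernel Q "CARD('n)" ?f
    unfolding Q_def by (rule hyp_kernel_bounded_symmetric[OF T sets_T r R B])
  interpret N: prob_space N by fact
  have law: "distr N (PiM UNIV (\<lambda>_. lborel \<Otimes>\<^sub>M \<Theta>)) (\<lambda>\<omega> i. X i \<omega>) = K.seq_space"
    unfolding Q_def by (rule iid_marked_points_joint_law(1)[OF N X])
  have X_m: "X i \<in> measurable N (lborel \<Otimes>\<^sub>M \<Theta>)" for i by (rule iid_marked_points_joint_law(2)[OF N X])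
  have X_seq: "(\<lambda>\<omega> i. X i \<omega>) \<in> measurable N (PiM UNIV (\<lambda>_. lborel \<Otimes>\<^sub>M \<Theta>))"
    by (rule measurable_PiM_single') (use X_m measurable_space[OF X_m] in \<open>auto simp: space_PiM\<close>)
  have sets_Q: "sets Q = sets (lborel \<Otimes>\<^sub>M \<Theta>)" unfolding Q_def by (intro sets_pair_measure_cong) simp_all
  have integral_X: "(\<integral>\<omega>. g (\<lambda>i. X i \<omega>) \<partial>N) = (\<integral>x. g x \<partial>K.seq_space)"
    if "g \<in> borel_measurable K.seq_space" for g :: "_ \<Rightarrow> real"
  proof -
    have "g \<in> borel_measurable (PiM UNIV (\<lambda>_. lborel \<Otimes>\<^sub>M \<Theta>))"
      using that measurable_cong_sets[OF sets_PiM_cong[OF refl sets_Q] refl] by auto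
    then show ?thesis
      using integral_distr[OF X_seq, of g] by (simp add: law)
  qed
  show "kernel_mean R N X r B = K.mean"
    unfolding kernel_mean_def K.mean_def by (rule integral_X) measurable
  have "sigma1 R N X r B = (\<integral>x. ?f (\<lambda>i. x i) * ?f (\<lambda>i. x (CARD('n) - 1 + i)) \<partial>K.seq_space)"
    unfolding sigma1_def by (rule integral_X) measurable
  also have "\<dots> = (\<integral>a. (K.proj a)\<^sup>2 \<partial>Q)"
  \<comment> \<open>The tuples are \<open>i\<close> and \<open>d - 1 + i\<close> with
    \<open>d = CARD('n)\<close>: slot \<open>d - 1\<close> of the first and slot 0 of the second
    hold the shared variable.\<close>
  proof (rule K.integral_overlap_one)
    show "CARD('n) - 1 = CARD('n) - 1 + 0" by simp
  qed (use K.d_pos in \<open>auto simp: inj_on_def\<close>)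
  finally show "sigma1 R N X r B = (\<integral>a. (K.proj a)\<^sup>2 \<partial>Q)" .
qed

text \<open>The families \<open>X\<close> and \<open>X0\<close> need not be related, but
  \<open>sigma1\<close> depends on the law alone. So \<open>X\<close> may be replaced by a dilation
  of \<open>X0\<close>, for which the kernels agree pointwise.\<close>

lemma sigma1_scale:
  fixes R :: "(real ^ 'n::{finite,linorder}) rel" and \<Theta> :: "(real ^ 'n::{finite,linorder}) measure"
  assumes T: "prob_space \<Theta>" "sets \<Theta> = sets half_sphere_borel"
    and R: "sort_tuple R \<in> measurable tuple_borel tuple_borel" and B: "B \<in> sets tuple_borel"
    and N: "prob_space N" and r: "r > 0" "r0 > 0"
    and X: "iid_marked_points N \<Theta> r X" "iid_marked_points N \<Theta> r0 X0"
  shows "sigma1 R N X r B = sigma1 R N X0 r0 B"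
proof -
  define c where "c = r / r0"
  have c: "c > 0" "c * r0 = r" using r by (auto simp: c_def)
  let ?X' = "\<lambda>i \<omega>. (c * fst (X0 i \<omega>), snd (X0 i \<omega>))"
  have X': "iid_marked_points N \<Theta> r ?X'"
    using iid_marked_points_scale[OF N T(1) X(2) c(1) r(2)] c(2) by simp
  have "sigma1 R N X r B = sigma1 R N ?X' r B"
    by (simp only: kernel_mean_sigma1_eq(2)[OF T r(1) R B N X(1)] kernel_mean_sigma1_eq(2)[OF T r(1) R B N X'])
  also have "\<dots> = sigma1 R N X0 r0 B"
    unfolding sigma1_def c(2)[symmetric] hyp_kernel_scale[OF c(1)] ..
  finally show ?thesis .
qed

lemma intersection_count_measurable:
  fixes R :: "(real ^ 'n::{finite,linorder}) rel" and \<Theta> :: "(real ^ 'n::{finite,linorder}) measure"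
  assumes sets_T: "sets \<Theta> = sets half_sphere_borel"
    and R: "sort_tuple R \<in> measurable tuple_borel tuple_borel" and B: "B \<in> sets tuple_borel"
    and Y: "\<And>i. Y i \<in> measurable M (lborel \<Otimes>\<^sub>M \<Theta>)"
  shows "intersection_count R Y r B \<in> borel_measurable M"
proof -
  have f: "hyp_kernel R r B \<in> borel_measurable (PiM {..<CARD('n)} (\<lambda>_. lborel \<Otimes>\<^sub>M \<Theta>))"
    by (rule hyp_kernel_measurable[OF _ R B]) (intro sets_pair_measure_cong; simp add: sets_T)
  have "(\<lambda>\<omega>. hyp_kernel R r B (\<lambda>k. Y (\<iota> k) \<omega>)) \<in> borel_measurable M" for \<iota>
  proof -
    have "(\<lambda>\<omega>. hyp_kernel R r B (\<lambda>k\<in>{..<CARD('n)}. Y (\<iota> k) \<omega>)) \<in> borel_measurable M"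
      by (intro measurable_compose[OF measurable_restrict f] Y)
    moreover have "hyp_kernel R r B (\<lambda>k\<in>{..<CARD('n)}. Y (\<iota> k) \<omega>) = hyp_kernel R r B (\<lambda>k. Y (\<iota> k) \<omega>)" for \<omega>
      by (rule depends_onD[OF hyp_kernel_depends]) auto
    ultimately show ?thesis by simp
  qed
  then show ?thesis
    unfolding intersection_count_def
    by (intro borel_measurable_times borel_measurable_const borel_measurable_infsum)
       (use countable_inj_tuples[of "CARD('n)"] in \<open>auto simp: inj_tuples_def\<close>)
qed

text \<open>The limit variance is read off at one reference radius \<open>r0\<close>; by
  \<open>sigma1_scale\<close> every other radius gives the same value.\<close>

theorem theorem3p1:
  fixes M :: "'w measure" and N :: "'v measure"
    and \<Theta> :: "(real ^ 'n::{finite,linorder}) measure"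
    and R :: "(real ^ 'n::{finite,linorder}) rel"
    and Y :: "nat \<Rightarrow> 'w \<Rightarrow> real \<times> (real ^ 'n::{finite,linorder})"
    and X :: "real \<Rightarrow> nat \<Rightarrow> 'v \<Rightarrow> real \<times> (real ^ 'n::{finite,linorder})"
    and B :: "(nat \<Rightarrow> real ^ 'n::{finite,linorder}) set"
    and lam r0 :: real
  assumes "lam > 0"
    and "prob_space \<Theta>" and "sets \<Theta> = sets half_sphere_borel"
    and "\<And>L :: (real ^ 'n::{finite,linorder}) set. subspace L \<Longrightarrow> dim L = CARD('n) - 1 \<Longrightarrow>
           measure \<Theta> (L \<inter> half_sphere) < 1"
    and "linear_order_on half_sphere R"
    and "sort_tuple R \<in> measurable tuple_borel tuple_borel"
    and "prob_space M" and "poisson_hyperplane_process M lam \<Theta> Y"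
    and "prob_space N" and "\<And>r. r > 0 \<Longrightarrow> iid_marked_points N \<Theta> r (X r)"
    and "B \<in> sets tuple_borel"
    and "r0 > 0" and "sigma1 R N (X r0) r0 B > 0"
  shows "converges_in_distribution M
    (\<lambda>r \<omega>. fact (CARD('n) - 1) / (2 * lam * r) powr (real CARD('n) - 1 / 2) *
       (intersection_count R Y r B \<omega> -
        (2 * lam * r) ^ CARD('n) / fact (CARD('n)) * kernel_mean R N (X r) r B))
    (gaussian 0 (sigma1 R N (X r0) r0 B))
    at_top"
proof -
  note lam = \<open>lam > 0\<close> and T = \<open>prob_space \<Theta>\<close> \<open>sets \<Theta> = sets half_sphere_borel\<close>
    and R = \<open>sort_tuple R \<in> measurable tuple_borel tuple_borel\<close> and B = \<open>B \<in> sets tuple_borel\<close>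
    and N = \<open>prob_space N\<close> and X = \<open>\<And>r. r > 0 \<Longrightarrow> iid_marked_points N \<Theta> r (X r)\<close>
    and M = \<open>prob_space M\<close> and r0 = \<open>r0 > 0\<close>
  interpret T: prob_space \<Theta> by fact
  interpret LT: pair_sigma_finite lborel \<Theta> ..
  define d where "d = CARD('n)"
  define s2 where "s2 = sigma1 R N (X r0) r0 B"
  have s2: "s2 > 0" using assms(13) by (simp add: s2_def)
  define \<Lambda> :: "(real \<times> (real ^ 'n::{finite,linorder})) measure" where "\<Lambda> = scale_measure (ennreal lam) (lborel \<Otimes>\<^sub>M \<Theta>)"
  define W :: "real \<Rightarrow> (real \<times> (real ^ 'n::{finite,linorder})) set" where "W r = {-r..r} \<times> space \<Theta>" for r
  have Y: "poisson_process M \<Lambda> Y"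
    using assms(8) by (simp add: poisson_hyperplane_process_def \<Lambda>_def)
  have Y_m: "Y i \<in> measurable M (lborel \<Otimes>\<^sub>M \<Theta>)" for i
  proof -
    have "sets \<Lambda> = sets (lborel \<Otimes>\<^sub>M \<Theta>)" unfolding \<Lambda>_def by (rule sets_scale_measure)
    moreover have "Y i \<in> measurable M \<Lambda>" using Y unfolding poisson_process_def by blast
    ultimately show ?thesis using measurable_cong_sets[OF refl, of \<Lambda> "lborel \<Otimes>\<^sub>M \<Theta>" M] by blast
  qed
  have count_m: "intersection_count R Y r B \<in> borel_measurable M" for r
    by (rule intersection_count_measurable[OF T(2) R B Y_m])
  have sp_T: "space \<Theta> = half_sphere"
    using sets_eq_imp_space_eq[OF T(2)] by (simp add: space_restrict_space)
  let ?Z = "\<lambda>r \<omega>. fact (d - 1) / (2 * lam * r) powr (real d - 1 / 2) *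
       (intersection_count R Y r B \<omega> - (2 * lam * r) ^ d / fact d * kernel_mean R N (X r) r B)"
  have W_em: "emeasure \<Lambda> (W r) = ennreal (2 * lam * r)" if "r > 0" for r
  proof -
    have "emeasure (lborel \<Otimes>\<^sub>M \<Theta>) ({-r..r} \<times> space \<Theta>) = emeasure lborel {-r..r} * emeasure \<Theta> (space \<Theta>)"
      by (intro T.emeasure_pair_measure_Times) auto
    also have "\<dots> = ennreal (2 * r)" by (simp only: emeasure_lborel_symmetric[OF that] T.emeasure_space_1 mult_1_right)
    finally have "emeasure \<Lambda> (W r) = ennreal lam * ennreal (2 * r)" by (simp add: \<Lambda>_def W_def)
    also have "\<dots> = ennreal (lam * (2 * r))" using lam that by (intro ennreal_mult[symmetric]) auto
    finally show ?thesis by (simp add: mult_ac)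
  qed
  \<comment> \<open>Window, law and kernel all depend on \<open>r\<close>, so the abstract setting
    is interpreted inside the proof for one \<open>r\<close>; none of its constants occurs in the
    claim.\<close>
  have approx: "\<exists>z. cmod (char (distr M borel (?Z r)) t - exp z)
      \<le> \<bar>t\<bar> * clt_error d (2 * lam * r) ((1 + d) * (2 * lam * r) powr (- 3 / 8)) + 2 * (2 * lam * r) powr (- 1 / 4) \<and>
    cmod (z + complex_of_real (t\<^sup>2 / 2 * s2)) \<le> \<bar>t\<bar> ^ 3 / (6 * sqrt (2 * lam * r))"
    if r: "r > 0" "2 * lam * r \<ge> 1" "(1 + d) * (2 * lam * r) powr (- 3 / 8) \<le> 1 / 2" for r t
  proof -
    have W_me: "measure \<Lambda> (W r) = 2 * lam * r" using W_em[OF r(1)] lam r(1) by (simp add: measure_def)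
    have Q: "uniform_measure \<Lambda> (W r) = uniform_measure lborel {-r..r} \<Otimes>\<^sub>M \<Theta>"
      unfolding \<Lambda>_def W_def by (rule uniform_measure_window[OF T(1) lam r(1)])
    note mean_sigma = kernel_mean_sigma1_eq[OF T r(1) R B N X[OF r(1)], folded Q]
    interpret poisson_ustat M \<Lambda> Y "W r" d "hyp_kernel R r B"
    proof (rule poisson_ustat.intro[OF M poisson_ustat_axioms.intro[OF Y]])
      show "W r \<in> sets \<Lambda>" by (simp add: W_def \<Lambda>_def)
      show "emeasure \<Lambda> (W r) < \<infinity>" using W_em[OF r(1)] by simp
      show "measure \<Lambda> (W r) > 0" using W_me r lam by simp
      show "bounded_symmetric_kernel (uniform_measure \<Lambda> (W r)) d (hyp_kernel R r B)"
        unfolding Q d_def by (rule hyp_kernel_bounded_symmetric[OF T r(1) R B])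
      show "hyp_kernel R r B x = 0" if "\<forall>i<d. x i \<in> space \<Lambda>" "k < d" "x k \<notin> W r" for x k
      proof (rule hyp_kernel_zero)
        show "k < CARD('n)" using that by (simp add: d_def)
        have "x k \<in> UNIV \<times> half_sphere"
          using that by (simp add: \<Lambda>_def space_scale_measure space_pair_measure sp_T)
        then show "snd (x k) \<in> half_sphere" "fst (x k) \<notin> {-r..r}"
          using that(3) by (auto simp: W_def sp_T)
      qed
    qed
    have total: "intersection_count R Y r B = total"
      unfolding fun_eq_iff intersection_count_def total_def inj_tuples_def by (simp add: d_def)
    have "(\<integral>a. (K.proj a)\<^sup>2 \<partial>uniform_measure \<Lambda> (W r)) = s2"
      using mean_sigma(2) sigma1_scale[OF T R B N r(1) r0 X[OF r(1)] X[OF r0]] by (simp add: s2_def)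
    moreover have "kernel_mean R N (X r) r B = K.mean" by (rule mean_sigma(1))
    ultimately show ?thesis
      using total_normalized_char_approx[of t] count_m[of r] r unfolding total W_me by simp
  qed
  have \<mu>_top: "filterlim (\<lambda>r. 2 * lam * r) at_top at_top"
    using lam by (intro filterlim_tendsto_pos_mult_at_top[OF tendsto_const _ filterlim_ident]) auto
  have "((\<lambda>\<mu>. (1 + d) * \<mu> powr (- 3 / 8)) \<longlongrightarrow> (0::real)) at_top" by real_asymp
  then have "\<forall>\<^sub>F \<mu> in at_top. (1 + d) * \<mu> powr (- 3 / 8) < (1 / 2 :: real)"
    by (rule order_tendstoD) simp
  then have ev\<epsilon>: "\<forall>\<^sub>F r in at_top. (1 + d) * (2 * lam * r) powr (- 3 / 8) < 1 / 2"
    by (rule eventually_compose_filterlim[OF _ \<mu>_top])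
  have ev\<mu>: "\<forall>\<^sub>F r in at_top. 2 * lam * r \<ge> 1"
    using \<mu>_top by (simp add: filterlim_at_top)
  \<comment> \<open>A suitable exponent is known to exist for large \<open>r\<close> only; for other
    \<open>r\<close> the choice is arbitrary, and its properties are asserted eventually.\<close>
  define z where "z t r = (SOME z. cmod (char (distr M borel (?Z r)) t - exp z)
      \<le> \<bar>t\<bar> * clt_error d (2 * lam * r) ((1 + d) * (2 * lam * r) powr (- 3 / 8)) + 2 * (2 * lam * r) powr (- 1 / 4) \<and>
    cmod (z + complex_of_real (t\<^sup>2 / 2 * s2)) \<le> \<bar>t\<bar> ^ 3 / (6 * sqrt (2 * lam * r)))" for t r
  have ev: "\<forall>\<^sub>F r in at_top. cmod (char (distr M borel (?Z r)) t - exp (z t r))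
      \<le> \<bar>t\<bar> * clt_error d (2 * lam * r) ((1 + d) * (2 * lam * r) powr (- 3 / 8)) + 2 * (2 * lam * r) powr (- 1 / 4) \<and>
    cmod (z t r + complex_of_real (t\<^sup>2 / 2 * s2)) \<le> \<bar>t\<bar> ^ 3 / (6 * sqrt (2 * lam * r))" for t
    using ev\<epsilon> ev\<mu> eventually_gt_at_top[of 0]
    by eventually_elim (unfold z_def, rule someI_ex, rule approx, auto)
  have "converges_in_distribution M ?Z (gaussian 0 s2) at_top"
  proof (rule converges_in_distribution_char[OF M _ real_distribution_gaussian[OF s2]])
    show "?Z r \<in> borel_measurable M" for r using count_m[of r] by measurable
    fix t
    \<comment> \<open>Convergence is proved for exponents and carried over by continuity of
      \<open>exp\<close>, so that no branch of the complex logarithm is involved.\<close>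
    have "((\<lambda>r. z t r + complex_of_real (t\<^sup>2 / 2 * s2)) \<longlongrightarrow> 0) at_top"
    proof (rule Lim_null_comparison)
      show "\<forall>\<^sub>F r in at_top. cmod (z t r + complex_of_real (t\<^sup>2 / 2 * s2)) \<le> \<bar>t\<bar> ^ 3 / (6 * sqrt (2 * lam * r))"
        using ev[of t] by eventually_elim simp
      show "((\<lambda>r. \<bar>t\<bar> ^ 3 / (6 * sqrt (2 * lam * r))) \<longlongrightarrow> 0) at_top"
        using lam by real_asymp
    qed
    from tendsto_add[OF this tendsto_const[of "- complex_of_real (t\<^sup>2 / 2 * s2)"]]
    have "(z t \<longlongrightarrow> - complex_of_real (t\<^sup>2 / 2 * s2)) at_top" by simp
    then have lim_z: "((\<lambda>r. exp (z t r)) \<longlongrightarrow> exp (- complex_of_real (t\<^sup>2 / 2 * s2))) at_top"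
      by (rule tendsto_exp)
    have "((\<lambda>r. char (distr M borel (?Z r)) t - exp (z t r)) \<longlongrightarrow> 0) at_top"
    proof (rule Lim_null_comparison)
      show "\<forall>\<^sub>F r in at_top. cmod (char (distr M borel (?Z r)) t - exp (z t r)) \<le>
        \<bar>t\<bar> * clt_error d (2 * lam * r) ((1 + d) * (2 * lam * r) powr (- 3 / 8)) + 2 * (2 * lam * r) powr (- 1 / 4)"
        using ev[of t] by eventually_elim simp
      show "((\<lambda>r. \<bar>t\<bar> * clt_error d (2 * lam * r) ((1 + d) * (2 * lam * r) powr (- 3 / 8)) + 2 * (2 * lam * r) powr (- 1 / 4)) \<longlongrightarrow> 0) at_top"
        using filterlim_compose[OF clt_error_tendsto[of t d] \<mu>_top] by simp
    qed
    from tendsto_add[OF this lim_z]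
    show "((\<lambda>r. char (distr M borel (?Z r)) t) \<longlongrightarrow> char (gaussian 0 s2) t) at_top"
      by (simp add: char_gaussian[OF s2])
  qed
  then show ?thesis by (simp only: d_def s2_def)
qed

end
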